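(* Let $G$ be a compact abelian group, $\gamma\in\Gamma$, $s\ge0$, and suppose that $\xi\mapsto(1+\gamma(\xi)^2)^{-1}$ belongs to $L^\alpha(G^\wedge,\mu_{G^\wedge})$ for some $\alpha>s$. Put $\alpha^*=\frac{2\alpha}{\alpha-s}$. Assume moreover that \[ \sup_{\xi\in G^\wedge}\frac{|\xi(h)-1|}{(1+\gamma(\xi)^2)^s}\longrightarrow 0\quad\text{as } h\to e, \] i.e. for every $\epsilon>0$ there is an open neighbourhood $U_\epsilon$ of the identity $e$ of $G$ such that $\frac{|\xi(h)-1|}{(1+\gamma(\xi)^2)^s}\le\epsilon$ for all $h\in U_\epsilon$ and all $\xi\in G^\wedge$. Then for every $p$ with $1\le p<\alpha^*$, the embedding $H^s_\gamma(G)\hookrightarrow L^p_{\mu_G}(G)$ is compact: every sequence bounded in $H^s_\gamma(G)$ has a subsequence converging in $L^p_{\mu_G}(G)$.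
   Context: $G$ is a locally compact abelian group with Haar measure $\mu_G$; $G^\wedge$ is its dual group (continuous homomorphisms $G\to\{z\in\mathbb C:|z|=1\}$, a locally compact abelian group under pointwise multiplication) with Haar measure $\mu_{G^\wedge}$ normalized so that the Plancherel theorem and Fourier inversion hold. For $f\in L^1_{\mu_G}(G)$, $\hat f(\xi)=\int_G\overline{\xi(x)}f(x)\,d\mu_G(x)$, extended to $L^2$ by Plancherel. $\Gamma$ is the set of functions $\gamma:G^\wedge\to[0,\infty)$ for which there is a constant $c_\gamma$ with $\gamma(\alpha\beta)\le c_\gamma[\gamma(\alpha)+\gamma(\beta)]$ for all $\alpha,\beta\in G^\wedge$. For $\gamma\in\Gamma$ and real $s\ge0$, $H^s_\gamma(G)$ is the set of $f\in L^2_{\mu_G}(G)$ with $\|f\|_{H^s_\gamma(G)}=\left(\int_{G^\wedge}(1+\gamma(\xi)^2)^s|\hat f(\xi)|^2\,d\mu_{G^\wedge}(\xi)\right)^{1/2}<\infty$. *)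

theory Defs
  imports "HOL-Analysis.Analysis"
begin

text \<open>Compact abelian groups are modelled as a type of class topological_ab_group_add
  (additive notation, identity 0) which is Hausdorff, with UNIV compact.\<close>

definition haar_measure :: "'a::topological_ab_group_add measure \<Rightarrow> bool" where
  "haar_measure M \<longleftrightarrow>
     space M = UNIV \<and> sets M = sets borel \<and>
     0 < emeasure M UNIV \<and>
     (\<forall>A\<in>sets M. \<forall>x. emeasure M ((\<lambda>y. x + y) ` A) = emeasure M A) \<and>
     (\<forall>A\<in>sets M. emeasure M A = (INF U\<in>{U. open U \<and> A \<subseteq> U}. emeasure M U)) \<and>
     (\<forall>U. open U \<longrightarrow> emeasure M U = (SUP K\<in>{K. compact K \<and> K \<subseteq> U}. emeasure M K)) \<and>
     (\<forall>K. compact K \<longrightarrow> emeasure M K < \<infinity>)"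

definition dual_group :: "('a::topological_ab_group_add \<Rightarrow> complex) set" where
  "dual_group = {\<xi>. continuous_on UNIV \<xi> \<and> (\<forall>x y. \<xi> (x + y) = \<xi> x * \<xi> y)
                      \<and> (\<forall>x. cmod (\<xi> x) = 1)}"

text \<open>For compact G the dual is discrete, and the Haar measure on it normalised so that
  Plancherel holds is counting measure times 1 / mu_G(G).\<close>
definition dual_measure :: "'a::topological_ab_group_add measure \<Rightarrow> ('a \<Rightarrow> complex) measure" where
  "dual_measure M = density (count_space dual_group) (\<lambda>_. 1 / emeasure M UNIV)"

definition Gamma_class :: "(('a::topological_ab_group_add \<Rightarrow> complex) \<Rightarrow> real) \<Rightarrow> bool" where
  "Gamma_class \<gamma> \<longleftrightarrow> (\<forall>\<xi>\<in>dual_group. 0 \<le> \<gamma> \<xi>) \<and>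
     (\<exists>c. \<forall>\<alpha>\<in>dual_group. \<forall>\<beta>\<in>dual_group. \<gamma> (\<lambda>x. \<alpha> x * \<beta> x) \<le> c * (\<gamma> \<alpha> + \<gamma> \<beta>))"

text \<open>Fourier transform (G compact, so L^2 is contained in L^1).\<close>
definition fourier :: "'a::topological_ab_group_add measure \<Rightarrow> ('a \<Rightarrow> complex) \<Rightarrow> ('a \<Rightarrow> complex) \<Rightarrow> complex" where
  "fourier M f \<xi> = (LINT x|M. cnj (\<xi> x) * f x)"

definition in_Lp :: "'b measure \<Rightarrow> real \<Rightarrow> ('b \<Rightarrow> complex) \<Rightarrow> bool" where
  "in_Lp M p f \<longleftrightarrow> f \<in> borel_measurable M \<and> (\<integral>\<^sup>+ x. ennreal (cmod (f x) powr p) \<partial>M) < \<infinity>"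

definition sobolev_norm_sq :: "'a::topological_ab_group_add measure \<Rightarrow> (('a \<Rightarrow> complex) \<Rightarrow> real) \<Rightarrow> real
     \<Rightarrow> ('a \<Rightarrow> complex) \<Rightarrow> ennreal" where
  "sobolev_norm_sq M \<gamma> s f =
     (\<integral>\<^sup>+ \<xi>. ennreal ((1 + (\<gamma> \<xi>)\<^sup>2) powr s * (cmod (fourier M f \<xi>))\<^sup>2) \<partial>dual_measure M)"

end

theory Submission
  imports Defs "HOL-Complex_Analysis.Great_Picard"
begin

text \<open>
  Write \<open>w = 1 + \<gamma>\<^sup>2\<close>. Summability of \<open>w\<close> to the power \<open>-\<alpha>\<close> makes every set \<open>{\<xi>. w \<xi> \<le> A}\<close>
  finite, and on a Sobolev ball the part of \<open>f\<close> with frequencies outside this set has mean square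
  of order \<open>A\<close> to the power \<open>-s\<close>. Hence a diagonal subsequence along which all Fourier
  coefficients converge is Cauchy in \<open>L\<^sup>2\<close>. The part of \<open>f\<close> with frequencies inside is bounded
  by a multiple of \<open>A\<close> to the power \<open>(\<alpha> - s) / 2\<close>; optimising in \<open>A\<close> bounds the Sobolev ball in
  weak \<open>L\<close> to the power \<open>2\<alpha> / (\<alpha> - s)\<close>, and interpolation with \<open>L\<^sup>2\<close> turns the \<open>L\<^sup>2\<close> Cauchy
  sequence into an \<open>L\<close>-\<open>p\<close> Cauchy sequence. For \<open>s = 0\<close> the tail is trivial because the
  equicontinuity hypothesis forces the dual group to be finite.

  Completeness of the characters is obtained without the spectral theorem: the normalised
  convolution powers of a Hermitian kernel converge uniformly to an idempotent, and an idempotent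
  of almost minimal norm is a multiple of a character.
\<close>

section \<open>Integration of continuous functions on a compact group\<close>

text \<open>The group need not be metrizable or second countable. Continuity is therefore not tested
  on sequences of points, and double integrals rest on approximation by finitely many tubes. The
  analytic core is that characters separate points; Stone-Weierstrass and regularity of the measure
  then give density in mean square. Heuristically, a Hermitian kernel expands in characters with
  real eigenvalues \<lambda>, its power with n + 1 factors has squared norm proportional to the sum
  of \<open>\<lambda>^(2n+2)\<close>, and the largest \<open>\<lambda>^2\<close> appears as the
  limit of the ratios of these norms. An idempotent projecting onto d characters has squared norm d
  / \<mu>, which is why a slack of 1 / \<mu> is the right meaning of "almost minimal". A strong
  endpoint embedding would call for the Hausdorff-Young inequality. The weak-type bound needs only
  Cauchy-Schwarz and Chebyshev, and it suffices because p lies strictly below the critical exponent.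
  At height t the cut-off has \<open>A^(\<alpha> - s)\<close> of order \<open>t^2\<close>, so the
  distribution function is at most of order \<open>A^(-s) / t^2\<close>, that is,
  \<open>t^(-2\<alpha>/(\<alpha> - s))\<close>.\<close>

locale compact_haar =
  fixes M :: "'a::{topological_ab_group_add, t2_space} measure"
  assumes compact_G: "compact (UNIV :: 'a set)"
    and haar: "haar_measure M"
begin

lemma space_M [simp]: "space M = UNIV"
  and sets_M [measurable_cong, simp]: "sets M = sets borel"
  and emeasure_UNIV_pos: "0 < emeasure M UNIV"
  and emeasure_translation: "A \<in> sets M \<Longrightarrow> emeasure M ((+) x ` A) = emeasure M A"
  and outer_regular:
    "A \<in> sets M \<Longrightarrow> emeasure M A = (INF U\<in>{U. open U \<and> A \<subseteq> U}. emeasure M U)"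
  and emeasure_compact: "compact K \<Longrightarrow> emeasure M K < \<infinity>"
proof -
  note h = haar[unfolded haar_measure_def]
  show "space M = UNIV" using h by (elim conjE)
  show "sets M = sets borel" using h by (elim conjE)
  show "0 < emeasure M UNIV" using h by (elim conjE)
  show "emeasure M ((+) x ` A) = emeasure M A" if "A \<in> sets M"
    using h that by (elim conjE) (drule (1) bspec, erule spec)
  show "emeasure M A = (INF U\<in>{U. open U \<and> A \<subseteq> U}. emeasure M U)" if "A \<in> sets M"
    using h that by (elim conjE) (rotate_tac 4, drule (1) bspec)
  show "emeasure M K < \<infinity>" if "compact K"
    using h that by (elim conjE) (rotate_tac -2, drule spec, erule (1) mp)
qed

sublocale finite_measure M
proof (rule finite_measureI)
  show "emeasure M (space M) \<noteq> \<infinity>" using emeasure_compact[OF compact_G] by simp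
qed

definition \<mu> :: real where "\<mu> = measure M UNIV"

lemma emeasure_UNIV: "emeasure M UNIV = ennreal \<mu>"
  unfolding \<mu>_def by (rule emeasure_eq_measure)

lemma mu_pos: "0 < \<mu>"
  using emeasure_UNIV_pos by (simp add: emeasure_UNIV)

lemma cont_measurable:
  fixes f :: "'a \<Rightarrow> 'b::topological_space"
  assumes "continuous_on UNIV f"
  shows "f \<in> borel_measurable M"
  using borel_measurable_continuous_onI[OF assms] by simp

lemma cont_bounded:
  fixes f :: "'a \<Rightarrow> 'b::real_normed_vector"
  assumes "continuous_on UNIV f"
  obtains B where "B > 0" "\<And>x. norm (f x) \<le> B"
proof -
  have "bounded (range f)"
    using compact_continuous_image[OF assms compact_G] by (rule compact_imp_bounded)
  then show ?thesis using that unfolding bounded_pos by auto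
qed

lemma cont_integrable:
  fixes f :: "'a \<Rightarrow> 'b::{banach, second_countable_topology}"
  assumes "continuous_on UNIV f"
  shows "integrable M f"
proof -
  obtain B where "\<And>x. norm (f x) \<le> B" using cont_bounded[OF assms] by metis
  then show ?thesis
    using cont_measurable[OF assms] by (intro integrable_const_bound[of _ B]) auto
qed

lemma cont_section:
  fixes F :: "'a \<times> 'a \<Rightarrow> complex"
  assumes "continuous_on UNIV F"
  shows "continuous_on UNIV (\<lambda>y. F (x, y))" "continuous_on UNIV (\<lambda>x. F (x, y))"
  by (auto intro!: continuous_on_compose2[OF assms] continuous_intros)

section \<open>Product measurability, Fubini and parameter integrals for continuous
  functions\<close>

lemma tube:
  fixes F :: "'a \<times> 'a \<Rightarrow> complex"
  assumes "continuous_on UNIV F" "e > 0"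
  obtains X where "x0 \<in> X" "open X" "\<And>x y. x \<in> X \<Longrightarrow> dist (F (x, y)) (F (x0, y)) \<le> e"
proof -
  have "continuous_on (UNIV \<times> UNIV) F" using assms(1) by simp
  then obtain X where "x0 \<in> X" "open X"
    "\<forall>x\<in>X \<inter> UNIV. \<forall>y\<in>UNIV. dist (F (x, y)) (F (x0, y)) \<le> e"
    using continuous_on_prod_compactE[OF _ compact_G UNIV_I assms(2)] by metis
  then show ?thesis using that by simp
qed

text \<open>Compactness of the first factor leaves finitely many tubes. On each of them
  \<open>F\<close> is replaced by a function of the second variable alone, so the approximant is a
  finite patchwork that is visibly measurable for the product sigma-algebra.\<close>

lemma step_approximation:
  fixes F :: "'a \<times> 'a \<Rightarrow> complex"
  assumes F: "continuous_on UNIV F" and e: "e > 0"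
  obtains G where "G \<in> borel_measurable (M \<Otimes>\<^sub>M M)" "\<And>p. dist (F p) (G p) \<le> e"
proof -
  define C where "C = {X. open X \<and> (\<exists>x0. \<forall>x\<in>X. \<forall>y. dist (F (x, y)) (F (x0, y)) \<le> e)}"
  have "UNIV \<subseteq> \<Union>C"
  proof
    fix x0 :: 'a
    obtain X where "x0 \<in> X" "open X" "\<And>x y. x \<in> X \<Longrightarrow> dist (F (x, y)) (F (x0, y)) \<le> e"
      using tube[OF F e] by metis
    then show "x0 \<in> \<Union>C" unfolding C_def by blast
  qed
  moreover have "\<And>X. X \<in> C \<Longrightarrow> open X" unfolding C_def by auto
  ultimately obtain T where T: "T \<subseteq> C" "finite T" "UNIV \<subseteq> \<Union>T"
    using compactE[OF compact_G] by metis
  have "\<exists>G\<in>borel_measurable (M \<Otimes>\<^sub>M M). \<forall>x\<in>\<Union>T. \<forall>y. dist (F (x, y)) (G (x, y)) \<le> e"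
    using T(2,1)
  proof (induction T)
    case empty
    show ?case by (intro bexI[of _ "\<lambda>_. 0"]) auto
  next
    case (insert X T)
    then obtain G where [measurable]: "G \<in> borel_measurable (M \<Otimes>\<^sub>M M)"
      and G: "\<And>x y. x \<in> \<Union>T \<Longrightarrow> dist (F (x, y)) (G (x, y)) \<le> e" by auto
    have "X \<in> C" using insert.prems by simp
    then have X: "open X" and "\<exists>x0. \<forall>x\<in>X. \<forall>y. dist (F (x, y)) (F (x0, y)) \<le> e"
      unfolding C_def by simp_all
    then obtain x0 where x0: "\<forall>x\<in>X. \<forall>y. dist (F (x, y)) (F (x0, y)) \<le> e"
      by (elim exE)
    have [measurable]: "X \<in> sets M" using X by simp
    have [measurable]: "(\<lambda>y. F (x0, y)) \<in> borel_measurable M"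
      by (rule cont_measurable[OF cont_section(1)[OF F]])
    show ?case
    \<comment> \<open>The section of the new tube overrides the earlier approximant, so overlapping
      tubes need not be made disjoint.\<close>
    proof (intro bexI[of _ "\<lambda>p. if fst p \<in> X then F (x0, snd p) else G p"])
      show "(\<lambda>p. if fst p \<in> X then F (x0, snd p) else G p) \<in> borel_measurable (M \<Otimes>\<^sub>M M)"
        by measurable
      show "\<forall>x\<in>\<Union>(insert X T). \<forall>y.
          dist (F (x, y)) (if fst (x, y) \<in> X then F (x0, snd (x, y)) else G (x, y)) \<le> e"
      proof (intro ballI allI)
        fix x y assume "x \<in> \<Union>(insert X T)"
        then show "dist (F (x, y)) (if fst (x, y) \<in> X then F (x0, snd (x, y)) else G (x, y)) \<le> e"
          using x0 G[of x y] by (cases "x \<in> X") simp_all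
      qed
    qed
  qed
  then obtain G where Gm: "G \<in> borel_measurable (M \<Otimes>\<^sub>M M)"
    and G: "\<forall>x\<in>\<Union>T. \<forall>y. dist (F (x, y)) (G (x, y)) \<le> e"
    by (elim bexE)
  have "dist (F p) (G p) \<le> e" for p
  proof -
    have "fst p \<in> \<Union>T" using T(3) by blast
    then show ?thesis using G[rule_format, of "fst p" "snd p"] by simp
  qed
  then show ?thesis by (rule that[OF Gm])
qed

text \<open>The product sigma-algebra may be smaller than the Borel sets of the product space.\<close>

lemma cont_measurable_pair:
  fixes F :: "'a \<times> 'a \<Rightarrow> complex"
  assumes F: "continuous_on UNIV F"
  shows "F \<in> borel_measurable (M \<Otimes>\<^sub>M M)"
proof -
  have "\<exists>G\<in>borel_measurable (M \<Otimes>\<^sub>M M). \<forall>p. dist (F p) (G p) \<le> 1 / real (Suc n)" for n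
  proof (rule step_approximation[OF F, of "1 / real (Suc n)"])
    fix G :: "'a \<times> 'a \<Rightarrow> complex"
    assume "G \<in> borel_measurable (M \<Otimes>\<^sub>M M)" "\<And>p. dist (F p) (G p) \<le> 1 / real (Suc n)"
    then show ?thesis by blast
  qed simp
  then obtain G where G: "\<And>n. G n \<in> borel_measurable (M \<Otimes>\<^sub>M M)"
    "\<And>n p. dist (F p) (G n p) \<le> 1 / real (Suc n)" by metis
  show ?thesis
  proof (rule borel_measurable_LIMSEQ_metric[OF G(1)])
    fix p
    have "(\<lambda>n. dist (G n p) (F p)) \<longlonglongrightarrow> 0"
      by (rule tendsto_sandwich[OF _ _ tendsto_const lim_1_over_n[THEN LIMSEQ_Suc]])
        (use G(2) in \<open>auto simp: dist_commute\<close>)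
    then show "(\<lambda>n. G n p) \<longlonglongrightarrow> F p" by (rule tendsto_dist_iff[THEN iffD2])
  qed
qed

lemma cont_integrable_pair:
  fixes F :: "'a \<times> 'a \<Rightarrow> complex"
  assumes F: "continuous_on UNIV F"
  shows "integrable (M \<Otimes>\<^sub>M M) F"
proof -
  interpret P: pair_sigma_finite M M ..
  interpret PF: finite_measure "M \<Otimes>\<^sub>M M"
    by (intro finite_measureI) (simp add: space_pair_measure emeasure_pair_measure_Times
        ennreal_mult_eq_top_iff emeasure_UNIV del: UNIV_Times_UNIV)
  have "compact (UNIV :: ('a \<times> 'a) set)"
    using compact_Times[OF compact_G compact_G] by simp
  then have "bounded (range F)"
    using compact_continuous_image[OF F] compact_imp_bounded by blast
  then obtain B where "\<And>p. norm (F p) \<le> B" unfolding bounded_iff by auto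
  then show ?thesis
    using cont_measurable_pair[OF F] by (intro PF.integrable_const_bound[of _ B]) auto
qed

lemma cont_Fubini:
  fixes F :: "'a \<times> 'a \<Rightarrow> complex"
  assumes F: "continuous_on UNIV F"
  shows "(LINT y|M. LINT x|M. F (x, y)) = (LINT x|M. LINT y|M. F (x, y))"
proof -
  interpret P: pair_sigma_finite M M ..
  show ?thesis
    using P.Fubini_integral[of "\<lambda>x y. F (x, y)"] cont_integrable_pair[OF F]
    by simp
qed

text \<open>Dominated convergence would only give sequential continuity. A tube instead makes the
  integrands uniformly close in the second variable, and the measure is finite.\<close>

lemma cont_integral_section:
  fixes F :: "'a \<times> 'a \<Rightarrow> complex"
  assumes F: "continuous_on UNIV F"
  shows "continuous_on UNIV (\<lambda>x. LINT y|M. F (x, y))"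
  unfolding continuous_on_eq_continuous_at[OF open_UNIV] continuous_at
proof (intro ballI tendstoI)
  fix x0 :: 'a and e :: real assume "e > 0"
  then have "e / (2 * \<mu>) > 0" using mu_pos by simp
  then obtain X where X: "x0 \<in> X" "open X"
    and le: "\<And>x y. x \<in> X \<Longrightarrow> dist (F (x, y)) (F (x0, y)) \<le> e / (2 * \<mu>)"
    using tube[OF F] by metis
  have "dist (LINT y|M. F (x, y)) (LINT y|M. F (x0, y)) < e" if "x \<in> X" for x
  proof -
    note int = cont_integrable[OF cont_section(1)[OF F]]
    have "dist (LINT y|M. F (x, y)) (LINT y|M. F (x0, y)) = norm (LINT y|M. F (x, y) - F (x0, y))"
      using int by (simp add: dist_norm)
    also have "\<dots> \<le> (LINT y|M. norm (F (x, y) - F (x0, y)))" by (rule integral_norm_bound)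
    also have "\<dots> \<le> (LINT y|M. e / (2 * \<mu>))"
      using le[OF that] int by (intro integral_mono) (auto simp: dist_norm)
    also have "\<dots> = e / 2" using mu_pos by (simp add: \<mu>_def)
    finally show ?thesis using \<open>e > 0\<close> by simp
  qed
  then show "\<forall>\<^sub>F x in at x0. dist (LINT y|M. F (x, y)) (LINT y|M. F (x0, y)) < e"
    using X unfolding eventually_at_topological by blast
qed

section \<open>Invariance of the integral under translation and reflection\<close>

lemma distr_translation: "distr M M ((+) a) = M"
proof (rule measure_eqI)
  fix A assume "A \<in> sets (distr M M ((+) a))"
  then have A: "A \<in> sets M" by simp
  have [measurable]: "(+) a \<in> measurable M M"
    using cont_measurable[of "(+) a"] by (simp add: continuous_intros)
  have "(+) a -` A = (+) (- a) ` A"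
  proof (intro set_eqI iffI)
    fix x assume "x \<in> (+) a -` A"
    then have "a + x \<in> A" "x = - a + (a + x)" by auto
    then show "x \<in> (+) (- a) ` A" by blast
  qed auto
  then have "emeasure (distr M M ((+) a)) A = emeasure M ((+) (- a) ` A)"
    using A by (simp add: emeasure_distr)
  also have "\<dots> = emeasure M A" using A by (rule emeasure_translation)
  finally show "emeasure (distr M M ((+) a)) A = emeasure M A" .
qed simp

lemma integral_translation:
  fixes f :: "'a \<Rightarrow> 'b::{banach, second_countable_topology}"
  assumes "f \<in> borel_measurable M"
  shows "(LINT x|M. f (a + x)) = (LINT x|M. f x)"
proof -
  have "(+) a \<in> measurable M M"
    using cont_measurable[of "(+) a"] by (simp add: continuous_intros)
  from integral_distr[OF this assms] show ?thesis by (simp add: distr_translation)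
qed

lemma cont_shift:
  fixes f :: "'a \<Rightarrow> complex"
  assumes "continuous_on UNIV f"
  shows "continuous_on UNIV (\<lambda>x. f (x + a))" "continuous_on UNIV (\<lambda>x. f (a + x))"
    "continuous_on UNIV (\<lambda>x. f (x - a))" "continuous_on UNIV (\<lambda>x. f (a - x))"
    "continuous_on UNIV (\<lambda>x. f (- x))"
  by (auto intro!: continuous_on_compose2[OF assms] continuous_intros)

text \<open>Unimodularity by Fubini: integrating \<open>f (x - y)\<close> first over
  \<open>x\<close> gives the integral of \<open>f\<close>, first over \<open>y\<close> that of its
  reflection, and the outer integration multiplies both by \<mu>.\<close>

lemma integral_reflection:
  fixes f :: "'a \<Rightarrow> complex"
  assumes f: "continuous_on UNIV f"
  shows "(LINT x|M. f (- x)) = (LINT x|M. f x)"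
proof -
  have "continuous_on UNIV (\<lambda>p::'a\<times>'a. f (fst p - snd p))"
    by (rule continuous_on_compose2[OF f]) (auto intro!: continuous_intros)
  from cont_Fubini[OF this]
  have eq: "(LINT y|M. LINT x|M. f (x - y)) = (LINT x|M. LINT y|M. f (x - y))"
    unfolding fst_conv snd_conv .
  have "(LINT x|M. f (x - y)) = (LINT x|M. f x)" for y
    using integral_translation[of f "- y"] cont_measurable[OF f] by simp
  moreover have "(LINT y|M. f (x - y)) = (LINT y|M. f (- y))" for x
    using integral_translation[of "\<lambda>y. f (- y)" "- x"] cont_measurable[OF cont_shift(5)[OF f]] by simp
  ultimately have "\<mu> *\<^sub>R (LINT x|M. f x) = \<mu> *\<^sub>R (LINT x|M. f (- x))"
    using eq by (simp only: lebesgue_integral_const \<mu>_def space_M)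
  then show ?thesis using mu_pos by simp
qed

end

section \<open>The convolution algebra\<close>

context compact_haar
begin

abbreviation cont :: "('a \<Rightarrow> complex) \<Rightarrow> bool" where
  "cont \<equiv> continuous_on UNIV"

definition conv :: "('a \<Rightarrow> complex) \<Rightarrow> ('a \<Rightarrow> complex) \<Rightarrow> 'a \<Rightarrow> complex" where
  "conv f g x = (LINT y|M. f (x - y) * g y)"

text \<open>The involution of the convolution algebra: \<open>adj k = k\<close> says that
  convolution with \<open>k\<close> is a self-adjoint operator.\<close>

definition adj :: "('a \<Rightarrow> complex) \<Rightarrow> 'a \<Rightarrow> complex" where
  "adj f x = cnj (f (- x))"

text \<open>The squared norm. Estimates are stated between squares, with a factor 2 in place of the
  triangle inequality.\<close>

definition l2 :: "('a \<Rightarrow> complex) \<Rightarrow> real" where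
  "l2 f = (LINT x|M. (norm (f x))\<^sup>2)"

lemma cont_compose_pair:
  assumes "cont f" "continuous_on UNIV h"
  shows "continuous_on UNIV (\<lambda>p::'a \<times> 'a. f (h p))"
  by (rule continuous_on_compose2[OF assms]) simp

lemma cont_adj: "cont f \<Longrightarrow> cont (adj f)"
  unfolding adj_def by (intro continuous_intros cont_shift(5))

lemma cont_conv:
  assumes "cont f" "cont g"
  shows "cont (conv f g)"
proof -
  have "continuous_on UNIV (\<lambda>p::'a \<times> 'a. f (fst p - snd p) * g (snd p))"
    by (intro continuous_on_mult cont_compose_pair[OF assms(1)] cont_compose_pair[OF assms(2)]
        continuous_intros)
  from cont_integral_section[OF this] show ?thesis unfolding conv_def by simp
qed

lemma conv_integrand:
  assumes "cont f" "cont g"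
  shows "integrable M (\<lambda>y. f (x - y) * g y)"
  by (intro cont_integrable continuous_on_mult assms(2) cont_shift[OF assms(1)])

lemma integral_point_reflection:
  assumes "cont f"
  shows "(LINT y|M. f (x - y)) = (LINT y|M. f y)"
proof -
  have "(LINT y|M. f (x - y)) = (LINT y|M. f (x + y))"
    using integral_reflection[OF cont_shift(2)[OF assms], of x] by simp
  then show ?thesis using integral_translation[OF cont_measurable[OF assms]] by simp
qed

lemma conv_commute:
  assumes "cont f" "cont g"
  shows "conv f g = conv g f"
proof
  fix x
  have "cont (\<lambda>y. f (x - y) * g y)"
    by (intro continuous_on_mult assms(2) cont_shift[OF assms(1)])
  from integral_point_reflection[OF this, of x] show "conv f g x = conv g f x"
    by (simp add: conv_def mult.commute)
qed

text \<open>Fubini, followed by translating the inner variable by \<open>y\<close>.\<close>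

lemma conv_assoc:
  assumes "cont f" "cont g" "cont h"
  shows "conv (conv f g) h = conv f (conv g h)"
proof
  fix x
  have F: "continuous_on UNIV (\<lambda>p::'a\<times>'a. f (x - fst p) * (g (fst p - snd p) * h (snd p)))"
  proof -
    have f: "continuous_on UNIV (\<lambda>p::'a \<times> 'a. f (x - fst p))"
      by (intro cont_compose_pair[OF assms(1)] continuous_intros)
    have g: "continuous_on UNIV (\<lambda>p::'a \<times> 'a. g (fst p - snd p))"
      by (intro cont_compose_pair[OF assms(2)] continuous_intros)
    have h: "continuous_on UNIV (\<lambda>p::'a \<times> 'a. h (snd p))"
      by (intro cont_compose_pair[OF assms(3)] continuous_intros)
    show ?thesis by (intro continuous_on_mult f g h)
  qed
  have 1: "conv f (conv g h) x = (LINT z|M. LINT y|M. f (x - z) * (g (z - y) * h y))"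
    unfolding conv_def by (subst Bochner_Integration.integral_mult_right_zero) (rule refl)
  note 2 = cont_Fubini[OF F, unfolded fst_conv snd_conv, symmetric]
  have 3: "(LINT y|M. LINT z|M. f (x - z) * (g (z - y) * h y))
      = (LINT y|M. LINT z|M. f (x - y - z) * g z * h y)"
  proof (rule Bochner_Integration.integral_cong[OF refl])
    fix y
    have "cont (\<lambda>z. f (x - z) * (g (z - y) * h y))"
      by (intro continuous_on_mult cont_shift[OF assms(1)] cont_shift[OF assms(2)] continuous_on_const)
    from integral_translation[OF cont_measurable[OF this], of y]
    show "(LINT z|M. f (x - z) * (g (z - y) * h y)) = (LINT z|M. f (x - y - z) * g z * h y)"
      by (simp add: diff_diff_eq mult.assoc)
  qed
  have 4: "conv (conv f g) h x = (LINT y|M. LINT z|M. f (x - y - z) * g z * h y)"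
    unfolding conv_def by (subst Bochner_Integration.integral_mult_left_zero) (rule refl)
  show "conv (conv f g) h x = conv f (conv g h) x"
    by (rule trans[OF 4 trans[OF 3[symmetric] trans[OF 2[symmetric] 1[symmetric]]]])
qed

lemma conv_lincomb_left:
  assumes "cont f" "cont g" "cont h"
  shows "conv (\<lambda>x. a * f x + b * g x) h = (\<lambda>x. a * conv f h x + b * conv g h x)"
proof
  fix x
  have "conv (\<lambda>x. a * f x + b * g x) h x
      = (LINT y|M. a * (f (x - y) * h y) + b * (g (x - y) * h y))"
    unfolding conv_def by (simp add: algebra_simps)
  then show "conv (\<lambda>x. a * f x + b * g x) h x = a * conv f h x + b * conv g h x"
    using conv_integrand[of f h x] conv_integrand[of g h x] assms by (simp add: conv_def)
qed

lemma conv_lincomb_right: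
  assumes "cont f" "cont g" "cont h"
  shows "conv h (\<lambda>x. a * f x + b * g x) = (\<lambda>x. a * conv h f x + b * conv h g x)"
proof -
  have "cont (\<lambda>x. a * f x + b * g x)" by (intro continuous_intros assms)
  then show ?thesis
    using conv_lincomb_left[OF assms] assms by (simp add: conv_commute[of h])
qed

lemma conv_scale_left: "conv (\<lambda>x. a * f x) h = (\<lambda>x. a * conv f h x)"
  unfolding conv_def by (simp add: mult.assoc fun_eq_iff)

lemma conv_scale_right: "conv h (\<lambda>x. a * f x) = (\<lambda>x. a * conv h f x)"
  unfolding conv_def by (simp add: mult.left_commute fun_eq_iff)

lemma conv_shift: "conv (\<lambda>x. f (x + a)) g = (\<lambda>x. conv f g (x + a))"
  unfolding conv_def by (simp add: algebra_simps fun_eq_iff)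

lemma adj_adj [simp]: "adj (adj f) = f"
  unfolding adj_def by (simp add: fun_eq_iff)

lemma adj_conv:
  assumes "cont f" "cont g"
  shows "adj (conv f g) = conv (adj f) (adj g)"
proof
  fix x
  have c: "cont (\<lambda>y. cnj (f (- x - y) * g y))"
    by (intro continuous_intros assms(2) cont_shift[OF assms(1)])
  have "adj (conv f g) x = (LINT y|M. cnj (f (- x - y) * g y))"
    unfolding adj_def conv_def by (rule Bochner_Integration.integral_cnj[symmetric])
  also have "\<dots> = (LINT y|M. cnj (f (- x - (- y)) * g (- y)))"
    using integral_reflection[OF c] by simp
  also have "\<dots> = conv (adj f) (adj g) x"
    unfolding adj_def conv_def by (simp add: algebra_simps)
  finally show "adj (conv f g) x = conv (adj f) (adj g) x" .
qed

lemma l2_integrable: "cont f \<Longrightarrow> integrable M (\<lambda>x. (norm (f x))\<^sup>2)"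
  by (intro cont_integrable continuous_intros)

lemma l2_nonneg [simp]: "0 \<le> l2 f"
  unfolding l2_def by simp

lemma conv_adj_zero:
  assumes "cont f" "cont g"
  shows "conv f (adj g) 0 = (LINT x|M. f x * cnj (g x))"
proof -
  have "cont (\<lambda>y. f y * cnj (g y))" by (intro continuous_intros assms)
  from integral_reflection[OF this] show ?thesis unfolding conv_def adj_def by simp
qed

text \<open>Values at 0 play the role of a trace; this identity converts them into squared
  norms.\<close>

lemma conv_adj_self:
  assumes "cont f"
  shows "conv f (adj f) 0 = complex_of_real (l2 f)"
proof -
  have "conv f (adj f) 0 = (LINT x|M. complex_of_real ((norm (f x))\<^sup>2))"
    by (simp add: conv_adj_zero[OF assms assms] complex_norm_square del: of_real_power)
  then show ?thesis by (simp only: integral_complex_of_real l2_def)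
qed

lemma Cauchy_Schwarz_integral:
  fixes f g :: "'a \<Rightarrow> complex"
  assumes [measurable]: "f \<in> borel_measurable M" "g \<in> borel_measurable M"
    and f: "integrable M (\<lambda>x. (norm (f x))\<^sup>2)" and g: "integrable M (\<lambda>x. (norm (g x))\<^sup>2)"
  shows "integrable M (\<lambda>x. f x * g x)"
    and "(norm (LINT x|M. f x * g x))\<^sup>2 \<le> (LINT x|M. (norm (f x))\<^sup>2) * (LINT x|M. (norm (g x))\<^sup>2)"
proof -
  let ?I = "\<integral>\<^sup>+x. ennreal (norm (f x)) * ennreal (norm (g x)) \<partial>M"
  have nf: "(\<integral>\<^sup>+x. ennreal (norm (f x)) ^ 2 \<partial>M) = ennreal (LINT x|M. (norm (f x))\<^sup>2)"
    using nn_integral_eq_integral[OF f] by (simp add: ennreal_power)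
  have ng: "(\<integral>\<^sup>+x. ennreal (norm (g x)) ^ 2 \<partial>M) = ennreal (LINT x|M. (norm (g x))\<^sup>2)"
    using nn_integral_eq_integral[OF g] by (simp add: ennreal_power)
  have CS: "?I\<^sup>2 \<le> ennreal ((LINT x|M. (norm (f x))\<^sup>2) * (LINT x|M. (norm (g x))\<^sup>2))"
    using Cauchy_Schwarz_nn_integral[of "\<lambda>x. ennreal (norm (f x))" M "\<lambda>x. ennreal (norm (g x))"]
    by (simp add: nf ng ennreal_mult)
  have "?I\<^sup>2 < top" by (rule le_less_trans[OF CS]) simp
  then have fin: "?I < \<infinity>" by (simp add: power_less_top_ennreal)
  have eq: "(\<integral>\<^sup>+x. ennreal (norm (f x * g x)) \<partial>M) = ?I"
    by (simp add: norm_mult ennreal_mult)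
  show int: "integrable M (\<lambda>x. f x * g x)"
    using fin eq by (intro integrableI_bounded) simp_all
  have "ennreal (norm (LINT x|M. f x * g x)) \<le> ?I"
    using integral_norm_bound_ennreal[OF int] eq by simp
  then have "(ennreal (norm (LINT x|M. f x * g x)))\<^sup>2 \<le> ?I\<^sup>2"
    by (rule power_mono) simp
  then have "ennreal ((norm (LINT x|M. f x * g x))\<^sup>2) \<le> ?I\<^sup>2"
    by (simp add: ennreal_power)
  from order_trans[OF this CS] show "(norm (LINT x|M. f x * g x))\<^sup>2 \<le> (LINT x|M. (norm (f x))\<^sup>2) * (LINT x|M. (norm (g x))\<^sup>2)"
    by (simp add: mult_nonneg_nonneg)
qed

lemma l2_point_reflection:
  assumes "cont f"
  shows "l2 (\<lambda>y. f (x - y)) = l2 f"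
proof -
  have "cont (\<lambda>y. complex_of_real ((norm (f y))\<^sup>2))" by (intro continuous_intros assms)
  from integral_point_reflection[OF this, of x]
  show ?thesis unfolding l2_def by (simp only: integral_complex_of_real of_real_eq_iff)
qed

text \<open>The smoothing effect of convolution: a mean square bound on one factor becomes a uniform
  bound on the product.\<close>

lemma conv_bound:
  assumes "cont f" "cont g"
  shows "(norm (conv f g x))\<^sup>2 \<le> l2 f * l2 g"
proof -
  have "(norm (conv f g x))\<^sup>2 \<le> l2 (\<lambda>y. f (x - y)) * l2 g"
    unfolding conv_def l2_def
    by (intro Cauchy_Schwarz_integral cont_measurable l2_integrable cont_shift[OF assms(1)] assms)
  then show ?thesis by (simp add: l2_point_reflection assms)
qed

lemma l2_le:
  assumes "cont f" "\<And>x. (norm (f x))\<^sup>2 \<le> B"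
  shows "l2 f \<le> \<mu> * B"
proof -
  have "l2 f \<le> (LINT x|M. B)"
    unfolding l2_def using assms l2_integrable by (intro integral_mono) auto
  then show ?thesis by (simp add: \<mu>_def)
qed

lemma l2_conv_le:
  assumes "cont f" "cont g"
  shows "l2 (conv f g) \<le> \<mu> * (l2 f * l2 g)"
  by (intro l2_le cont_conv conv_bound assms)

text \<open>Finitely many translates of \<open>U\<close> cover the compact group, so if
  \<open>U\<close> were null, the whole group would be.\<close>

lemma open_pos:
  assumes "open U" "U \<noteq> {}"
  shows "0 < emeasure M U"
proof (rule ccontr)
  assume "\<not> 0 < emeasure M U"
  then have U0: "emeasure M U = 0" by simp
  obtain u where u: "u \<in> U" using assms by auto
  have op: "open ((+) x ` U)" for x
  proof -
    have "(+) x ` U = (\<lambda>y. y - x) -` U"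
    proof (intro set_eqI iffI)
      fix y assume "y \<in> (\<lambda>y. y - x) -` U"
      then have "y - x \<in> U" "y = x + (y - x)" by auto
      then show "y \<in> (+) x ` U" by blast
    qed auto
    moreover have "open ((\<lambda>y. y - x) -` U)"
      by (rule open_vimage[OF assms(1)]) (intro continuous_intros)
    ultimately show ?thesis by simp
  qed
  have "UNIV \<subseteq> \<Union>(range (\<lambda>x. (+) x ` U))"
  proof
    fix y :: 'a
    have "y = (y - u) + u" by simp
    then have "y \<in> (+) (y - u) ` U" using u by blast
    then show "y \<in> \<Union>(range (\<lambda>x. (+) x ` U))" by blast
  qed
  then obtain T where T: "T \<subseteq> range (\<lambda>x. (+) x ` U)" "finite T" "UNIV \<subseteq> \<Union>T"
    using compactE[OF compact_G] op by (metis (no_types, lifting) imageE)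
  have "X \<in> null_sets M" if X: "X \<in> T" for X
  proof -
    obtain x where "X = (+) x ` U" using X T(1) by auto
    then show ?thesis
      using op[of x] emeasure_translation[of U x] assms(1) U0 by (intro null_setsI) auto
  qed
  then have "(\<Union>X\<in>T. X) \<in> null_sets M" using T(2)
    by (intro null_sets_UN' countable_finite)
  then have "\<Union>T \<in> null_sets M" by simp
  then have "emeasure M UNIV = 0" using T(3)
    by (metis null_setsD1 top.extremum_uniqueI)
  then show False using emeasure_UNIV_pos by simp
qed

lemma l2_pos:
  assumes f: "cont f" and a: "f a \<noteq> 0"
  shows "0 < l2 f"
proof (rule ccontr)
  assume "\<not> 0 < l2 f"
  then have "l2 f = 0" using l2_nonneg[of f] by linarith
  then have "AE x in M. (norm (f x))\<^sup>2 = 0"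
    using integral_nonneg_eq_0_iff_AE[OF l2_integrable[OF f]] unfolding l2_def by simp
  then have "AE x in M. x \<notin> {x. f x \<noteq> 0}" by simp
  moreover have op: "open {x. f x \<noteq> 0}"
    by (rule open_Collect_neq) (intro f continuous_intros)+
  ultimately have "emeasure M {x. f x \<noteq> 0} = 0"
    by (subst (asm) AE_iff_measurable[of "{x. f x \<noteq> 0}"]) auto
  moreover have "0 < emeasure M {x. f x \<noteq> 0}"
    using op a by (intro open_pos) auto
  ultimately show False by simp
qed

lemma conv_uniform_limit:
  assumes f: "cont f" and g: "\<And>n. cont (g n)" and h: "cont h"
    and lim: "uniform_limit UNIV g h sequentially"
  shows "(\<lambda>n. conv f (g n) x) \<longlonglongrightarrow> conv f h x"
proof (rule tendstoI)
  fix e :: real assume "e > 0"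
  obtain B where B: "B > 0" "\<And>y. norm (f y) \<le> B" using cont_bounded[OF f] by metis
  define d where "d = e / (2 * B * \<mu>)"
  have "d > 0" unfolding d_def using \<open>e > 0\<close> B mu_pos by simp
  with lim have "\<forall>\<^sub>F n in sequentially. \<forall>y\<in>UNIV. dist (g n y) (h y) < d"
    by (rule uniform_limitD)
  then show "\<forall>\<^sub>F n in sequentially. dist (conv f (g n) x) (conv f h x) < e"
  proof eventually_elim
    case (elim n)
    have "dist (conv f (g n) x) (conv f h x) = norm (LINT y|M. f (x - y) * (g n y - h y))"
      unfolding conv_def dist_norm using conv_integrand[OF f g] conv_integrand[OF f h]
      by (simp add: right_diff_distrib)
    also have "\<dots> \<le> (LINT y|M. norm (f (x - y) * (g n y - h y)))"
      by (rule integral_norm_bound)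
    also have "\<dots> \<le> (LINT y|M. B * d)"
    proof (rule integral_mono)
      show "integrable M (\<lambda>y. norm (f (x - y) * (g n y - h y)))"
        by (intro cont_integrable continuous_intros g h cont_shift[OF f])
      show "norm (f (x - y) * (g n y - h y)) \<le> B * d" for y
        unfolding norm_mult using elim B \<open>d > 0\<close>
        by (intro mult_mono) (auto simp: dist_norm less_imp_le)
    qed simp
    also have "\<dots> = e / 2" using B mu_pos by (simp add: d_def \<mu>_def)
    finally show ?case using \<open>e > 0\<close> by simp
  qed
qed

end

section \<open>The power method for Hermitian kernels\<close>

text \<open>Convexity makes the ratios \<open>r n\<close> increase to a limit \<kappa>, so
  \<open>A n / \<kappa> ^ n\<close> decreases. Submultiplicativity keeps it above
  \<open>\<kappa> / c\<close>, which excludes the limit 0. In the application \<open>A n\<close> is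
  the squared norm of a convolution power and \<kappa> the square of the largest eigenvalue in
  modulus.\<close>

lemma log_convex_submultiplicative_limit:
  fixes A :: "nat \<Rightarrow> real"
  assumes pos: "\<And>n. A n > 0"
    and convex: "\<And>n. (A (Suc n))\<^sup>2 \<le> A n * A (Suc (Suc n))"
    and submult: "\<And>m n. A (Suc (m + n)) \<le> c * (A m * A n)"
    and c: "c > 0"
  obtains \<kappa> b where "\<kappa> > 0" "b > 0" "(\<lambda>n. A n / \<kappa> ^ n) \<longlonglongrightarrow> b"
proof -
  define r where "r n = A (Suc n) / A n" for n
  have rpos: "r n > 0" for n unfolding r_def using pos by simp
  have Ar: "A (Suc n) = A n * r n" for n unfolding r_def using pos[of n] by simp
  have "r n \<le> r (Suc n)" for n
    using convex[of n] pos[of n] pos[of "Suc n"] unfolding r_def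
    by (simp add: field_simps power2_eq_square)
  then have inc: "incseq r" by (rule incseq_SucI)
  have bd: "r n \<le> c * A 0" for n
    using submult[of 0 n] pos[of n] unfolding r_def by (simp add: field_simps)
  obtain \<kappa> where lim: "r \<longlonglongrightarrow> \<kappa>" and le: "\<And>n. r n \<le> \<kappa>"
    using incseq_convergent[OF inc] bd by blast
  have lpos: "\<kappa> > 0" using rpos[of 0] le[of 0] by linarith
  \<comment> \<open>Ratios from index \<open>j\<close> on are at least \<open>r j\<close>, so growth
    is at least geometric with that ratio.\<close>
  have lower: "A m \<ge> A j / r j ^ j * r j ^ m" if "j \<le> m" for j m
    using that
  proof (induction m rule: dec_induct)
    case base
    then show ?case using rpos[of j] by simp
  next
    case (step m)
    have "A j / r j ^ j * r j ^ Suc m = A j / r j ^ j * r j ^ m * r j" by simp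
    also have "\<dots> \<le> A m * r m"
      using step.IH rpos[of j] incseqD[OF inc step.hyps(1)] pos[of m]
      by (intro mult_mono) (auto simp: less_imp_le)
    finally show ?case by (simp add: Ar)
  qed
  \<comment> \<open>Each use of \<open>submult\<close> appends a block \<open>A n\<close> and
    advances the index by \<open>Suc n\<close>, since joining two indices costs an extra 1.\<close>
  have upper: "c * A (Suc n * i + n) \<le> (c * A n) ^ Suc i" for n i
  proof (induction i)
    case (Suc i)
    have "c * A (Suc n * Suc i + n) = c * A (Suc ((Suc n * i + n) + n))"
      by (simp add: algebra_simps)
    also have "\<dots> \<le> c * (c * (A (Suc n * i + n) * A n))"
      using submult c by (intro mult_left_mono) auto
    also have "\<dots> = (c * A n) * (c * A (Suc n * i + n))" by simp
    also have "\<dots> \<le> (c * A n) * (c * A n) ^ Suc i"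
      using Suc c pos[of n] by (intro mult_left_mono) auto
    finally show ?case by simp
  qed simp
  \<comment> \<open>Otherwise some \<open>r j\<close> exceeds the root of order \<open>Suc n\<close>
    of \<open>c * A n\<close>, and along the progression of \<open>upper\<close> the geometric lower
    bound would outgrow the upper one; \<open>q\<close> is the quotient of the two growth factors
    per block.\<close>
  have key: "\<kappa> ^ Suc n \<le> c * A n" for n
  proof (rule ccontr)
    assume "\<not> \<kappa> ^ Suc n \<le> c * A n"
    then have "c * A n < \<kappa> ^ Suc n" by simp
    with tendsto_power[OF lim] have "\<forall>\<^sub>F j in sequentially. c * A n < r j ^ Suc n"
      by (rule order_tendstoD)
    then obtain j where j: "c * A n < r j ^ Suc n"
      by (metis eventually_sequentially order_refl)
    define q where "q = c * A n / r j ^ Suc n"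
    have q: "0 < q" "q < 1"
      unfolding q_def using j c pos[of n] rpos[of j] by (auto simp: divide_simps)
    have bound: "c * (A j / r j ^ j) / r j \<le> q ^ Suc i" if "j \<le> i" for i
    proof -
      let ?N = "Suc n * i + n"
      have N: "j \<le> ?N" using that by (simp add: trans_le_add1)
      have "c * (A j / r j ^ j * r j ^ ?N) \<le> c * A ?N"
        using lower[OF N] c by (intro mult_left_mono) auto
      also have "\<dots> \<le> (c * A n) ^ Suc i" by (rule upper)
      also have "\<dots> = (q * r j ^ Suc n) ^ Suc i"
        unfolding q_def using rpos[of j] by simp
      also have "\<dots> = q ^ Suc i * r j ^ (Suc n * Suc i)"
        by (simp only: power_mult_distrib power_mult)
      also have "Suc n * Suc i = Suc ?N" by simp
      also have "q ^ Suc i * r j ^ Suc ?N = q ^ Suc i * r j * r j ^ ?N" by simp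
      finally have "c * (A j / r j ^ j) * r j ^ ?N \<le> q ^ Suc i * r j * r j ^ ?N"
        by (simp only: mult.assoc)
      then have "c * (A j / r j ^ j) \<le> q ^ Suc i * r j"
        by (rule mult_right_le_imp_le) (use rpos[of j] in simp)
      then show ?thesis using rpos[of j] by (simp only: pos_divide_le_eq)
    qed
    have "(\<lambda>i. q ^ Suc i) \<longlonglongrightarrow> 0"
      using q by (intro LIMSEQ_Suc LIMSEQ_power_zero) auto
    moreover have "c * (A j / r j ^ j) / r j > 0" using c pos[of j] rpos[of j] by simp
    ultimately have "\<forall>\<^sub>F i in sequentially. q ^ Suc i < c * (A j / r j ^ j) / r j"
      by (rule order_tendstoD)
    then obtain N where "\<And>i. i \<ge> N \<Longrightarrow> q ^ Suc i < c * (A j / r j ^ j) / r j"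
      unfolding eventually_sequentially by metis
    from this[of "max N j"] bound[of "max N j"] show False by simp
  qed
  define B where "B n = A n / \<kappa> ^ n" for n
  have Blow: "\<kappa> / c \<le> B n" for n
    using key[of n] lpos c unfolding B_def by (simp add: field_simps)
  have "B (Suc n) \<le> B n" for n
    unfolding B_def Ar using le[of n] lpos pos[of n]
    by (simp add: divide_simps mult_left_mono mult.commute mult.left_commute)
  then have "decseq B" by (rule decseq_SucI)
  then obtain b where b: "B \<longlonglongrightarrow> b" using decseq_convergent[of B] Blow by blast
  have "\<kappa> / c \<le> b" using b Blow by (intro LIMSEQ_le_const) auto
  then have "b > 0" using lpos c by (smt (verit) divide_pos_pos)
  then show ?thesis using that lpos b unfolding B_def by blast
qed

context compact_haar
begin

text \<open>Power iteration is run on the square of \<open>k\<close>, since eigenvalues of opposite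
  sign and equal modulus would make the powers of \<open>k\<close> oscillate. The clause on \<eta>
  keeps the limit inside the ideal on which \<eta> acts as a unit; the minimality argument uses it
  to place one idempotent below another.\<close>

lemma hermitian_square_idempotent:
  assumes k: "cont k" and herm: "adj k = k" and nz: "k a \<noteq> 0"
  obtains \<psi> \<kappa> where "\<kappa> > 0" "cont \<psi>" "adj \<psi> = \<psi>" "conv \<psi> \<psi> = \<psi>" "\<psi> 0 \<noteq> 0"
    "conv (conv k k) \<psi> = (\<lambda>x. complex_of_real \<kappa> * \<psi> x)"
    "\<And>\<eta>. cont \<eta> \<Longrightarrow> conv \<eta> k = k \<Longrightarrow> conv \<eta> \<psi> = \<psi>"
proof -
  \<comment> \<open>\<open>E n\<close> is the convolution power with n + 1 factors, which explains
    the \<open>Suc\<close> in \<open>EE\<close>; odd indices give the powers of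
    \<open>conv k k\<close>.\<close>
  define E where "E n = ((conv k) ^^ n) k" for n
  have E0: "E 0 = k" and ES: "E (Suc n) = conv k (E n)" for n
    by (simp_all add: E_def)
  have cE: "cont (E n)" for n
    by (induction n) (simp_all add: E0 ES k cont_conv)
  have EE: "conv (E m) (E n) = E (Suc (m + n))" for m n
    by (induction m) (simp_all add: E0 ES conv_assoc k cE)
  have aE: "adj (E n) = E n" for n
    by (induction n) (simp_all add: E0 ES adj_conv k cE herm)
  define A where "A n = l2 (E n)" for n
  have EA: "E (Suc (n + n)) 0 = complex_of_real (A n)" for n
    using conv_adj_self[OF cE[of n]] by (simp add: aE EE A_def)
  have Apos: "A n > 0" for n
  proof (induction n)
    case 0
    show ?case unfolding A_def E0 by (rule l2_pos[OF k nz])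
  next
    case (Suc n)
    show ?case
    proof (cases "\<exists>x. E (Suc n) x \<noteq> 0")
      case True
      then show ?thesis unfolding A_def using l2_pos[OF cE] by blast
    next
      \<comment> \<open>If one power vanished, all later ones would, among them
        \<open>E (Suc (n + n))\<close>, whose value at 0 is \<open>A n\<close>.\<close>
      case False
      then have z: "E (Suc n) = (\<lambda>x. 0)" by (simp add: fun_eq_iff)
      have "E (Suc n + i) = (\<lambda>x. 0)" for i
      proof (induction i)
        case (Suc i)
        then show ?case by (simp add: ES conv_def fun_eq_iff)
      qed (simp add: z)
      from this[of n] EA[of n] Suc show ?thesis by simp
    qed
  qed
  \<comment> \<open>Log-convexity is Cauchy-Schwarz: \<open>A (Suc n)\<close> is the value at 0 of
    the product of the powers \<open>E n\<close> and \<open>E (Suc (Suc n))\<close>.\<close>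
  have "(A (Suc n))\<^sup>2 \<le> A n * A (Suc (Suc n))" for n
  proof -
    have "conv (E n) (E (Suc (Suc n))) 0 = complex_of_real (A (Suc n))"
      using EA[of "Suc n"] by (simp add: EE)
    then show ?thesis
      using conv_bound[OF cE[of n] cE[of "Suc (Suc n)"], of 0] Apos[of "Suc n"]
      by (simp add: A_def)
  qed
  moreover have "A (Suc (m + n)) \<le> \<mu> * (A m * A n)" for m n
    using l2_conv_le[OF cE[of m] cE[of n]] by (simp add: A_def EE)
  ultimately obtain \<kappa> b where l: "\<kappa> > 0" and b: "b > 0" and lim: "(\<lambda>n. A n / \<kappa> ^ n) \<longlonglongrightarrow> b"
    using log_convex_submultiplicative_limit[of A \<mu>, OF Apos _ _ mu_pos] by metis
  define B where "B n = A n / \<kappa> ^ n" for n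
  \<comment> \<open>This is the power of \<open>conv k k\<close> with n + 1 factors divided by only
    n factors \<kappa>, so the limit is \<kappa> times an idempotent; \<psi> corrects this at the
    end.\<close>
  define P where "P n x = complex_of_real (inverse (\<kappa> ^ n)) * E (Suc (n + n)) x" for n x
  have cP: "cont (P n)" for n unfolding P_def by (intro continuous_intros cE)
  have aP: "adj (P n) = P n" for n
    using aE[of "Suc (n + n)"] unfolding P_def adj_def by (simp add: fun_eq_iff)
  have cK: "cont (conv k k)" by (intro cont_conv k)
  have KP: "conv (conv k k) (P n) = (\<lambda>x. complex_of_real \<kappa> * P (Suc n) x)" for n
  proof -
    have "conv (conv k k) (E (Suc (n + n))) = E (Suc (Suc n + Suc n))"
      using EE[of 1 "Suc (n + n)"] by (simp add: E0 ES)
    then show ?thesis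
      using l unfolding P_def conv_scale_right by (simp add: fun_eq_iff)
  qed
  have P0: "P n 0 = complex_of_real (B n)" for n
    by (simp add: P_def B_def EA field_simps)
  \<comment> \<open>Expanding the square yields values of powers at 0. All three indices go to
    infinity, so the bracket tends to b - 2b + b = 0.\<close>
  have l2P: "l2 (\<lambda>x. P m x - P n x) = \<kappa> * (B (Suc (m + m)) - 2 * B (Suc (m + n)) + B (Suc (n + n)))"
    for m n
  proof -
    define p q where "p = complex_of_real (inverse (\<kappa> ^ m))" and "q = - complex_of_real (inverse (\<kappa> ^ n))"
    let ?f = "\<lambda>x. p * E (Suc (m + m)) x + q * E (Suc (n + n)) x"
    have f: "(\<lambda>x. P m x - P n x) = ?f" by (simp add: P_def p_def q_def fun_eq_iff)
    have cf: "cont ?f" by (intro continuous_intros cE)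
    have "adj ?f = ?f"
      using aP[of m] aP[of n] unfolding f[symmetric] adj_def by (simp add: fun_eq_iff)
    then have "complex_of_real (l2 ?f) = conv ?f ?f 0"
      using conv_adj_self[OF cf] by simp
    also have "\<dots> = p * (p * conv (E (Suc (m + m))) (E (Suc (m + m))) 0 + q * conv (E (Suc (m + m))) (E (Suc (n + n))) 0)
       + q * (p * conv (E (Suc (n + n))) (E (Suc (m + m))) 0 + q * conv (E (Suc (n + n))) (E (Suc (n + n))) 0)"
      by (simp only: conv_lincomb_left[OF cE cE cf] conv_lincomb_right[OF cE cE cE])
    also have "\<dots> = p * (p * A (Suc (m + m)) + q * A (Suc (m + n))) + q * (p * A (Suc (m + n)) + q * A (Suc (n + n)))"
      using EA[of "Suc (m + m)"] EA[of "Suc (m + n)"] EA[of "Suc (n + n)"]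
      by (simp add: EE algebra_simps)
    also have "\<dots> = complex_of_real (\<kappa> * (B (Suc (m + m)) - 2 * B (Suc (m + n)) + B (Suc (n + n))))"
      using l unfolding p_def q_def B_def
      by (simp add: field_simps power_add power2_eq_square)
    finally show ?thesis unfolding f of_real_eq_iff .
  qed
  \<comment> \<open>One more convolution with \<open>conv k k\<close> upgrades mean square closeness
    to uniform closeness; by \<open>KP\<close> its only cost is an index shift and the factor
    \<kappa>.\<close>
  have diff: "(norm (P (Suc m) x - P (Suc n) x))\<^sup>2
      \<le> l2 (conv k k) / \<kappa>\<^sup>2 * l2 (\<lambda>x. P m x - P n x)" for m n x
  proof -
    let ?f = "\<lambda>x. 1 * P m x + (-1) * P n x"
    have cf: "cont ?f" by (intro continuous_intros cP)
    have "conv (conv k k) ?f = (\<lambda>x. complex_of_real \<kappa> * (P (Suc m) x - P (Suc n) x))"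
      by (simp only: conv_lincomb_right[OF cP cP cK] KP) (simp add: algebra_simps)
    then have "(norm (complex_of_real \<kappa> * (P (Suc m) x - P (Suc n) x)))\<^sup>2 \<le> l2 (conv k k) * l2 ?f"
      using conv_bound[OF cK cf, of x] by simp
    then have "\<kappa>\<^sup>2 * (norm (P (Suc m) x - P (Suc n) x))\<^sup>2 \<le> l2 (conv k k) * l2 ?f"
      by (simp only: norm_mult power_mult_distrib norm_of_real power2_abs)
    then show ?thesis using l by (simp add: field_simps)
  qed
  have "uniformly_Cauchy_on UNIV (\<lambda>n. P (Suc n))"
    unfolding uniformly_Cauchy_on_def
  proof (intro allI impI)
    fix e :: real assume e: "e > 0"
    define C where "C = l2 (conv k k) / \<kappa>\<^sup>2 * \<kappa> * 4 + 1"
    have C: "C > 0" unfolding C_def using l by (intro add_nonneg_pos) auto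
    have "e\<^sup>2 / C > 0" using e C by simp
    with lim have "\<forall>\<^sub>F n in sequentially. dist (A n / \<kappa> ^ n) b < e\<^sup>2 / C" by (rule tendstoD)
    then obtain N where N: "\<And>n. n \<ge> N \<Longrightarrow> \<bar>B n - b\<bar> < e\<^sup>2 / C"
      unfolding eventually_sequentially B_def dist_real_def by metis
    have "dist (P (Suc m) x) (P (Suc n) x) < e" if "m \<ge> N" "n \<ge> N" for m n x
    proof -
      have "B (Suc (m + m)) - 2 * B (Suc (m + n)) + B (Suc (n + n)) \<le> 4 * (e\<^sup>2 / C)"
        using N[of "Suc (m + m)"] N[of "Suc (m + n)"] N[of "Suc (n + n)"] that by (simp add: abs_less_iff)
      then have "l2 (\<lambda>x. P m x - P n x) \<le> \<kappa> * (4 * (e\<^sup>2 / C))"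
        unfolding l2P using l by (intro mult_left_mono) auto
      then have "l2 (conv k k) / \<kappa>\<^sup>2 * l2 (\<lambda>x. P m x - P n x)
          \<le> l2 (conv k k) / \<kappa>\<^sup>2 * (\<kappa> * (4 * (e\<^sup>2 / C)))"
        by (intro mult_left_mono) auto
      also have "\<dots> = (C - 1) * (e\<^sup>2 / C)" unfolding C_def by simp
      also have "\<dots> < C * (e\<^sup>2 / C)" using \<open>e\<^sup>2 / C > 0\<close> by (intro mult_strict_right_mono) auto
      also have "\<dots> = e\<^sup>2" using C by simp
      finally have "(norm (P (Suc m) x - P (Suc n) x))\<^sup>2 < e\<^sup>2" using diff[of m x n] by linarith
      then show ?thesis using e by (simp add: dist_norm power_less_imp_less_base)
    qed
    then show "\<exists>N. \<forall>x\<in>UNIV. \<forall>m\<ge>N. \<forall>n\<ge>N. dist (P (Suc m) x) (P (Suc n) x) < e" by blast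
  qed
  then have "uniformly_convergent_on UNIV (\<lambda>n. P (Suc n))"
    by (rule Cauchy_uniformly_convergent)
  then obtain Q where Q: "uniform_limit UNIV (\<lambda>n. P (Suc n)) Q sequentially"
    unfolding uniformly_convergent_on_def by blast
  have cQ: "cont Q"
    by (rule uniform_limit_theorem[OF _ Q]) (simp_all add: cP)
  have Qx: "(\<lambda>n. P (Suc n) x) \<longlonglongrightarrow> Q x" for x
    using tendsto_uniform_limitI[OF Q] by simp
  have convQ: "(\<lambda>n. conv f (P (Suc n)) x) \<longlonglongrightarrow> conv f Q x" if "cont f" for f x
    by (rule conv_uniform_limit[OF that cP cQ Q])
  have Q0: "Q 0 = complex_of_real b"
  proof (rule LIMSEQ_unique[OF Qx])
    show "(\<lambda>n. P (Suc n) 0) \<longlonglongrightarrow> complex_of_real b"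
      unfolding P0 using LIMSEQ_Suc[OF lim] unfolding B_def by (intro tendsto_of_real)
  qed
  have aQ: "adj Q = Q"
  proof
    fix x
    have "(\<lambda>n. cnj (P (Suc n) (- x))) \<longlonglongrightarrow> cnj (Q (- x))" by (intro tendsto_cnj Qx)
    moreover have "cnj (P (Suc n) (- x)) = P (Suc n) x" for n
      using fun_cong[OF aP[of "Suc n"], of x] by (simp add: adj_def)
    ultimately have "(\<lambda>n. P (Suc n) x) \<longlonglongrightarrow> cnj (Q (- x))" by simp
    then show "adj Q x = Q x" unfolding adj_def using Qx by (rule LIMSEQ_unique)
  qed
  have KQ: "conv (conv k k) Q = (\<lambda>x. complex_of_real \<kappa> * Q x)"
  proof
    fix x
    have "(\<lambda>n. conv (conv k k) (P (Suc n)) x) \<longlonglongrightarrow> complex_of_real \<kappa> * Q x"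
      unfolding KP by (intro tendsto_intros LIMSEQ_Suc[OF Qx])
    with convQ[OF cK] show "conv (conv k k) Q x = complex_of_real \<kappa> * Q x"
      by (rule LIMSEQ_unique)
  qed
  have E1: "E 1 = conv k k" by (simp add: E0 ES)
  have EQ: "conv (E (Suc (n + n))) Q = (\<lambda>x. complex_of_real (\<kappa> ^ Suc n) * Q x)" for n
  proof (induction n)
    case 0
    show ?case using KQ E1 by simp
  next
    case (Suc n)
    have "E (Suc (Suc n + Suc n)) = conv (conv k k) (E (Suc (n + n)))"
      using EE[of 1 "Suc (n + n)"] by (simp add: E1[symmetric])
    then show ?case
      by (simp add: conv_assoc[OF cK cE cQ] Suc conv_scale_right KQ fun_eq_iff)
  qed
  \<comment> \<open>The product does not depend on \<open>n\<close>, so its limit identifies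
    \<open>conv Q Q\<close>.\<close>
  have PQ: "conv Q (P n) = (\<lambda>x. complex_of_real \<kappa> * Q x)" for n
    using l unfolding conv_commute[OF cQ cP] unfolding P_def conv_scale_left EQ
    by (simp add: fun_eq_iff)
  have QQ: "conv Q Q = (\<lambda>x. complex_of_real \<kappa> * Q x)"
  proof
    fix x
    show "conv Q Q x = complex_of_real \<kappa> * Q x"
      using convQ[OF cQ, of x] unfolding PQ by (rule LIMSEQ_unique) (rule tendsto_const)
  qed
  define \<psi> where "\<psi> x = complex_of_real (inverse \<kappa>) * Q x" for x
  have psi: "\<psi> = (\<lambda>x. complex_of_real (inverse \<kappa>) * Q x)" by (simp add: \<psi>_def fun_eq_iff)
  show ?thesis
  proof (rule that[OF l, of \<psi>])
    show "cont \<psi>" unfolding psi by (intro continuous_intros cQ)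
    show "adj \<psi> = \<psi>" using aQ by (simp add: adj_def psi fun_eq_iff)
    show "conv \<psi> \<psi> = \<psi>"
      using l unfolding psi conv_scale_left conv_scale_right QQ by (simp add: fun_eq_iff)
    show "\<psi> 0 \<noteq> 0" using Q0 b l by (simp add: \<psi>_def)
    show "conv (conv k k) \<psi> = (\<lambda>x. complex_of_real \<kappa> * \<psi> x)"
      unfolding psi conv_scale_right KQ by (simp add: fun_eq_iff)
    fix \<eta> assume eta: "cont \<eta>" "conv \<eta> k = k"
    have "conv \<eta> (E n) = E n" for n
    proof (induction n)
      case (Suc n)
      then show ?case using conv_assoc[OF eta(1) k cE[of n]] by (simp add: ES eta(2))
    qed (simp add: E0 eta)
    then have "conv \<eta> (P n) = P n" for n
      unfolding P_def conv_scale_right by (simp add: fun_eq_iff)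
    then have "(\<lambda>n. P (Suc n) x) \<longlonglongrightarrow> conv \<eta> Q x" for x
      using convQ[OF eta(1), of x] by simp
    then have "conv \<eta> Q x = Q x" for x
      using Qx by (rule LIMSEQ_unique)
    then show "conv \<eta> \<psi> = \<psi>" unfolding psi conv_scale_right by (simp add: fun_eq_iff)
  qed
qed

text \<open>Descent from the square of \<open>k\<close> to \<open>k\<close>: on the range of \<psi>
  the square acts as \<kappa>, so \<open>k\<close> can only have the eigenvalues \<open>s\<close>
  and \<open>- s\<close> with \<open>s = sqrt \<kappa>\<close>. Either \<open>k\<close> acts as
  \<open>- s\<close> throughout, or half of \<psi> plus \<open>conv k \<psi>\<close> over
  \<open>s\<close>, the projection onto the eigenspace of \<open>s\<close>, is nonzero.\<close>

lemma hermitian_idempotent: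
  assumes k: "cont k" and herm: "adj k = k" and nz: "k a \<noteq> 0"
  obtains \<psi> and \<kappa> :: real where "\<kappa> \<noteq> 0" "cont \<psi>" "adj \<psi> = \<psi>" "conv \<psi> \<psi> = \<psi>" "\<psi> \<noteq> (\<lambda>x. 0)"
    "conv k \<psi> = (\<lambda>x. complex_of_real \<kappa> * \<psi> x)"
    "\<And>\<eta>. cont \<eta> \<Longrightarrow> conv \<eta> k = k \<Longrightarrow> conv \<eta> \<psi> = \<psi>"
proof -
  obtain \<psi> \<kappa> where l: "\<kappa> > 0" and c: "cont \<psi>" and a: "adj \<psi> = \<psi>" and i: "conv \<psi> \<psi> = \<psi>"
    and z: "\<psi> 0 \<noteq> 0" and K: "conv (conv k k) \<psi> = (\<lambda>x. complex_of_real \<kappa> * \<psi> x)"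
    and eta: "\<And>\<eta>. cont \<eta> \<Longrightarrow> conv \<eta> k = k \<Longrightarrow> conv \<eta> \<psi> = \<psi>"
    using hermitian_square_idempotent[OF assms] by metis
  define s where "s = sqrt \<kappa>"
  have s: "s > 0" "s * s = \<kappa>" using l by (simp_all add: s_def)
  let ?\<phi> = "conv k \<psi>"
  have cphi: "cont ?\<phi>" by (intro cont_conv k c)
  have kphi: "conv k ?\<phi> = (\<lambda>x. complex_of_real \<kappa> * \<psi> x)"
    using K conv_assoc[OF k k c] by simp
  have psiphi: "conv \<psi> ?\<phi> = ?\<phi>"
    using conv_assoc[OF k c c] conv_commute[OF c cphi] i by simp
  have phipsi: "conv ?\<phi> \<psi> = ?\<phi>" using psiphi conv_commute[OF c cphi] by simp
  have phiphi: "conv ?\<phi> ?\<phi> = (\<lambda>x. complex_of_real \<kappa> * \<psi> x)"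
    using conv_assoc[OF k c cphi] psiphi kphi by simp
  have aphi: "adj ?\<phi> = ?\<phi>" using adj_conv[OF k c] a herm by simp
  show ?thesis
  proof (cases "\<exists>x. ?\<phi> x + complex_of_real s * \<psi> x \<noteq> 0")
    case False
    then have "conv k \<psi> = (\<lambda>x. complex_of_real (- s) * \<psi> x)"
      by (simp add: fun_eq_iff eq_neg_iff_add_eq_0)
    moreover have "\<psi> \<noteq> (\<lambda>x. 0)" using z by auto
    ultimately show ?thesis using that[of "- s" \<psi>] s c a i eta by simp
  next
    case True
    define h d where "h = (1 / 2 :: complex)" and "d = 1 / (2 * complex_of_real s)"
    have d: "complex_of_real s * d = h" "d * d * complex_of_real \<kappa> = h * h"
      "complex_of_real \<kappa> * d = complex_of_real s * h" "d \<noteq> 0" "h + h = 1"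
      using s(1) unfolding h_def d_def s(2)[symmetric] by (simp_all add: field_simps)
    let ?\<omega> = "\<lambda>x. h * \<psi> x + d * ?\<phi> x"
    have co: "cont ?\<omega>" by (intro continuous_intros c cphi)
    show ?thesis
    proof (rule that[of s ?\<omega>])
      show "s \<noteq> 0" using s by simp
      show "cont ?\<omega>" by fact
      show "adj ?\<omega> = ?\<omega>"
        using fun_cong[OF a] fun_cong[OF aphi] by (simp add: adj_def fun_eq_iff h_def d_def)
      have "conv ?\<omega> ?\<omega> = (\<lambda>x. h * (h * \<psi> x + d * ?\<phi> x) + d * (h * ?\<phi> x + d * (complex_of_real \<kappa> * \<psi> x)))"
        by (simp only: conv_lincomb_left[OF c cphi co] conv_lincomb_right[OF c cphi c]
            conv_lincomb_right[OF c cphi cphi] i psiphi phipsi phiphi)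
      also have "\<dots> = (\<lambda>x. (h * h + d * d * complex_of_real \<kappa>) * \<psi> x + (h + h) * d * ?\<phi> x)"
        by (simp add: algebra_simps)
      also have "\<dots> = ?\<omega>" by (simp only: d) (simp add: d(5) flip: distrib_left)
      finally show "conv ?\<omega> ?\<omega> = ?\<omega>" .
      obtain x where "?\<phi> x + complex_of_real s * \<psi> x \<noteq> 0" using True by blast
      moreover have "?\<omega> x = d * (?\<phi> x + complex_of_real s * \<psi> x)"
        using d(1) by (simp add: algebra_simps)
      ultimately have "?\<omega> x \<noteq> 0" using d(4) by simp
      then show "?\<omega> \<noteq> (\<lambda>x. 0)" by metis
      have "conv k ?\<omega> = (\<lambda>x. h * ?\<phi> x + d * (complex_of_real \<kappa> * \<psi> x))"
        by (simp only: conv_lincomb_right[OF c cphi k] kphi)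
      also have "\<dots> = (\<lambda>x. complex_of_real s * (h * \<psi> x + d * ?\<phi> x))"
      proof
        fix x
        have "d * (complex_of_real \<kappa> * \<psi> x) = (complex_of_real \<kappa> * d) * \<psi> x" by simp
        then show "h * ?\<phi> x + d * (complex_of_real \<kappa> * \<psi> x)
            = complex_of_real s * (h * \<psi> x + d * ?\<phi> x)"
          unfolding d(3) d(1)[symmetric] by (simp add: algebra_simps)
      qed
      finally show "conv k ?\<omega> = (\<lambda>x. complex_of_real s * ?\<omega> x)" .
      fix \<eta> assume e: "cont \<eta>" "conv \<eta> k = k"
      have "conv \<eta> ?\<phi> = ?\<phi>" using conv_assoc[OF e(1) k c] e(2) by simp
      then show "conv \<eta> ?\<omega> = ?\<omega>"
        by (simp only: conv_lincomb_right[OF c cphi e(1)] eta[OF e])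
    qed
  qed
qed

end

section \<open>Characters and trigonometric polynomials\<close>

lemma dual_groupD:
  assumes "\<xi> \<in> dual_group"
  shows "continuous_on UNIV \<xi>" "\<xi> (x + y) = \<xi> x * \<xi> y" "cmod (\<xi> x) = 1"
  using assms unfolding dual_group_def by auto

lemma dual_group_zero:
  assumes "\<xi> \<in> dual_group"
  shows "\<xi> 0 = 1"
proof -
  have "\<xi> 0 * \<xi> 0 = \<xi> 0" using dual_groupD(2)[OF assms, of 0 0] by simp
  moreover have "\<xi> 0 \<noteq> 0" using dual_groupD(3)[OF assms, of 0] by auto
  ultimately show ?thesis by simp
qed

lemma dual_group_minus:
  assumes "\<xi> \<in> dual_group"
  shows "\<xi> (- x) = cnj (\<xi> x)"
proof -
  have "\<xi> x * \<xi> (- x) = 1"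
    using dual_groupD(2)[OF assms, of x "- x"] dual_group_zero[OF assms] by simp
  moreover have "\<xi> x * cnj (\<xi> x) = 1"
    using dual_groupD(3)[OF assms, of x] complex_norm_square[of "\<xi> x"] by simp
  moreover have "\<xi> x \<noteq> 0" using dual_groupD(3)[OF assms, of x] by auto
  ultimately show ?thesis by (metis mult_left_cancel)
qed

lemma dual_group_diff:
  assumes "\<xi> \<in> dual_group"
  shows "\<xi> (x - y) = \<xi> x * cnj (\<xi> y)"
  using dual_groupD(2)[OF assms, of x "- y"] dual_group_minus[OF assms] by simp

lemma dual_group_one: "(\<lambda>x. 1) \<in> dual_group"
  unfolding dual_group_def by simp

lemma dual_group_mult:
  assumes "\<xi> \<in> dual_group" "\<eta> \<in> dual_group"
  shows "(\<lambda>x. \<xi> x * \<eta> x) \<in> dual_group"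
  using assms unfolding dual_group_def
  by (auto simp: norm_mult mult_ac intro!: continuous_on_mult)

lemma dual_group_cnj:
  assumes "\<xi> \<in> dual_group"
  shows "(\<lambda>x. cnj (\<xi> x)) \<in> dual_group"
  using assms unfolding dual_group_def by (auto intro!: continuous_on_cnj)

context compact_haar
begin

text \<open>The lower bound comes from inserting \<open>conv \<psi> \<psi> = \<psi>\<close> into
  \<open>l2_conv_le\<close>. It is sharp: a character divided by \<mu> is an idempotent with squared
  norm 1 / \<mu>.\<close>

lemma hermitian_idempotent_l2:
  assumes "cont \<psi>" "adj \<psi> = \<psi>" "conv \<psi> \<psi> = \<psi>"
  shows "\<psi> 0 = complex_of_real (l2 \<psi>)" "\<psi> \<noteq> (\<lambda>x. 0) \<Longrightarrow> 1 / \<mu> \<le> l2 \<psi>"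
proof -
  show "\<psi> 0 = complex_of_real (l2 \<psi>)"
    using conv_adj_self[OF assms(1)] assms by simp
  assume "\<psi> \<noteq> (\<lambda>x. 0)"
  then obtain a where "\<psi> a \<noteq> 0" by auto
  then have pos: "l2 \<psi> > 0" by (rule l2_pos[OF assms(1)])
  have "l2 \<psi> \<le> (\<mu> * l2 \<psi>) * l2 \<psi>"
    using l2_conv_le[OF assms(1,1)] assms(3) by (simp add: mult.assoc)
  then have "1 \<le> \<mu> * l2 \<psi>" using pos by simp
  then show "1 / \<mu> \<le> l2 \<psi>" using mu_pos by (simp add: field_simps)
qed

text \<open>
  An idempotent of almost minimal norm inside a spectral subspace of \<open>k\<close> cannot be split by the
  Hermitian combinations of its own translates, so every translation acts on it as a scalar.
\<close>

lemma hermitian_eigencharacter: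
  assumes k: "cont k" and herm: "adj k = k" and nz: "k a \<noteq> 0"
  obtains \<xi> and \<kappa> :: real where "\<xi> \<in> dual_group" "\<kappa> \<noteq> 0"
    "conv k \<xi> = (\<lambda>x. complex_of_real \<kappa> * \<xi> x)"
proof -
  obtain \<psi>0 and \<kappa> :: real where kap: "\<kappa> \<noteq> 0"
    and psi0: "cont \<psi>0" "adj \<psi>0 = \<psi>0" "conv \<psi>0 \<psi>0 = \<psi>0" "\<psi>0 \<noteq> (\<lambda>x. 0)"
      "conv k \<psi>0 = (\<lambda>x. complex_of_real \<kappa> * \<psi>0 x)"
    using hermitian_idempotent[OF assms] by metis
  define S where "S = {\<psi>. cont \<psi> \<and> adj \<psi> = \<psi> \<and> conv \<psi> \<psi> = \<psi> \<and> \<psi> \<noteq> (\<lambda>x. 0)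
      \<and> conv k \<psi> = (\<lambda>x. complex_of_real \<kappa> * \<psi> x)}"
  have "\<psi>0 \<in> S" unfolding S_def using psi0 by simp
  have bdd: "bdd_below (l2 ` S)" by (rule bdd_belowI[of _ 0]) auto
  have "Inf (l2 ` S) < Inf (l2 ` S) + 1 / \<mu>" using mu_pos by simp
  with \<open>\<psi>0 \<in> S\<close> obtain \<psi> where "\<psi> \<in> S" and less: "l2 \<psi> < Inf (l2 ` S) + 1 / \<mu>"
    using cInf_lessD[of "l2 ` S"] by blast
  have min: "l2 \<psi> < l2 \<psi>' + 1 / \<mu>" if "\<psi>' \<in> S" for \<psi>'
    using less cInf_lower[OF imageI[OF that, of l2] bdd] by linarith
  have c: "cont \<psi>" and a: "adj \<psi> = \<psi>" and i: "conv \<psi> \<psi> = \<psi>" and z: "\<psi> \<noteq> (\<lambda>x. 0)"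
    and kpsi: "conv k \<psi> = (\<lambda>x. complex_of_real \<kappa> * \<psi> x)"
    using \<open>\<psi> \<in> S\<close> unfolding S_def by blast+
  have cnj_psi: "cnj (\<psi> (- x)) = \<psi> x" for x using fun_cong[OF a, of x] by (simp add: adj_def)
  have p0: "\<psi> 0 = complex_of_real (l2 \<psi>)" and ppos: "l2 \<psi> > 0"
    using hermitian_idempotent_l2[OF c a i] z mu_pos
    by (auto intro: less_le_trans[of 0 "1 / \<mu>"])
  \<comment> \<open>The conjugate coefficient on the opposite translate keeps the combination
    Hermitian. The choices \<open>\<theta> = 1\<close> and \<open>\<theta> = \<i>\<close> together
    recover the single translate.\<close>
  have scalar: "\<exists>r. \<forall>x. \<theta> * \<psi> (x + y) + cnj \<theta> * \<psi> (x - y) = r * \<psi> x" for \<theta> y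
  proof (cases "\<exists>x. \<theta> * \<psi> (x + y) + cnj \<theta> * \<psi> (x - y) \<noteq> 0")
    case False
    then show ?thesis by (intro exI[of _ 0]) simp
  next
    case True
    let ?h = "\<lambda>x. \<theta> * \<psi> (x + y) + cnj \<theta> * \<psi> (x + (- y))"
    obtain b where b: "?h b \<noteq> 0" using True by auto
    have ch: "cont ?h" by (intro continuous_intros cont_shift(1)[OF c])
    have ah: "adj ?h = ?h"
    proof
      fix x
      have "adj ?h x = cnj \<theta> * cnj (\<psi> (- (x + (- y)))) + \<theta> * cnj (\<psi> (- (x + y)))"
        by (simp add: adj_def algebra_simps)
      then show "adj ?h x = ?h x" unfolding cnj_psi by (simp add: algebra_simps)
    qed
    have hpsi: "conv ?h \<psi> = ?h"
      by (simp only: conv_lincomb_left[OF cont_shift(1)[OF c] cont_shift(1)[OF c] c] conv_shift i)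
    then have psih: "conv \<psi> ?h = ?h" using conv_commute[OF c ch] by simp
    define h where "h = ?h"
    obtain \<psi>' and r :: real where c': "cont \<psi>'" and a': "adj \<psi>' = \<psi>'" and i': "conv \<psi>' \<psi>' = \<psi>'"
      and z': "\<psi>' \<noteq> (\<lambda>x. 0)" and hr: "conv h \<psi>' = (\<lambda>x. complex_of_real r * \<psi>' x)"
      and eta: "\<And>\<eta>. cont \<eta> \<Longrightarrow> conv \<eta> h = h \<Longrightarrow> conv \<eta> \<psi>' = \<psi>'"
      using hermitian_idempotent[OF ch ah b, folded h_def] by metis
    \<comment> \<open>\<psi> is a unit for \<open>h\<close> and hence for the idempotent obtained
      from \<open>h\<close>: \<psi>' lies below \<psi>, and their difference is again
      idempotent.\<close>
    have pp': "conv \<psi> \<psi>' = \<psi>'" by (rule eta[OF c psih[folded h_def]])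
    have p'p: "conv \<psi>' \<psi> = \<psi>'" using pp' conv_commute[OF c c'] by simp
    have "conv k \<psi>' = conv (conv k \<psi>) \<psi>'" using conv_assoc[OF k c c'] pp' by simp
    also have "\<dots> = (\<lambda>x. complex_of_real \<kappa> * \<psi>' x)" unfolding kpsi conv_scale_left pp' ..
    finally have "\<psi>' \<in> S" unfolding S_def using c' a' i' z' by simp
    let ?d = "\<lambda>x. 1 * \<psi> x + (- 1) * \<psi>' x"
    have cd: "cont ?d" by (intro continuous_intros c c')
    have ad: "adj ?d = ?d"
      using fun_cong[OF a] fun_cong[OF a'] by (simp add: adj_def fun_eq_iff)
    have "conv ?d ?d = (\<lambda>x. 1 * (1 * \<psi> x + (- 1) * \<psi>' x) + (- 1) * (1 * \<psi>' x + (- 1) * \<psi>' x))"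
      by (simp only: conv_lincomb_left[OF c c' cd] conv_lincomb_right[OF c c' c]
          conv_lincomb_right[OF c c' c'] i i' pp' p'p)
    also have "\<dots> = ?d" by simp
    finally have id: "conv ?d ?d = ?d" .
    have "?d = (\<lambda>x. 0)"
    proof (rule ccontr)
      assume nz: "?d \<noteq> (\<lambda>x. 0)"
      have "complex_of_real (l2 ?d) = complex_of_real (l2 \<psi> - l2 \<psi>')"
        using hermitian_idempotent_l2(1)[OF cd ad id] p0 hermitian_idempotent_l2(1)[OF c' a' i'] by simp
      then have "l2 ?d = l2 \<psi> - l2 \<psi>'" unfolding of_real_eq_iff .
      with hermitian_idempotent_l2(2)[OF cd ad id nz] min[OF \<open>\<psi>' \<in> S\<close>] show False by simp
    qed
    then have "\<psi>' = \<psi>" by (simp add: fun_eq_iff)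
    then have "h = (\<lambda>x. complex_of_real r * \<psi> x)" using hpsi[folded h_def] hr by simp
    then show ?thesis
      by (intro exI[of _ "complex_of_real r"]) (simp add: h_def fun_eq_iff)
  qed
  define \<xi> where "\<xi> y = \<psi> y / \<psi> 0" for y
  have shift: "\<psi> (x + y) = \<xi> y * \<psi> x" for x y
  proof -
    obtain r where r: "\<And>x. \<psi> (x + y) + \<psi> (x - y) = r * \<psi> x" using scalar[of 1 y] by auto
    obtain q where q: "\<And>x. \<i> * \<psi> (x + y) - \<i> * \<psi> (x - y) = q * \<psi> x" using scalar[of \<i> y] by auto
    have *: "\<psi> (x + y) = (r - \<i> * q) / 2 * \<psi> x" for x
    proof -
      have "(r - \<i> * q) * \<psi> x = r * \<psi> x - \<i> * (q * \<psi> x)" by (simp add: algebra_simps)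
      also have "\<dots> = 2 * \<psi> (x + y)" unfolding r[symmetric] q[symmetric] by (simp add: algebra_simps)
      finally show ?thesis by simp
    qed
    from *[of 0] have "\<xi> y = (r - \<i> * q) / 2" unfolding \<xi>_def using p0 ppos by simp
    then show ?thesis using *[of x] by (simp only:)
  qed
  have mult: "\<xi> (x + y) = \<xi> x * \<xi> y" for x y using shift[of x y] by (simp add: \<xi>_def)
  have chi0: "\<xi> 0 = 1" unfolding \<xi>_def using p0 ppos by simp
  have le1: "cmod (\<xi> x) \<le> 1" for x
  proof -
    have "(cmod (\<psi> x))\<^sup>2 \<le> (l2 \<psi>)\<^sup>2" using conv_bound[OF c c, of x] by (simp add: i power2_eq_square)
    then have "cmod (\<psi> x) \<le> l2 \<psi>" by (rule power2_le_imp_le) simp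
    then show ?thesis unfolding \<xi>_def using p0 ppos by (simp add: norm_divide)
  qed
  have norm1: "cmod (\<xi> x) = 1" for x
  proof -
    have "cmod (\<xi> x) * cmod (\<xi> (- x)) = 1"
      using mult[of x "- x"] chi0 by (simp flip: norm_mult)
    then show ?thesis using le1[of x] le1[of "- x"] mult_left_le[of "cmod (\<xi> (- x))" "cmod (\<xi> x)"] by simp
  qed
  have "cont \<xi>" unfolding \<xi>_def by (intro continuous_intros c) (use p0 ppos in simp)
  then have "\<xi> \<in> dual_group" unfolding dual_group_def using mult norm1 by simp
  have xi: "\<xi> = (\<lambda>x. inverse (\<psi> 0) * \<psi> x)" by (simp add: \<xi>_def fun_eq_iff field_simps)
  have "conv k \<xi> = (\<lambda>x. complex_of_real \<kappa> * \<xi> x)"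
    unfolding xi conv_scale_right kpsi by (simp add: fun_eq_iff)
  with \<open>\<xi> \<in> dual_group\<close> kap show ?thesis by (rule that)
qed

lemma conv_character:
  assumes v: "cont v" and \<xi>: "\<xi> \<in> dual_group"
  shows "conv v \<xi> = (\<lambda>x. fourier M v \<xi> * \<xi> x)"
proof
  fix x
  have "conv v \<xi> x = conv \<xi> v x" by (simp add: conv_commute v dual_groupD(1)[OF \<xi>])
  also have "\<dots> = (LINT y|M. \<xi> x * (cnj (\<xi> y) * v y))"
    unfolding conv_def dual_group_diff[OF \<xi>] by (simp only: mult.assoc)
  also have "\<dots> = fourier M v \<xi> * \<xi> x" unfolding fourier_def by simp
  finally show "conv v \<xi> x = fourier M v \<xi> * \<xi> x" .
qed

text \<open>A nonzero \<open>v\<close> makes the Hermitian kernel \<open>conv v (adj v)\<close>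
  nonzero at 0, hence gives a character with nonzero eigenvalue. But convolution with
  \<open>v\<close> alone already annihilates every character.\<close>

lemma fourier_eq_zero_imp:
  assumes v: "cont v" and zero: "\<And>\<xi>. \<xi> \<in> dual_group \<Longrightarrow> fourier M v \<xi> = 0"
  shows "v x = 0"
proof (rule ccontr)
  assume nz: "v x \<noteq> 0"
  let ?k = "conv v (adj v)"
  have cv: "cont (adj v)" by (rule cont_adj[OF v])
  have ck: "cont ?k" by (rule cont_conv[OF v cv])
  have ak: "adj ?k = ?k" using adj_conv[OF v cv] conv_commute[OF v cv] by simp
  have "?k 0 \<noteq> 0" using conv_adj_self[OF v] l2_pos[OF v nz] by simp
  then obtain \<xi> and \<kappa> :: real where chi: "\<xi> \<in> dual_group" "\<kappa> \<noteq> 0"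
    and eq: "conv ?k \<xi> = (\<lambda>x. complex_of_real \<kappa> * \<xi> x)"
    using hermitian_eigencharacter[OF ck ak] by metis
  have "conv ?k \<xi> = conv (adj v) (conv v \<xi>)"
    using conv_assoc[OF cv v dual_groupD(1)[OF chi(1)]] conv_commute[OF v cv] by simp
  also have "\<dots> = (\<lambda>x. 0)"
    unfolding conv_character[OF v chi(1)] zero[OF chi(1)] by (simp add: conv_def fun_eq_iff)
  finally have "complex_of_real \<kappa> * \<xi> 0 = 0" using eq by metis
  then show False using chi(2) dual_group_zero[OF chi(1)] by simp
qed

lemma Urysohn_real:
  fixes S T :: "'a set"
  assumes "closed S" "closed T" "S \<inter> T = {}"
  obtains u :: "'a \<Rightarrow> real" where "continuous_on UNIV u" "\<And>x. u x \<in> {0..1}"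
    "\<And>x. x \<in> S \<Longrightarrow> u x = 0" "\<And>x. x \<in> T \<Longrightarrow> u x = 1"
proof -
  have "Hausdorff_space (euclidean :: 'a topology)"
    unfolding Hausdorff_space_def disjnt_def open_openin[symmetric] using hausdorff by metis
  then have "normal_space (euclidean :: 'a topology)"
    using compact_G
    by (intro compact_Hausdorff_or_regular_imp_normal_space disjI1)
      (simp_all add: compact_space_def)
  then obtain u :: "'a \<Rightarrow> real" where "continuous_map euclidean (top_of_set {0..1}) u"
    "u ` S \<subseteq> {0}" "u ` T \<subseteq> {1}"
    using Urysohn_lemma[of "euclidean :: 'a topology" S T 0 1] assms
    by (auto simp: disjnt_def)
  then show ?thesis
    by (intro that[of u]) (auto simp: continuous_map_in_subtopology)
qed

text \<open>If every character were 1 at \<open>a = x - y\<close>, translation by \<open>a\<close>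
  would preserve all Fourier coefficients of a continuous function. A Urysohn function with
  different values at 0 and \<open>a\<close> contradicts uniqueness.\<close>

lemma dual_group_separates:
  fixes x y :: 'a
  assumes "x \<noteq> y"
  obtains \<xi> where "\<xi> \<in> dual_group" "\<xi> x \<noteq> \<xi> y"
proof (rule ccontr)
  assume "\<not> thesis"
  then have eq: "\<xi> x = \<xi> y" if "\<xi> \<in> dual_group" for \<xi> using \<open>_ \<Longrightarrow> _ \<Longrightarrow> thesis\<close> that by blast
  define a where "a = x - y"
  have a: "a \<noteq> 0" using assms by (simp add: a_def)
  have chi_a: "\<xi> a = 1" if "\<xi> \<in> dual_group" for \<xi>
    using dual_group_diff[OF that, of x y] eq[OF that] dual_groupD(3)[OF that, of y]
      complex_norm_square[of "\<xi> y"] by (simp add: a_def)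
  obtain u :: "'a \<Rightarrow> real" where u: "continuous_on UNIV u" "u 0 = 0" "u a = 1"
    using Urysohn_real[of "{0}" "{a}"] a by auto
  let ?u = "\<lambda>x. complex_of_real (u x)"
  have cu: "cont ?u" by (intro continuous_intros u)
  let ?v = "\<lambda>x. ?u (x + a) - ?u x"
  have cv: "cont ?v" by (intro continuous_on_diff cont_shift(1)[OF cu] cu)
  have "fourier M ?v \<xi> = 0" if "\<xi> \<in> dual_group" for \<xi>
  proof -
    note cc = continuous_on_cnj[OF dual_groupD(1)[OF that]]
    have w: "cont (\<lambda>x. cnj (\<xi> x) * ?u x)" by (intro continuous_on_mult cc cu)
    have "fourier M ?v \<xi> = (LINT x|M. cnj (\<xi> x) * ?u (x + a)) - (LINT x|M. cnj (\<xi> x) * ?u x)"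
      unfolding fourier_def right_diff_distrib
      by (intro Bochner_Integration.integral_diff cont_integrable w continuous_on_mult cc cont_shift(1)[OF cu])
    also have "(LINT x|M. cnj (\<xi> x) * ?u (x + a)) = (LINT x|M. cnj (\<xi> (a + x)) * ?u (a + x))"
      by (simp add: dual_groupD(2)[OF that] chi_a[OF that] add.commute)
    also have "\<dots> = (LINT x|M. cnj (\<xi> x) * ?u x)"
      by (rule integral_translation[OF cont_measurable[OF w]])
    finally show ?thesis by simp
  qed
  from fourier_eq_zero_imp[OF cv this, of 0] u show False by simp
qed

end

inductive_set trig_poly :: "('a::topological_ab_group_add \<Rightarrow> complex) set" where
  monomial: "\<xi> \<in> dual_group \<Longrightarrow> (\<lambda>x. c * \<xi> x) \<in> trig_poly"
| add: "s \<in> trig_poly \<Longrightarrow> t \<in> trig_poly \<Longrightarrow> (\<lambda>x. s x + t x) \<in> trig_poly"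

lemma trig_poly_monomial_mult:
  assumes "t \<in> trig_poly" "\<xi> \<in> dual_group"
  shows "(\<lambda>x. c * \<xi> x * t x) \<in> trig_poly"
  using assms(1)
proof induction
  case (monomial \<eta> d)
  have "(\<lambda>x. (c * d) * (\<xi> x * \<eta> x)) \<in> trig_poly"
    by (intro trig_poly.monomial dual_group_mult assms monomial)
  then show ?case by (simp add: mult_ac)
next
  case (add s t)
  then show ?case using trig_poly.add by (simp add: distrib_left)
qed

lemma trig_poly_mult:
  assumes "s \<in> trig_poly" "t \<in> trig_poly"
  shows "(\<lambda>x. s x * t x) \<in> trig_poly"
  using assms(1)
proof induction
  case (monomial \<xi> c)
  then show ?case by (intro trig_poly_monomial_mult assms)
next
  case (add s' t')
  then show ?case using trig_poly.add by (simp add: distrib_right)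
qed

lemma trig_poly_scale: "t \<in> trig_poly \<Longrightarrow> (\<lambda>x. c * t x) \<in> trig_poly"
  using trig_poly_monomial_mult[OF _ dual_group_one, of t c] by simp

lemma trig_poly_cnj:
  assumes "t \<in> trig_poly"
  shows "(\<lambda>x. cnj (t x)) \<in> trig_poly"
  using assms
proof induction
  case (monomial \<xi> c)
  then show ?case using trig_poly.monomial[OF dual_group_cnj, of \<xi> "cnj c"] by simp
next
  case (add s t)
  then show ?case using trig_poly.add by simp
qed

lemma trig_poly_continuous: "t \<in> trig_poly \<Longrightarrow> continuous_on UNIV t"
  by (induction rule: trig_poly.induct) (simp_all add: continuous_on_mult continuous_on_add dual_groupD(1))

text \<open>Coefficients vanish off \<open>F\<close>, so that \<open>F\<close> may be enlarged
  without changing the sum.\<close>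

lemma trig_poly_sum:
  assumes "t \<in> trig_poly"
  obtains F c where "finite F" "F \<subseteq> dual_group" "\<And>\<xi>. \<xi> \<notin> F \<Longrightarrow> c \<xi> = 0"
    "t = (\<lambda>x. \<Sum>\<xi>\<in>F. c \<xi> * \<xi> x)"
proof -
  from assms have "\<exists>F c. finite F \<and> F \<subseteq> dual_group \<and> (\<forall>\<xi>. \<xi> \<notin> F \<longrightarrow> c \<xi> = 0)
      \<and> t = (\<lambda>x. \<Sum>\<xi>\<in>F. c \<xi> * \<xi> x)"
  proof induction
    case (monomial \<xi> c)
    then show ?case by (intro exI[of _ "{\<xi>}"] exI[of _ "\<lambda>\<eta>. if \<eta> = \<xi> then c else 0"]) auto
  next
    case (add s t)
    from add.IH(1) obtain F c where F: "finite F" "F \<subseteq> dual_group" "\<forall>\<xi>. \<xi> \<notin> F \<longrightarrow> c \<xi> = 0"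
      "s = (\<lambda>x. \<Sum>\<xi>\<in>F. c \<xi> * \<xi> x)" by (elim exE conjE)
    from add.IH(2) obtain G d where G: "finite G" "G \<subseteq> dual_group" "\<forall>\<xi>. \<xi> \<notin> G \<longrightarrow> d \<xi> = 0"
      "t = (\<lambda>x. \<Sum>\<xi>\<in>G. d \<xi> * \<xi> x)" by (elim exE conjE)
    have "s x = (\<Sum>\<xi>\<in>F \<union> G. c \<xi> * \<xi> x)" for x
      unfolding F(4) using F G by (intro sum.mono_neutral_left) auto
    moreover have "t x = (\<Sum>\<xi>\<in>F \<union> G. d \<xi> * \<xi> x)" for x
      unfolding G(4) using F G by (intro sum.mono_neutral_left) auto
    ultimately have "(\<lambda>x. s x + t x) = (\<lambda>x. \<Sum>\<xi>\<in>F \<union> G. (c \<xi> + d \<xi>) * \<xi> x)"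
      by (simp add: sum.distrib distrib_right)
    then show ?case using F G
      by (intro exI[of _ "F \<union> G"] exI[of _ "\<lambda>\<xi>. c \<xi> + d \<xi>"]) auto
  qed
  then show ?thesis using that by blast
qed

section \<open>Uniform density of trigonometric polynomials\<close>

context compact_haar
begin

text \<open>Real parts suffice for a real function ring: the factor \<open>- \<i>\<close> turns
  imaginary parts into real parts, and a product of real parts of \<open>s\<close> and
  \<open>t\<close> is the real part of half of \<open>s t\<close> plus \<open>s\<close> times the
  conjugate of \<open>t\<close>.\<close>

lemma trig_poly_function_ring:
  "function_ring_on ((\<lambda>t x. Re (t x)) ` (trig_poly :: ('a \<Rightarrow> complex) set)) UNIV"
proof
  let ?R = "(\<lambda>t x. Re (t x)) ` (trig_poly :: ('a \<Rightarrow> complex) set)"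
  show "compact (UNIV :: 'a set)" by (rule compact_G)
  fix f g :: "'a \<Rightarrow> real" and c :: real and x y :: 'a
  show "(\<lambda>_. c) \<in> ?R"
    by (rule image_eqI[OF _ trig_poly.monomial[OF dual_group_one, of "complex_of_real c"]]) simp
  show "\<exists>f\<in>?R. f x \<noteq> f y" if xy: "x \<noteq> y"
  proof -
    obtain \<xi> where chi: "\<xi> \<in> dual_group" "\<xi> x \<noteq> \<xi> y" using dual_group_separates[OF xy] by metis
    then have "Re (1 * \<xi> x) \<noteq> Re (1 * \<xi> y) \<or> Re (- \<i> * \<xi> x) \<noteq> Re (- \<i> * \<xi> y)"
      by (simp add: complex_eq_iff)
    then show ?thesis
    proof
      assume "Re (1 * \<xi> x) \<noteq> Re (1 * \<xi> y)"
      then show ?thesis by (intro bexI[OF _ imageI[OF trig_poly.monomial[OF chi(1)]]])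
    next
      assume "Re (- \<i> * \<xi> x) \<noteq> Re (- \<i> * \<xi> y)"
      then show ?thesis by (intro bexI[OF _ imageI[OF trig_poly.monomial[OF chi(1)]]])
    qed
  qed
  assume "f \<in> ?R"
  then obtain s where s: "s \<in> trig_poly" "f = (\<lambda>x. Re (s x))" by auto
  show "continuous_on UNIV f"
    unfolding s by (intro continuous_intros trig_poly_continuous s)
  assume "g \<in> ?R"
  then obtain t where t: "t \<in> trig_poly" "g = (\<lambda>x. Re (t x))" by auto
  show "(\<lambda>x. f x + g x) \<in> ?R"
    by (rule image_eqI[OF _ trig_poly.add[OF s(1) t(1)]]) (simp add: s t)
  have "(\<lambda>x. 1 / 2 * (s x * t x + s x * cnj (t x))) \<in> trig_poly"
    by (intro trig_poly_scale trig_poly.add trig_poly_mult trig_poly_cnj s t)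
  then show "(\<lambda>x. f x * g x) \<in> ?R"
    by (rule image_eqI[rotated]) (simp add: s t fun_eq_iff)
qed

lemma trig_poly_dense_real:
  fixes u :: "'a \<Rightarrow> real"
  assumes "continuous_on UNIV u" "e > 0"
  obtains t where "t \<in> trig_poly" "\<And>x. cmod (complex_of_real (u x) - t x) < e"
proof -
  obtain s :: "'a \<Rightarrow> complex" where s: "s \<in> trig_poly" "\<And>x. \<bar>u x - Re (s x)\<bar> < e"
    using function_ring_on.Stone_Weierstrass_basic[OF trig_poly_function_ring assms] by auto
  have "(\<lambda>x. 1 / 2 * (s x + cnj (s x))) \<in> trig_poly"
    by (intro trig_poly_scale trig_poly.add trig_poly_cnj s)
  moreover have "1 / 2 * (s x + cnj (s x)) = complex_of_real (Re (s x))" for x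
    by (simp add: complex_eq_iff)
  ultimately show ?thesis
    using that[of "\<lambda>x. complex_of_real (Re (s x))"] s(2) by (simp flip: of_real_diff)
qed

lemma trig_poly_dense:
  assumes u: "cont u" and e: "e > 0"
  obtains t where "t \<in> trig_poly" "\<And>x. cmod (u x - t x) < e"
proof -
  have e2: "e / 2 > 0" using e by simp
  have "continuous_on UNIV (\<lambda>x. Re (u x))" "continuous_on UNIV (\<lambda>x. Im (u x))"
    by (intro continuous_intros u)+
  then obtain s t where s: "s \<in> trig_poly" "\<And>x. cmod (complex_of_real (Re (u x)) - s x) < e / 2"
    and t: "t \<in> trig_poly" "\<And>x. cmod (complex_of_real (Im (u x)) - t x) < e / 2"
    using trig_poly_dense_real[OF _ e2] by metis
  show ?thesis
  proof (rule that)
    show "(\<lambda>x. s x + \<i> * t x) \<in> trig_poly" by (intro trig_poly.add trig_poly_scale s t)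
    fix x
    have "u x - (s x + \<i> * t x)
        = (complex_of_real (Re (u x)) - s x) + \<i> * (complex_of_real (Im (u x)) - t x)"
      by (subst complex_eq[of "u x"]) (simp add: algebra_simps)
    then have "cmod (u x - (s x + \<i> * t x))
        \<le> cmod (complex_of_real (Re (u x)) - s x) + cmod (complex_of_real (Im (u x)) - t x)"
      using norm_triangle_ineq[of "complex_of_real (Re (u x)) - s x" "\<i> * (complex_of_real (Im (u x)) - t x)"]
      by (simp only: norm_mult norm_ii mult_1)
    then show "cmod (u x - (s x + \<i> * t x)) < e" using s(2)[of x] t(2)[of x] by linarith
  qed
qed

end

section \<open>Mean square approximation\<close>

context compact_haar
begin

definition L2 :: "('a \<Rightarrow> complex) \<Rightarrow> bool" where
  "L2 f \<longleftrightarrow> f \<in> borel_measurable M \<and> integrable M (\<lambda>x. (norm (f x))\<^sup>2)"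

lemma L2_measurable [measurable_dest]: "L2 f \<Longrightarrow> f \<in> borel_measurable M"
  and L2_integrable: "L2 f \<Longrightarrow> integrable M (\<lambda>x. (norm (f x))\<^sup>2)"
  by (simp_all add: L2_def)

lemma L2_cont: "cont f \<Longrightarrow> L2 f"
  unfolding L2_def using cont_measurable l2_integrable by blast

lemma norm_square_add_le: "(norm (a + b :: complex))\<^sup>2 \<le> 2 * (norm a)\<^sup>2 + 2 * (norm b)\<^sup>2"
proof -
  have "(norm (a + b))\<^sup>2 \<le> (norm a + norm b)\<^sup>2"
    by (intro power_mono norm_triangle_ineq) simp
  also have "\<dots> \<le> 2 * (norm a)\<^sup>2 + 2 * (norm b)\<^sup>2"
    using sum_squares_bound[of "norm a" "norm b"] by (simp add: power2_sum)
  finally show ?thesis .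
qed

lemma L2_add:
  assumes f: "L2 f" and g: "L2 g"
  shows "L2 (\<lambda>x. f x + g x)" "l2 (\<lambda>x. f x + g x) \<le> 2 * l2 f + 2 * l2 g"
proof -
  note [measurable] = L2_measurable[OF f] L2_measurable[OF g]
  have i: "integrable M (\<lambda>x. 2 * (norm (f x))\<^sup>2 + 2 * (norm (g x))\<^sup>2)"
    using L2_integrable[OF f] L2_integrable[OF g] by simp
  have "integrable M (\<lambda>x. (norm (f x + g x))\<^sup>2)"
    by (rule Bochner_Integration.integrable_bound[OF i]) (use norm_square_add_le in auto)
  then show s: "L2 (\<lambda>x. f x + g x)" unfolding L2_def by simp
  have "l2 (\<lambda>x. f x + g x) \<le> (LINT x|M. 2 * (norm (f x))\<^sup>2 + 2 * (norm (g x))\<^sup>2)"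
    unfolding l2_def by (intro integral_mono L2_integrable s i norm_square_add_le)
  then show "l2 (\<lambda>x. f x + g x) \<le> 2 * l2 f + 2 * l2 g"
    using L2_integrable[OF f] L2_integrable[OF g] by (simp add: l2_def)
qed

lemma L2_scale:
  assumes f: "L2 f"
  shows "L2 (\<lambda>x. c * f x)" "l2 (\<lambda>x. c * f x) = (norm c)\<^sup>2 * l2 f"
  using L2_integrable[OF f] L2_measurable[OF f]
  unfolding L2_def l2_def by (simp_all add: norm_mult power_mult_distrib)

lemma L2_diff:
  assumes f: "L2 f" and g: "L2 g"
  shows "L2 (\<lambda>x. f x - g x)" "l2 (\<lambda>x. f x - g x) \<le> 2 * l2 f + 2 * l2 g"
  using L2_add[OF f L2_scale(1)[OF g, of "- 1"]] L2_scale(2)[OF g, of "- 1"] by simp_all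

lemma L2_mult_integrable:
  assumes "L2 f" "L2 g"
  shows "integrable M (\<lambda>x. f x * g x)"
  using assms unfolding L2_def by (intro Cauchy_Schwarz_integral) auto

lemma L2_dual_group:
  assumes "\<xi> \<in> dual_group"
  shows "L2 \<xi>" "L2 (\<lambda>x. cnj (\<xi> x))" "l2 \<xi> = \<mu>"
  using L2_cont[OF dual_groupD(1)[OF assms]] L2_cont[OF dual_groupD(1)[OF dual_group_cnj[OF assms]]]
    dual_groupD(3)[OF assms] by (simp_all add: l2_def \<mu>_def)

lemma fourier_lincomb:
  assumes "L2 f" "L2 g" "\<xi> \<in> dual_group"
  shows "fourier M (\<lambda>x. f x - c * g x) \<xi> = fourier M f \<xi> - c * fourier M g \<xi>"
proof -
  note i = L2_mult_integrable[OF L2_dual_group(2)[OF assms(3)]]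
  have "fourier M (\<lambda>x. f x - c * g x) \<xi> = (LINT x|M. cnj (\<xi> x) * f x - c * (cnj (\<xi> x) * g x))"
    unfolding fourier_def by (simp add: algebra_simps)
  also have "\<dots> = fourier M f \<xi> - c * fourier M g \<xi>"
    unfolding fourier_def using i[OF assms(1)] i[OF assms(2)] by simp
  finally show ?thesis .
qed

text \<open>Translating by a point \<open>a\<close> where the two characters differ multiplies the
  integral by a scalar other than 1.\<close>

lemma fourier_character:
  assumes "\<xi> \<in> dual_group" "\<eta> \<in> dual_group"
  shows "fourier M \<eta> \<xi> = (if \<eta> = \<xi> then complex_of_real \<mu> else 0)"
proof (cases "\<eta> = \<xi>")
  case True
  have "cnj (\<xi> x) * \<xi> x = 1" for x
    using complex_norm_square[of "\<xi> x"] dual_groupD(3)[OF assms(1), of x] by (simp add: mult.commute)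
  then show ?thesis using True by (simp add: fourier_def \<mu>_def scaleR_conv_of_real)
next
  case False
  then obtain a where a: "\<eta> a \<noteq> \<xi> a" by auto
  have c: "cont (\<lambda>x. cnj (\<xi> x) * \<eta> x)"
    by (intro continuous_on_mult continuous_on_cnj dual_groupD(1) assms)
  have "fourier M \<eta> \<xi> = (LINT x|M. cnj (\<xi> (a + x)) * \<eta> (a + x))"
    unfolding fourier_def by (rule integral_translation[OF cont_measurable[OF c], symmetric])
  also have "\<dots> = (LINT x|M. (cnj (\<xi> a) * \<eta> a) * (cnj (\<xi> x) * \<eta> x))"
    unfolding dual_groupD(2)[OF assms(1)] dual_groupD(2)[OF assms(2)] by (simp add: mult_ac)
  also have "\<dots> = (cnj (\<xi> a) * \<eta> a) * fourier M \<eta> \<xi>" unfolding fourier_def by simp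
  finally have "\<xi> a * fourier M \<eta> \<xi> = (\<xi> a * cnj (\<xi> a)) * (\<eta> a * fourier M \<eta> \<xi>)"
    by (simp add: mult_ac)
  also have "\<xi> a * cnj (\<xi> a) = 1"
    using complex_norm_square[of "\<xi> a"] dual_groupD(3)[OF assms(1), of a] by simp
  finally show ?thesis using a False by simp
qed

lemma L2_sum:
  assumes "finite F" "F \<subseteq> dual_group"
  shows "L2 (\<lambda>x. \<Sum>\<xi>\<in>F. c \<xi> * \<xi> x)"
  using assms
proof (induction F)
  case empty
  show ?case by (simp add: L2_def)
next
  case (insert \<xi> F)
  then show ?case using L2_add(1)[OF L2_scale(1)[OF L2_dual_group(1)]] by simp
qed

lemma fourier_minus_sum:
  assumes "finite F" "F \<subseteq> dual_group" and f: "L2 f" and \<xi>: "\<xi> \<in> dual_group" "\<xi> \<notin> F"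
  shows "fourier M (\<lambda>x. f x - (\<Sum>\<eta>\<in>F. c \<eta> * \<eta> x)) \<xi> = fourier M f \<xi>"
  using assms(1,2) \<xi>(2)
proof (induction F)
  case (insert \<eta> F)
  then have \<eta>: "\<eta> \<in> dual_group" by simp
  have "L2 (\<lambda>x. f x - (\<Sum>\<eta>\<in>F. c \<eta> * \<eta> x))" using insert by (intro L2_diff f L2_sum) auto
  from fourier_lincomb[OF this L2_dual_group(1)[OF \<eta>] \<xi>(1), of "c \<eta>"]
  have "fourier M (\<lambda>x. f x - (\<Sum>\<eta>\<in>F. c \<eta> * \<eta> x) - c \<eta> * \<eta> x) \<xi> = fourier M f \<xi>"
    using insert by (auto simp: fourier_character[OF \<xi>(1) \<eta>])
  then show ?case using insert.hyps by (simp add: diff_diff_eq add.commute)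
qed simp

text \<open>Completing the square in \<open>c\<close>. The coefficient is divided by \<mu> because a
  character has squared norm \<mu>.\<close>

lemma l2_minus_character:
  assumes g: "L2 g" and \<xi>: "\<xi> \<in> dual_group"
  shows "l2 (\<lambda>x. g x - c * \<xi> x)
    = l2 g - (norm (fourier M g \<xi>))\<^sup>2 / \<mu> + \<mu> * (norm (c - fourier M g \<xi> / \<mu>))\<^sup>2"
proof -
  have "(norm (g x - c * \<xi> x))\<^sup>2 = (norm (g x))\<^sup>2 - 2 * Re (cnj c * (cnj (\<xi> x) * g x)) + (norm c)\<^sup>2" for x
  proof -
    have "(norm (c * \<xi> x))\<^sup>2 = (norm c)\<^sup>2" by (simp add: norm_mult dual_groupD(3)[OF \<xi>])
    moreover have "Re (cnj c * (cnj (\<xi> x) * g x)) = g x \<bullet> (c * \<xi> x)"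
      by (simp add: inner_complex_def algebra_simps)
    ultimately show ?thesis by (simp add: power2_norm_eq_inner inner_diff_left inner_diff_right inner_commute)
  qed
  moreover note i = L2_mult_integrable[OF L2_dual_group(2)[OF \<xi>] g]
  ultimately have "l2 (\<lambda>x. g x - c * \<xi> x) = l2 g - 2 * Re (cnj c * fourier M g \<xi>) + (norm c)\<^sup>2 * \<mu>"
    unfolding l2_def fourier_def using L2_integrable[OF g] integrable_mult_right[OF i, of "cnj c"]
    by (simp add: \<mu>_def del: Re_complex_of_real times_complex.sel)
  moreover have "\<mu> * (norm (c - fourier M g \<xi> / \<mu>))\<^sup>2
      = \<mu> * (norm c)\<^sup>2 - 2 * Re (cnj c * fourier M g \<xi>) + (norm (fourier M g \<xi>))\<^sup>2 / \<mu>"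
  proof -
    have "Re (cnj c * fourier M g \<xi>) = c \<bullet> fourier M g \<xi>" by (simp add: inner_complex_def)
    moreover have "fourier M g \<xi> / \<mu> = (1 / \<mu>) *\<^sub>R fourier M g \<xi>"
      by (simp add: scaleR_conv_of_real)
    ultimately show ?thesis using mu_pos
      by (simp only: power2_norm_eq_inner inner_diff_left inner_diff_right inner_scaleR_left
          inner_scaleR_right inner_commute[of "fourier M g \<xi>" c]) (simp add: field_simps power2_eq_square)
  qed
  ultimately show ?thesis by simp
qed

lemma l2_minus_sum:
  assumes "finite F" "F \<subseteq> dual_group" and f: "L2 f"
  shows "l2 (\<lambda>x. f x - (\<Sum>\<xi>\<in>F. c \<xi> * \<xi> x))
    = l2 f - (\<Sum>\<xi>\<in>F. (norm (fourier M f \<xi>))\<^sup>2) / \<mu> + \<mu> * (\<Sum>\<xi>\<in>F. (norm (c \<xi> - fourier M f \<xi> / \<mu>))\<^sup>2)"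
  using assms(1,2)
proof (induction F)
  case (insert \<xi> F)
  then have \<xi>: "\<xi> \<in> dual_group" and F: "finite F" "F \<subseteq> dual_group" "\<xi> \<notin> F" by auto
  have L: "L2 (\<lambda>x. f x - (\<Sum>\<xi>\<in>F. c \<xi> * \<xi> x))" by (intro L2_diff f L2_sum F)
  have "l2 (\<lambda>x. f x - (\<Sum>\<xi>\<in>F. c \<xi> * \<xi> x) - c \<xi> * \<xi> x)
      = l2 f - (\<Sum>\<xi>\<in>insert \<xi> F. (norm (fourier M f \<xi>))\<^sup>2) / \<mu>
        + \<mu> * (\<Sum>\<xi>\<in>insert \<xi> F. (norm (c \<xi> - fourier M f \<xi> / \<mu>))\<^sup>2)"
    unfolding l2_minus_character[OF L \<xi>] fourier_minus_sum[OF F(1,2) f \<xi> F(3)]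
      insert.IH[OF F(2)] sum.insert[OF F(1,3)]
    by (simp add: distrib_left add_divide_distrib)
  then show ?case using F by (simp add: diff_diff_eq add.commute)
qed simp

definition proj :: "('a \<Rightarrow> complex) set \<Rightarrow> ('a \<Rightarrow> complex) \<Rightarrow> 'a \<Rightarrow> complex" where
  "proj F f x = (\<Sum>\<xi>\<in>F. fourier M f \<xi> / \<mu> * \<xi> x)"

lemma l2_minus_proj:
  assumes "finite F" "F \<subseteq> dual_group" "L2 f"
  shows "L2 (\<lambda>x. f x - proj F f x)"
    and "l2 (\<lambda>x. f x - proj F f x) = l2 f - (\<Sum>\<xi>\<in>F. (norm (fourier M f \<xi>))\<^sup>2) / \<mu>"
proof -
  show "L2 (\<lambda>x. f x - proj F f x)"
    unfolding proj_def by (rule L2_diff(1)[OF assms(3) L2_sum[OF assms(1,2)]])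
  show "l2 (\<lambda>x. f x - proj F f x) = l2 f - (\<Sum>\<xi>\<in>F. (norm (fourier M f \<xi>))\<^sup>2) / \<mu>"
    unfolding proj_def l2_minus_sum[OF assms] by simp
qed

lemma Bessel:
  assumes "finite F" "F \<subseteq> dual_group" "L2 f"
  shows "(\<Sum>\<xi>\<in>F. (norm (fourier M f \<xi>))\<^sup>2) \<le> \<mu> * l2 f"
proof -
  have "(\<Sum>\<xi>\<in>F. (norm (fourier M f \<xi>))\<^sup>2) / \<mu> \<le> l2 f"
    using l2_minus_proj(2)[OF assms] l2_nonneg[of "\<lambda>x. f x - proj F f x"] by linarith
  then show ?thesis using mu_pos by (simp add: field_simps)
qed

text \<open>Outer regularity is applied to \<open>A\<close> and to its complement. The Urysohn
  function equals the indicator off \<open>U \<inter> V\<close>, and this set is small because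
  \<open>U\<close> and \<open>V\<close> cover the group with total measure below
  \<open>\<mu> + e\<close>.\<close>

lemma indicator_approximation:
  assumes A: "A \<in> sets M" and e: "e > 0"
  obtains u :: "'a \<Rightarrow> real" where "continuous_on UNIV u"
    "l2 (\<lambda>x. complex_of_real (indicator A x) - complex_of_real (u x)) < e"
proof -
  have outer: "\<exists>U. open U \<and> A \<subseteq> U \<and> measure M U < measure M A + e / 2" if "A \<in> sets M" for A
  proof -
    have "emeasure M A < emeasure M A + ennreal (e / 2)"
      using e by (simp add: ennreal_add_left_cancel_less[of "emeasure M A" 0, simplified])
    then have "(INF U\<in>{U. open U \<and> A \<subseteq> U}. emeasure M U) < emeasure M A + ennreal (e / 2)"
      using outer_regular[OF that] by metis
    then obtain U where U: "open U" "A \<subseteq> U" "emeasure M U < emeasure M A + ennreal (e / 2)"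
      unfolding INF_less_iff by blast
    then have "ennreal (measure M U) < ennreal (measure M A + e / 2)"
      using e by (simp add: emeasure_eq_measure ennreal_plus)
    then have "measure M U < measure M A + e / 2" by (simp add: ennreal_less_iff)
    with U show ?thesis by blast
  qed
  obtain U where U: "open U" "A \<subseteq> U" "measure M U < measure M A + e / 2" using outer[OF A] by blast
  have A': "- A \<in> sets M" using A sets.compl_sets[OF A] by (simp add: Compl_eq_Diff_UNIV)
  obtain V where V: "open V" "- A \<subseteq> V" "measure M V < measure M (- A) + e / 2"
    using outer[OF A'] by blast
  have [measurable]: "U \<in> sets M" "V \<in> sets M" using U V by auto
  obtain u :: "'a \<Rightarrow> real" where u: "continuous_on UNIV u" "\<And>x. u x \<in> {0..1}"
    "\<And>x. x \<in> - U \<Longrightarrow> u x = 0" "\<And>x. x \<in> - V \<Longrightarrow> u x = 1"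
  proof (rule Urysohn_real[of "- U" "- V"])
    show "closed (- U)" "closed (- V)" using U(1) V(1) by (simp_all add: closed_Compl)
    show "- U \<inter> - V = {}" using U(2) V(2) by blast
  qed (rule that)
  let ?d = "\<lambda>x. complex_of_real (indicator A x) - complex_of_real (u x)"
  have le: "(norm (?d x))\<^sup>2 \<le> indicator (U \<inter> V) x" for x
  proof -
    have "norm (?d x) = \<bar>indicator A x - u x\<bar>" unfolding of_real_diff[symmetric] norm_of_real ..
    also have "\<dots> \<le> indicator (U \<inter> V) x"
      using u(2)[of x] u(3)[of x] u(4)[of x] U(2) V(2) by (auto simp: indicator_def split: if_splits)
    finally have "(norm (?d x))\<^sup>2 \<le> (indicator (U \<inter> V) x)\<^sup>2" by (rule power_mono) simp
    moreover have "(indicator (U \<inter> V) x :: real)\<^sup>2 = indicator (U \<inter> V) x"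
      by (simp add: indicator_def)
    ultimately show ?thesis by (simp only:)
  qed
  have "l2 ?d \<le> (LINT x|M. indicator (U \<inter> V) x)"
    unfolding l2_def
  proof (rule integral_mono_AE')
    show "integrable M (indicat_real (U \<inter> V))" by (simp add: emeasure_eq_measure)
  qed (use le in auto)
  also have "\<dots> = measure M (U \<inter> V)" by simp
  also have "\<dots> = measure M U + measure M V - measure M (U \<union> V)"
    using measure_Un3[of U M V] U(1) V(1) by (simp add: fmeasurable_eq_sets)
  also have "U \<union> V = UNIV" using U(2) V(2) by blast
  also have "measure M U + measure M V - measure M UNIV < e"
    using U(3) V(3) finite_measure_compl[OF A] by (simp add: Compl_eq_Diff_UNIV)
  finally show ?thesis using that u(1) by blast
qed

section \<open>Density of trigonometric polynomials in mean square\<close>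

definition trig_approximable :: "('a \<Rightarrow> complex) \<Rightarrow> bool" where
  "trig_approximable f \<longleftrightarrow> L2 f \<and> (\<forall>e>0. \<exists>t\<in>trig_poly. l2 (\<lambda>x. f x - t x) < e)"

lemma L2_trig_poly: "t \<in> trig_poly \<Longrightarrow> L2 t"
  by (intro L2_cont trig_poly_continuous)

lemma trig_approximable_limit:
  assumes f: "L2 f" and g: "\<And>e. e > 0 \<Longrightarrow> \<exists>g. trig_approximable g \<and> l2 (\<lambda>x. f x - g x) < e"
  shows "trig_approximable f"
  unfolding trig_approximable_def
proof (intro conjI allI impI f)
  fix e :: real assume "e > 0"
  \<comment> \<open>Two errors, each doubled by \<open>L2_add\<close>.\<close>
  then have e: "e / 4 > 0" by simp
  obtain g where g: "trig_approximable g" "l2 (\<lambda>x. f x - g x) < e / 4" using g[OF e] by blast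
  then obtain t where t: "t \<in> trig_poly" "l2 (\<lambda>x. g x - t x) < e / 4" and Lg: "L2 g"
    using e unfolding trig_approximable_def by blast
  have "l2 (\<lambda>x. f x - t x) \<le> 2 * l2 (\<lambda>x. f x - g x) + 2 * l2 (\<lambda>x. g x - t x)"
    using L2_add(2)[OF L2_diff(1)[OF f Lg] L2_diff(1)[OF Lg L2_trig_poly[OF t(1)]]] by simp
  with g t show "\<exists>t\<in>trig_poly. l2 (\<lambda>x. f x - t x) < e" by (intro bexI[of _ t]) auto
qed

lemma trig_approximable_add:
  assumes "trig_approximable f" "trig_approximable g"
  shows "trig_approximable (\<lambda>x. f x + g x)"
  unfolding trig_approximable_def
proof (intro conjI allI impI)
  have f: "L2 f" and g: "L2 g" using assms unfolding trig_approximable_def by auto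
  show "L2 (\<lambda>x. f x + g x)" by (rule L2_add(1)[OF f g])
  fix e :: real assume "e > 0"
  then have e: "e / 4 > 0" by simp
  obtain s where s: "s \<in> trig_poly" "l2 (\<lambda>x. f x - s x) < e / 4"
    using assms(1) e unfolding trig_approximable_def by blast
  obtain t where t: "t \<in> trig_poly" "l2 (\<lambda>x. g x - t x) < e / 4"
    using assms(2) e unfolding trig_approximable_def by blast
  have "l2 (\<lambda>x. (f x + g x) - (s x + t x)) \<le> 2 * l2 (\<lambda>x. f x - s x) + 2 * l2 (\<lambda>x. g x - t x)"
    using L2_add(2)[OF L2_diff(1)[OF f L2_trig_poly[OF s(1)]] L2_diff(1)[OF g L2_trig_poly[OF t(1)]]]
    by (simp add: algebra_simps)
  then show "\<exists>t\<in>trig_poly. l2 (\<lambda>x. (f x + g x) - t x) < e"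
    using s t by (intro bexI[OF _ trig_poly.add[OF s(1) t(1)]]) auto
qed

lemma trig_approximable_scale:
  assumes "trig_approximable f"
  shows "trig_approximable (\<lambda>x. c * f x)"
  unfolding trig_approximable_def
proof (intro conjI allI impI)
  have f: "L2 f" using assms unfolding trig_approximable_def by auto
  show "L2 (\<lambda>x. c * f x)" by (rule L2_scale(1)[OF f])
  fix e :: real assume e: "e > 0"
  \<comment> \<open>The summand 1 keeps the divisor positive for \<open>c = 0\<close>.\<close>
  have pos: "(norm c)\<^sup>2 + 1 > 0" by (intro add_nonneg_pos) auto
  then have "e / ((norm c)\<^sup>2 + 1) > 0" using e by simp
  then obtain t where t: "t \<in> trig_poly" "l2 (\<lambda>x. f x - t x) < e / ((norm c)\<^sup>2 + 1)"
    using assms unfolding trig_approximable_def by blast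
  have "l2 (\<lambda>x. c * f x - c * t x) = (norm c)\<^sup>2 * l2 (\<lambda>x. f x - t x)"
    using L2_scale(2)[OF L2_diff(1)[OF f L2_trig_poly[OF t(1)]], of c] by (simp add: right_diff_distrib)
  also have "\<dots> \<le> (norm c)\<^sup>2 * (e / ((norm c)\<^sup>2 + 1))" using t by (intro mult_left_mono) auto
  also have "\<dots> < e" using pos e by (simp add: divide_simps)
  finally show "\<exists>t\<in>trig_poly. l2 (\<lambda>x. c * f x - t x) < e"
    by (intro bexI[OF _ trig_poly_scale[OF t(1)]])
qed

lemma trig_approximable_cont:
  assumes u: "cont u"
  shows "trig_approximable u"
  unfolding trig_approximable_def
proof (intro conjI allI impI L2_cont u)
  fix e :: real assume e: "e > 0"
  define d where "d = sqrt (e / (2 * \<mu>))"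
  have d: "d > 0" "d\<^sup>2 = e / (2 * \<mu>)" unfolding d_def using e mu_pos by auto
  obtain t where t: "t \<in> trig_poly" "\<And>x. cmod (u x - t x) < d" using trig_poly_dense[OF u d(1)] by blast
  have "l2 (\<lambda>x. u x - t x) \<le> \<mu> * (e / (2 * \<mu>))"
  proof (rule l2_le)
    show "cont (\<lambda>x. u x - t x)" by (intro continuous_intros u trig_poly_continuous t)
    show "(cmod (u x - t x))\<^sup>2 \<le> e / (2 * \<mu>)" for x
      using t(2)[of x] unfolding d(2)[symmetric] by (intro power_mono) auto
  qed
  also have "\<dots> < e" using mu_pos e by simp
  finally show "\<exists>t\<in>trig_poly. l2 (\<lambda>x. u x - t x) < e" using t(1) by blast
qed

lemma trig_approximable_indicator:
  assumes A: "A \<in> sets M"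
  shows "trig_approximable (\<lambda>x. complex_of_real (indicator A x))"
proof (rule trig_approximable_limit)
  have "(norm (complex_of_real (indicator A x)))\<^sup>2 = indicator A x" for x
    by (simp add: indicator_def)
  then show "L2 (\<lambda>x. complex_of_real (indicator A x))"
    unfolding L2_def using A by (simp add: emeasure_eq_measure)
  fix e :: real assume "e > 0"
  then obtain u :: "'a \<Rightarrow> real" where u: "continuous_on UNIV u"
    "l2 (\<lambda>x. complex_of_real (indicator A x) - complex_of_real (u x)) < e"
    using indicator_approximation[OF A] by blast
  moreover have "cont (\<lambda>x. complex_of_real (u x))" by (intro continuous_intros u)
  ultimately show "\<exists>g. trig_approximable g \<and> l2 (\<lambda>x. complex_of_real (indicator A x) - g x) < e"
    using trig_approximable_cont by blast
qed

lemma trig_approximable_sum: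
  assumes "finite I" "\<And>i. i \<in> I \<Longrightarrow> trig_approximable (f i)"
  shows "trig_approximable (\<lambda>x. \<Sum>i\<in>I. f i x)"
  using assms
proof (induction I)
  case empty
  show ?case using trig_approximable_cont[of "\<lambda>x. 0"] by simp
next
  case (insert i I)
  then show ?case using trig_approximable_add[of "f i"] by simp
qed

lemma trig_approximable_simple:
  assumes s: "simple_function M s"
  shows "trig_approximable s"
proof -
  have fin: "finite (range s)" using simple_functionD(1)[OF s] by simp
  have "trig_approximable (\<lambda>x. \<Sum>y\<in>range s. y * complex_of_real (indicator (s -` {y}) x))"
    using simple_functionD(2)[OF s]
    by (intro trig_approximable_sum fin trig_approximable_scale trig_approximable_indicator) simp
  moreover have "(\<Sum>y\<in>range s. y * complex_of_real (indicator (s -` {y}) x)) = s x" for x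
  proof -
    have "(\<Sum>y\<in>range s. y * complex_of_real (indicator (s -` {y}) x))
        = (\<Sum>y\<in>range s. if y = s x then y else 0)"
      by (intro sum.cong refl) (auto simp: indicator_def)
    then show ?thesis using fin by simp
  qed
  ultimately show ?thesis by simp
qed

lemma trig_approximable_L2:
  assumes f: "L2 f"
  shows "trig_approximable f"
proof (rule trig_approximable_limit[OF f])
  fix e :: real assume e: "e > 0"
  note [measurable] = L2_measurable[OF f]
  obtain F where F: "\<And>i. simple_function M (F i)" "\<And>x. (\<lambda>i. F i x) \<longlonglongrightarrow> f x"
    "\<And>i x. dist (F i x) 0 \<le> 2 * dist (f x) 0"
    using borel_measurable_implies_sequence_metric[of f M 0] by auto
  have [measurable]: "F i \<in> borel_measurable M" for i by (rule borel_measurable_simple_function[OF F(1)])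
  have "(\<lambda>i. LINT x|M. (norm (f x - F i x))\<^sup>2) \<longlonglongrightarrow> (LINT x|M. 0)"
  proof (rule integral_dominated_convergence)
    \<comment> \<open>The approximants satisfy \<open>norm (F i x) \<le> 2 * norm (f x)\<close>,
      whence the constant 2 + 2 * 4 = 10.\<close>
    show "integrable M (\<lambda>x. 10 * (norm (f x))\<^sup>2)" using L2_integrable[OF f] by simp
    have "(\<lambda>i. (norm (f x - F i x))\<^sup>2) \<longlonglongrightarrow> (norm (f x - f x))\<^sup>2" for x
      by (intro tendsto_intros F)
    then show "AE x in M. (\<lambda>i. (norm (f x - F i x))\<^sup>2) \<longlonglongrightarrow> 0" by simp
    fix i
    have "(norm (f x - F i x))\<^sup>2 \<le> 10 * (norm (f x))\<^sup>2" for x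
    proof -
      have "(norm (f x - F i x))\<^sup>2 \<le> 2 * (norm (f x))\<^sup>2 + 2 * (norm (F i x))\<^sup>2"
        using norm_square_add_le[of "f x" "- F i x"] by simp
      moreover have "(norm (F i x))\<^sup>2 \<le> (2 * norm (f x))\<^sup>2"
        using F(3)[of i x] by (intro power_mono) auto
      ultimately show ?thesis by (simp add: power_mult_distrib)
    qed
    then show "AE x in M. norm ((norm (f x - F i x))\<^sup>2) \<le> 10 * (norm (f x))\<^sup>2" by simp
  qed measurable
  then have "(\<lambda>i. l2 (\<lambda>x. f x - F i x)) \<longlonglongrightarrow> 0" unfolding l2_def by simp
  then have "\<forall>\<^sub>F i in sequentially. l2 (\<lambda>x. f x - F i x) < e" using e by (rule order_tendstoD)
  then obtain i where "l2 (\<lambda>x. f x - F i x) < e" unfolding eventually_sequentially by blast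
  then show "\<exists>g. trig_approximable g \<and> l2 (\<lambda>x. f x - g x) < e"
    using trig_approximable_simple[OF F(1)] by blast
qed

text \<open>The projection is the best approximation with frequencies in a given set, and enlarging
  the set cannot hurt. Prescribing \<open>F0\<close> allows a comparison with the projection onto a
  fixed frequency range.\<close>

lemma proj_approximation:
  assumes f: "L2 f" and e: "e > 0" and F0: "finite F0" "F0 \<subseteq> dual_group"
  obtains F where "finite F" "F \<subseteq> dual_group" "F0 \<subseteq> F" "l2 (\<lambda>x. f x - proj F f x) < e"
proof -
  obtain t where t: "t \<in> trig_poly" "l2 (\<lambda>x. f x - t x) < e"
    using trig_approximable_L2[OF f] e unfolding trig_approximable_def by blast
  obtain G c where G: "finite G" "G \<subseteq> dual_group" "\<And>\<xi>. \<xi> \<notin> G \<Longrightarrow> c \<xi> = 0"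
    "t = (\<lambda>x. \<Sum>\<xi>\<in>G. c \<xi> * \<xi> x)" using trig_poly_sum[OF t(1)] by metis
  let ?F = "G \<union> F0"
  have F: "finite ?F" "?F \<subseteq> dual_group" using G F0 by auto
  have t': "t x = (\<Sum>\<xi>\<in>?F. c \<xi> * \<xi> x)" for x
    unfolding G(4) using F G by (intro sum.mono_neutral_left) auto
  have "0 \<le> \<mu> * (\<Sum>\<xi>\<in>?F. (norm (c \<xi> - fourier M f \<xi> / \<mu>))\<^sup>2)"
    using mu_pos by (intro mult_nonneg_nonneg sum_nonneg) auto
  then have "l2 (\<lambda>x. f x - proj ?F f x) \<le> l2 (\<lambda>x. f x - t x)"
    unfolding t' l2_minus_sum[OF F f] l2_minus_proj(2)[OF F f] by simp
  then show ?thesis using that[of ?F] F t by auto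
qed

end

section \<open>Completeness and weak type estimates\<close>

lemma cmod_add_powr_le:
  assumes "p \<ge> 0"
  shows "cmod (a + b) powr p \<le> 2 powr p * (cmod a powr p + cmod b powr p)"
proof -
  have "cmod (a + b) powr p \<le> (2 * max (cmod a) (cmod b)) powr p"
    using norm_triangle_ineq[of a b] assms by (intro powr_mono2) auto
  also have "\<dots> = 2 powr p * (max (cmod a) (cmod b) powr p)"
    by (rule powr_mult)
  also have "\<dots> \<le> 2 powr p * (cmod a powr p + cmod b powr p)"
    by (intro mult_left_mono) (auto simp: max_def)
  finally show ?thesis .
qed

text \<open>An elementary replacement for Hoelder: where \<open>d x\<close> exceeds
  \<open>T\<close>, the exponent 1 - p is not positive, so \<open>d x\<close> is at most
  \<open>T powr (1 - p) * d x powr p\<close>.\<close>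

lemma (in finite_measure) nn_integral_norm_le_powr:
  fixes d :: "'a \<Rightarrow> real"
  assumes [measurable]: "d \<in> borel_measurable M" and d: "\<And>x. d x \<ge> 0" and p: "p \<ge> 1" and T: "T > 0"
    and small: "(\<integral>\<^sup>+x. ennreal (d x powr p) \<partial>M) \<le> ennreal (T powr p)"
  shows "(\<integral>\<^sup>+x. ennreal (d x) \<partial>M) \<le> ennreal (T * (measure M (space M) + 1))"
proof -
  have le: "d x \<le> T + T powr (1 - p) * d x powr p" for x
  proof (cases "d x \<le> T")
    case True
    then show ?thesis by (simp add: add_increasing2)
  next
    case False
    then have "d x = d x powr (1 - p) * d x powr p" using T by (simp flip: powr_add)
    also have "\<dots> \<le> T powr (1 - p) * d x powr p"
      using False T p by (intro mult_right_mono powr_mono2') auto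
    finally show ?thesis using T by simp
  qed
  have "(\<integral>\<^sup>+x. ennreal (d x) \<partial>M) \<le> (\<integral>\<^sup>+x. ennreal T + ennreal (T powr (1 - p)) * ennreal (d x powr p) \<partial>M)"
    using le T by (intro nn_integral_mono) (simp flip: ennreal_plus ennreal_mult)
  also have "\<dots> = ennreal T * emeasure M (space M)
      + ennreal (T powr (1 - p)) * (\<integral>\<^sup>+x. ennreal (d x powr p) \<partial>M)"
    by (simp add: nn_integral_add nn_integral_cmult)
  also have "\<dots> \<le> ennreal T * emeasure M (space M) + ennreal (T powr (1 - p)) * ennreal (T powr p)"
    by (intro add_left_mono mult_left_mono small) simp
  also have "\<dots> = ennreal (T * measure M (space M) + T powr (1 - p) * T powr p)"
    using T by (simp add: emeasure_eq_measure ennreal_mult ennreal_plus)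
  also have "T powr (1 - p) * T powr p = T" using T by (simp flip: powr_add)
  finally show ?thesis by (simp add: distrib_left)
qed

text \<open>Riesz-Fischer with integrals of p-th powers. A fast subsequence has summable increments
  in mean, hence converges almost everywhere; Fatou's lemma then handles the whole sequence.\<close>

lemma (in finite_measure) Lp_complete:
  fixes f :: "nat \<Rightarrow> 'a \<Rightarrow> complex"
  assumes [measurable]: "\<And>n. f n \<in> borel_measurable M" and p: "p \<ge> 1"
    and cauchy: "\<And>e. e > 0 \<Longrightarrow> \<exists>N. \<forall>m\<ge>N. \<forall>n\<ge>N. (\<integral>\<^sup>+x. ennreal (cmod (f m x - f n x) powr p) \<partial>M) \<le> ennreal e"
  obtains g where "g \<in> borel_measurable M"
    "(\<lambda>n. \<integral>\<^sup>+x. ennreal (cmod (f n x - g x) powr p) \<partial>M) \<longlonglongrightarrow> 0"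
proof -
  have "\<exists>N. \<forall>m\<ge>N. \<forall>n\<ge>N. (\<integral>\<^sup>+x. ennreal (cmod (f m x - f n x) powr p) \<partial>M) \<le> ennreal (((1 / 2) ^ j) powr p)" for j
    by (rule cauchy) simp
  then obtain N where N: "\<And>j m n. m \<ge> N j \<Longrightarrow> n \<ge> N j \<Longrightarrow>
      (\<integral>\<^sup>+x. ennreal (cmod (f m x - f n x) powr p) \<partial>M) \<le> ennreal (((1 / 2) ^ j) powr p)" by metis
  \<comment> \<open>Partial sums make both \<open>k j\<close> and \<open>k (Suc j)\<close> at least
    \<open>N j\<close>; the summand \<open>j\<close> makes the indices tend to infinity.\<close>
  define k where "k j = j + (\<Sum>i\<le>j. N i)" for j
  have kN: "k j \<ge> N j" "k (Suc j) \<ge> N j" "k j \<ge> j" for j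
  proof -
    have "N j \<le> (\<Sum>i\<le>j. N i)" by (rule member_le_sum) auto
    then show "k j \<ge> N j" "k (Suc j) \<ge> N j" "k j \<ge> j" unfolding k_def by simp_all
  qed
  define d where "d j x = cmod (f (k (Suc j)) x - f (k j) x)" for j x
  have [measurable]: "d j \<in> borel_measurable M" for j unfolding d_def by measurable
  have "(\<integral>\<^sup>+x. ennreal (d j x) \<partial>M) \<le> ennreal ((1 / 2) ^ j * (measure M (space M) + 1))" for j
    by (rule nn_integral_norm_le_powr[OF _ _ p]) (use N[OF kN(2,1)] in \<open>auto simp: d_def\<close>)
  then have "(\<Sum>j. \<integral>\<^sup>+x. ennreal (d j x) \<partial>M) \<le> (\<Sum>j. ennreal ((1 / 2) ^ j * (measure M (space M) + 1)))"
    by (intro suminf_le) auto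
  also have "\<dots> < \<infinity>"
  proof -
    have "summable (\<lambda>j. (1 / 2 :: real) ^ j * (measure M (space M) + 1))"
      by (intro summable_mult2 summable_geometric) simp
    then show ?thesis by (simp add: suminf_ennreal2)
  qed
  finally have "(\<integral>\<^sup>+x. (\<Sum>j. ennreal (d j x)) \<partial>M) \<noteq> \<infinity>"
    by (subst nn_integral_suminf) auto
  then have "AE x in M. (\<Sum>j. ennreal (d j x)) \<noteq> \<infinity>"
    by (intro nn_integral_noteq_infinite) auto
  then have conv: "AE x in M. convergent (\<lambda>j. f (k j) x)"
  proof eventually_elim
    case (elim x)
    then have "summable (\<lambda>j. d j x)" by (intro summable_suminf_not_top) (auto simp: d_def)
    then have "summable (\<lambda>j. f (k (Suc j)) x - f (k j) x)"
      unfolding d_def by (rule summable_norm_cancel)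
    then have "convergent (\<lambda>n. \<Sum>j<n. f (k (Suc j)) x - f (k j) x)"
      by (simp add: summable_iff_convergent)
    then have "convergent (\<lambda>n. f (k n) x - f (k 0) x)" by (simp add: sum_lessThan_telescope[of "\<lambda>n. f (k n) x"])
    then have "convergent (\<lambda>n. (f (k n) x - f (k 0) x) + f (k 0) x)"
      by (intro convergent_add convergent_const)
    then show ?case by simp
  qed
  define g where "g x = lim (\<lambda>j. f (k j) x)" for x
  have [measurable]: "g \<in> borel_measurable M" unfolding g_def by measurable
  have lim: "AE x in M. (\<lambda>j. f (k j) x) \<longlonglongrightarrow> g x"
    using conv by eventually_elim (simp add: g_def convergent_LIMSEQ_iff)
  have fatou: "(\<integral>\<^sup>+x. ennreal (cmod (f n x - g x) powr p) \<partial>M) \<le> ennreal e"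
    if e: "\<And>m. m \<ge> n0 \<Longrightarrow> (\<integral>\<^sup>+x. ennreal (cmod (f n x - f m x) powr p) \<partial>M) \<le> ennreal e" for n n0 e
  proof -
    have "AE x in M. ennreal (cmod (f n x - g x) powr p)
        = liminf (\<lambda>j. ennreal (cmod (f n x - f (k j) x) powr p))"
      using lim
    proof eventually_elim
      case (elim x)
      have "(\<lambda>j. ennreal (cmod (f n x - f (k j) x) powr p)) \<longlonglongrightarrow> ennreal (cmod (f n x - g x) powr p)"
        using p by (intro tendsto_ennrealI tendsto_powr' tendsto_intros elim) auto
      then show ?case using lim_imp_Liminf[OF trivial_limit_sequentially] by metis
    qed
    then have "(\<integral>\<^sup>+x. ennreal (cmod (f n x - g x) powr p) \<partial>M)
        = (\<integral>\<^sup>+x. liminf (\<lambda>j. ennreal (cmod (f n x - f (k j) x) powr p)) \<partial>M)"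
      by (rule nn_integral_cong_AE)
    also have "\<dots> \<le> liminf (\<lambda>j. \<integral>\<^sup>+x. ennreal (cmod (f n x - f (k j) x) powr p) \<partial>M)"
      by (rule nn_integral_liminf) measurable
    also have "\<dots> \<le> limsup (\<lambda>j. \<integral>\<^sup>+x. ennreal (cmod (f n x - f (k j) x) powr p) \<partial>M)"
      by (rule Liminf_le_Limsup) simp
    also have "\<dots> \<le> ennreal e"
    proof (rule Limsup_bounded)
      show "\<forall>\<^sub>F j in sequentially. (\<integral>\<^sup>+x. ennreal (cmod (f n x - f (k j) x) powr p) \<partial>M) \<le> ennreal e"
        unfolding eventually_sequentially using e kN(3) by (meson order_trans)
    qed
    finally show ?thesis .
  qed
  have "(\<lambda>n. \<integral>\<^sup>+x. ennreal (cmod (f n x - g x) powr p) \<partial>M) \<longlonglongrightarrow> 0"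
  proof (rule order_tendstoI)
    fix a :: ennreal assume "0 < a"
    then obtain b where b: "0 < b" "b < a" using dense by blast
    then obtain e where e: "e > 0" "b = ennreal e" by (cases b) auto
    obtain n0 where n0: "\<And>m n. m \<ge> n0 \<Longrightarrow> n \<ge> n0 \<Longrightarrow>
        (\<integral>\<^sup>+x. ennreal (cmod (f m x - f n x) powr p) \<partial>M) \<le> ennreal e"
      using cauchy[OF e(1)] by blast
    have "(\<integral>\<^sup>+x. ennreal (cmod (f n x - g x) powr p) \<partial>M) < a" if "n \<ge> n0" for n
      using fatou[of n0 n e] n0[OF that] b(2) unfolding e(2) by (meson le_less_trans)
    then show "\<forall>\<^sub>F n in sequentially. (\<integral>\<^sup>+x. ennreal (cmod (f n x - g x) powr p) \<partial>M) < a"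
      unfolding eventually_sequentially by blast
  qed simp
  then show ?thesis using that[of g] by simp
qed

section \<open>Dyadic decomposition and weak-type tails\<close>

lemma powr_le_dyadic_suminf:
  fixes t T p :: real
  assumes T: "T > 0" and t: "t > T" and p: "p \<ge> 0"
  shows "ennreal (t powr p) \<le> (\<Sum>k. ennreal ((2 ^ Suc k * T) powr p) * indicator {y. y > 2 ^ k * T} t)"
proof -
  define G where "G k = ennreal ((2 ^ Suc k * T) powr p) * indicator {y. y > 2 ^ k * T} t" for k :: nat
  have "\<exists>n. t / T < 2 ^ n" by (rule real_arch_pow) simp
  then obtain n where n: "t \<le> 2 ^ n * T" using T by (auto simp: field_simps intro: less_imp_le)
  define m where "m = (LEAST n. t \<le> 2 ^ n * T)"
  have m: "t \<le> 2 ^ m * T" unfolding m_def using n by (rule LeastI)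
  have "m \<noteq> 0" using m t by (cases m) auto
  then obtain k where k: "m = Suc k" by (cases m) auto
  have "\<not> t \<le> 2 ^ k * T" using not_less_Least[of k "\<lambda>n. t \<le> 2 ^ n * T"] k unfolding m_def by simp
  then have "ennreal (t powr p) \<le> G k"
    unfolding G_def using m k p t T by (auto intro!: ennreal_leI powr_mono2)
  also have "G k \<le> suminf G" using sum_le_suminf[OF summableI, of "{k}" G] by simp
  finally show ?thesis unfolding G_def .
qed

text \<open>The level \<open>2 ^ k * T\<close> contributes at most
  \<open>(2 ^ Suc k * T) powr p * D * (2 ^ k * T) powr (- q)\<close>, a geometric sequence with
  ratio \<open>2 powr (p - q)\<close>, which is below 1.\<close>

lemma (in finite_measure) weak_type_tail:
  fixes h :: "'a \<Rightarrow> real"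
  assumes [measurable]: "h \<in> borel_measurable M"
    and weak: "\<And>t. t > 0 \<Longrightarrow> measure M {x \<in> space M. h x > t} \<le> D * t powr (- q)"
    and D: "D \<ge> 0" and p: "0 \<le> p" "p < q" and T: "T > 0"
  shows "(\<integral>\<^sup>+x. ennreal (h x powr p) * indicator {y. y > T} (h x) \<partial>M)
    \<le> ennreal (D * 2 powr p / (1 - 2 powr (p - q)) * T powr (p - q))"
proof -
  let ?g = "\<lambda>k x. ennreal ((2 ^ Suc k * T) powr p) * indicator {y. y > 2 ^ k * T} (h x)"
  let ?c = "D * 2 powr p * T powr (p - q)"
  have r: "2 powr (p - q) < (1::real)" using p by (simp add: powr_less_one)
  have "(\<integral>\<^sup>+x. ennreal (h x powr p) * indicator {y. y > T} (h x) \<partial>M) \<le> (\<integral>\<^sup>+x. (\<Sum>k. ?g k x) \<partial>M)"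
    using powr_le_dyadic_suminf[OF T _ p(1)] by (intro nn_integral_mono) (auto split: split_indicator)
  also have "\<dots> = (\<Sum>k. \<integral>\<^sup>+x. ?g k x \<partial>M)" by (rule nn_integral_suminf) measurable
  also have "\<dots> \<le> (\<Sum>k. ennreal (?c * (2 powr (p - q)) ^ k))"
  proof (intro suminf_le summableI)
    fix k
    have "(\<integral>\<^sup>+x. ?g k x \<partial>M) = ennreal ((2 ^ Suc k * T) powr p) * emeasure M {x \<in> space M. h x > 2 ^ k * T}"
    proof -
      have "(\<integral>\<^sup>+x. ?g k x \<partial>M)
        = (\<integral>\<^sup>+x. ennreal ((2 ^ Suc k * T) powr p) * indicator {x \<in> space M. h x > 2 ^ k * T} x \<partial>M)"
        by (intro nn_integral_cong) (auto split: split_indicator)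
      then show ?thesis by (simp add: nn_integral_cmult_indicator)
    qed
    also have "\<dots> \<le> ennreal ((2 ^ Suc k * T) powr p) * ennreal (D * (2 ^ k * T) powr (- q))"
      unfolding emeasure_eq_measure using weak[of "2 ^ k * T"] T by (intro mult_left_mono ennreal_leI) auto
    also have "\<dots> = ennreal ((2 ^ Suc k * T) powr p * (D * (2 ^ k * T) powr (- q)))"
      using D by (simp add: ennreal_mult)
    also have "(2 ^ Suc k * T) powr p * (D * (2 ^ k * T) powr (- q)) = ?c * (2 powr (p - q)) ^ k"
    proof -
      have "(2 ^ Suc k * T) powr p = 2 powr p * (2 ^ k * T) powr p"
        using T by (simp add: powr_mult mult.assoc)
      moreover have "(2 ^ k * T) powr p * (2 ^ k * T) powr (- q) = (2 ^ k * T) powr (p - q)"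
        by (simp flip: powr_add)
      moreover have "(2 ^ k * T) powr (p - q) = (2 powr (p - q)) ^ k * T powr (p - q)"
        using T by (simp add: powr_mult powr_power powr_powr mult.commute flip: powr_realpow)
      ultimately show ?thesis by (simp add: mult_ac)
    qed
    finally show "(\<integral>\<^sup>+x. ?g k x \<partial>M) \<le> ennreal (?c * (2 powr (p - q)) ^ k)" .
  qed
  also have "\<dots> = ennreal (?c * (1 / (1 - 2 powr (p - q))))"
  proof (rule suminf_ennreal_eq)
    show "(\<lambda>k. ?c * (2 powr (p - q)) ^ k) sums (?c * (1 / (1 - 2 powr (p - q))))"
      using r by (intro sums_mult geometric_sums) simp
  qed (use D in simp)
  finally show ?thesis by (simp add: mult_ac)
qed

section \<open>Sobolev balls\<close>

lemma powr_eq_powr_minus_two: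
  fixes x :: real
  assumes "x > 0"
  shows "x powr p = x powr (p - 2) * x\<^sup>2"
proof -
  have "x powr p = x powr (p - 2) * x powr 2" by (simp flip: powr_add)
  then show ?thesis using assms by simp
qed

text \<open>Bounds over finite sets of characters encode summability without assuming a countable
  dual; countability becomes a consequence.\<close>

locale sobolev_weight = compact_haar M
  for M :: "'a::{topological_ab_group_add, t2_space} measure" +
  fixes w :: "('a \<Rightarrow> complex) \<Rightarrow> real" and s \<alpha> K :: real
  assumes w_ge: "\<xi> \<in> dual_group \<Longrightarrow> 1 \<le> w \<xi>"
    and s_nonneg: "0 \<le> s" and alpha_gt: "s < \<alpha>" and K_pos: "0 < K"
    and weight_sum: "finite F \<Longrightarrow> F \<subseteq> dual_group \<Longrightarrow> (\<Sum>\<xi>\<in>F. w \<xi> powr (- \<alpha>)) \<le> K"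
    and cont_cond: "\<And>e. e > 0 \<Longrightarrow> \<exists>U. open U \<and> (0::'a) \<in> U \<and>
        (\<forall>h\<in>U. \<forall>\<xi>\<in>dual_group. cmod (\<xi> h - 1) / w \<xi> powr s \<le> e)"
begin

text \<open>The sums use counting weights on the dual, so \<open>C\<close> bounds \<mu> times the
  squared Sobolev norm.\<close>

definition Hs_ball :: "real \<Rightarrow> ('a \<Rightarrow> complex) \<Rightarrow> bool" where
  "Hs_ball C f \<longleftrightarrow> L2 f \<and> (\<forall>F. finite F \<longrightarrow> F \<subseteq> dual_group \<longrightarrow>
      (\<Sum>\<xi>\<in>F. w \<xi> powr s * (norm (fourier M f \<xi>))\<^sup>2) \<le> C)"

lemma Hs_ballD:
  assumes "Hs_ball C f"
  shows "L2 f" "finite F \<Longrightarrow> F \<subseteq> dual_group \<Longrightarrow>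
      (\<Sum>\<xi>\<in>F. w \<xi> powr s * (norm (fourier M f \<xi>))\<^sup>2) \<le> C"
  using assms unfolding Hs_ball_def by auto

definition low :: "real \<Rightarrow> ('a \<Rightarrow> complex) set" where
  "low A = {\<xi> \<in> dual_group. w \<xi> \<le> A}"

lemma low_subset: "low A \<subseteq> dual_group"
  unfolding low_def by auto

lemma finite_low:
  assumes A: "A > 0"
  shows "finite (low A)"
proof -
  have "card F \<le> nat \<lceil>K * A powr \<alpha>\<rceil>" if F: "F \<subseteq> low A" "finite F" for F
  proof -
    have "real (card F) * A powr (- \<alpha>) = (\<Sum>\<xi>\<in>F. A powr (- \<alpha>))" by simp
    also have "\<dots> \<le> (\<Sum>\<xi>\<in>F. w \<xi> powr (- \<alpha>))"
    proof (rule sum_mono)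
      fix \<xi> assume "\<xi> \<in> F"
      then have "1 \<le> w \<xi>" "w \<xi> \<le> A" using F(1) w_ge unfolding low_def by auto
      then show "A powr (- \<alpha>) \<le> w \<xi> powr (- \<alpha>)"
        using s_nonneg alpha_gt by (intro powr_mono2') auto
    qed
    also have "\<dots> \<le> K" using F low_subset by (intro weight_sum) auto
    finally have "real (card F) \<le> K * A powr \<alpha>" using A by (simp add: powr_minus field_simps)
    then show ?thesis by linarith
  qed
  then show ?thesis using finite_if_finite_subsets_card_bdd by blast
qed

lemma countable_dual_group: "countable (dual_group :: ('a \<Rightarrow> complex) set)"
proof -
  have "(dual_group :: ('a \<Rightarrow> complex) set) \<subseteq> (\<Union>n. low (real (Suc n)))"
  proof
    fix \<xi> :: "'a \<Rightarrow> complex" assume "\<xi> \<in> dual_group"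
    moreover obtain n where "w \<xi> \<le> real n" using real_arch_simple by blast
    ultimately have "\<xi> \<in> low (real (Suc n))" unfolding low_def by simp
    then show "\<xi> \<in> (\<Union>n. low (real (Suc n)))" by blast
  qed
  moreover have "countable (\<Union>n. low (real (Suc n)))"
    by (rule countable_UN) (auto intro!: countable_finite finite_low)
  ultimately show ?thesis by (rule countable_subset)
qed

text \<open>An infinite Parseval sum is avoided: a finite \<open>F\<close> containing
  \<open>low A\<close> captures \<open>h\<close> up to \<open>e\<close>, and each frequency in
  \<open>F - low A\<close> gains the factor \<open>A powr (- s)\<close>.\<close>

lemma l2_minus_proj_low:
  assumes h: "Hs_ball C h" and A: "A > 0"
  shows "l2 (\<lambda>x. h x - proj (low A) h x) \<le> A powr (- s) * C / \<mu>"
proof (rule field_le_epsilon)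
  fix e :: real assume e: "e > 0"
  note L = Hs_ballD(1)[OF h]
  obtain F where F: "finite F" "F \<subseteq> dual_group" "low A \<subseteq> F" "l2 (\<lambda>x. h x - proj F h x) < e"
    using proj_approximation[OF L e finite_low[OF A] low_subset] by metis
  have "(\<Sum>\<xi>\<in>F - low A. (norm (fourier M h \<xi>))\<^sup>2)
      \<le> (\<Sum>\<xi>\<in>F - low A. A powr (- s) * (w \<xi> powr s * (norm (fourier M h \<xi>))\<^sup>2))"
  proof (rule sum_mono)
    fix \<xi> assume "\<xi> \<in> F - low A"
    then have "A < w \<xi>" using F(2) unfolding low_def by auto
    then have "A powr s \<le> w \<xi> powr s" using A s_nonneg by (intro powr_mono2) auto
    then have "1 \<le> A powr (- s) * w \<xi> powr s" using A by (simp add: powr_minus field_simps)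
    then have "1 * (norm (fourier M h \<xi>))\<^sup>2 \<le> (A powr (- s) * w \<xi> powr s) * (norm (fourier M h \<xi>))\<^sup>2"
      by (rule mult_right_mono) simp
    then show "(norm (fourier M h \<xi>))\<^sup>2 \<le> A powr (- s) * (w \<xi> powr s * (norm (fourier M h \<xi>))\<^sup>2)"
      by (simp add: mult.assoc)
  qed
  also have "\<dots> \<le> A powr (- s) * C"
    unfolding sum_distrib_left[symmetric] using F by (intro mult_left_mono Hs_ballD(2)[OF h]) auto
  finally have "(\<Sum>\<xi>\<in>F - low A. (norm (fourier M h \<xi>))\<^sup>2) / \<mu> \<le> A powr (- s) * C / \<mu>"
    using mu_pos by (simp add: divide_right_mono)
  moreover have "(\<Sum>\<xi>\<in>F. (norm (fourier M h \<xi>))\<^sup>2)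
      = (\<Sum>\<xi>\<in>F - low A. (norm (fourier M h \<xi>))\<^sup>2) + (\<Sum>\<xi>\<in>low A. (norm (fourier M h \<xi>))\<^sup>2)"
    by (rule sum.subset_diff[OF F(3,1)])
  ultimately show "l2 (\<lambda>x. h x - proj (low A) h x) \<le> A powr (- s) * C / \<mu> + e"
    using F(4) unfolding l2_minus_proj(2)[OF F(1,2) L] l2_minus_proj(2)[OF finite_low[OF A] low_subset L]
    by (simp add: add_divide_distrib)
qed

text \<open>Cauchy-Schwarz with the weights \<open>w \<xi> powr (s / 2)\<close> and
  \<open>w \<xi> powr (- s / 2)\<close>; on \<open>low A\<close> one has \<open>w \<xi> powr (- s)
  \<le> w \<xi> powr (- \<alpha>) * A powr (\<alpha> - s)\<close>, which brings in the summable
  weight.\<close>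

lemma norm_proj_low_le:
  assumes h: "Hs_ball C h" and A: "A > 0"
  shows "(\<mu> * norm (proj (low A) h x))\<^sup>2 \<le> C * (K * A powr (\<alpha> - s))"
proof -
  let ?L = "low A"
  have L: "finite ?L" "?L \<subseteq> dual_group" using finite_low[OF A] low_subset by auto
  have wpos: "w \<xi> > 0" if "\<xi> \<in> ?L" for \<xi> using w_ge[of \<xi>] that unfolding low_def by auto
  have "norm (proj ?L h x) \<le> (\<Sum>\<xi>\<in>?L. norm (fourier M h \<xi> / \<mu> * \<xi> x))"
    unfolding proj_def by (rule norm_sum)
  also have "\<dots> = (\<Sum>\<xi>\<in>?L. norm (fourier M h \<xi>)) / \<mu>"
    unfolding sum_divide_distrib
  proof (rule sum.cong[OF refl])
    fix \<xi> assume "\<xi> \<in> ?L"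
    then have "cmod (\<xi> x) = 1" using L(2) dual_groupD(3) by blast
    then show "norm (fourier M h \<xi> / \<mu> * \<xi> x) = norm (fourier M h \<xi>) / \<mu>"
      using mu_pos by (simp add: norm_mult norm_divide)
  qed
  finally have "\<mu> * norm (proj ?L h x) \<le> (\<Sum>\<xi>\<in>?L. norm (fourier M h \<xi>))"
    using mu_pos by (simp add: field_simps)
  then have "(\<mu> * norm (proj ?L h x))\<^sup>2 \<le> (\<Sum>\<xi>\<in>?L. norm (fourier M h \<xi>))\<^sup>2"
    using mu_pos by (intro power_mono) auto
  also have "(\<Sum>\<xi>\<in>?L. norm (fourier M h \<xi>))
      = (\<Sum>\<xi>\<in>?L. (w \<xi> powr (s / 2) * norm (fourier M h \<xi>)) * w \<xi> powr (- s / 2))"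
  proof (rule sum.cong[OF refl])
    fix \<xi> assume "\<xi> \<in> ?L"
    from wpos[OF this] have "w \<xi> powr (s / 2) * w \<xi> powr (- s / 2) = 1"
      by (simp flip: powr_add)
    then show "norm (fourier M h \<xi>) = (w \<xi> powr (s / 2) * norm (fourier M h \<xi>)) * w \<xi> powr (- s / 2)"
      by (metis mult.assoc mult.commute mult_1)
  qed
  also have "(\<Sum>\<xi>\<in>?L. (w \<xi> powr (s / 2) * norm (fourier M h \<xi>)) * w \<xi> powr (- s / 2))\<^sup>2
      \<le> (\<Sum>\<xi>\<in>?L. (w \<xi> powr (s / 2) * norm (fourier M h \<xi>))\<^sup>2) * (\<Sum>\<xi>\<in>?L. (w \<xi> powr (- s / 2))\<^sup>2)"
    by (rule Cauchy_Schwarz_ineq_sum)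
  also have "(\<Sum>\<xi>\<in>?L. (w \<xi> powr (s / 2) * norm (fourier M h \<xi>))\<^sup>2)
      = (\<Sum>\<xi>\<in>?L. w \<xi> powr s * (norm (fourier M h \<xi>))\<^sup>2)"
    by (intro sum.cong refl) (simp add: power_mult_distrib power2_eq_square flip: powr_add)
  also have "(\<Sum>\<xi>\<in>?L. (w \<xi> powr (- s / 2))\<^sup>2) = (\<Sum>\<xi>\<in>?L. w \<xi> powr (- s))"
    by (intro sum.cong refl) (simp add: power2_eq_square flip: powr_add)
  also have "(\<Sum>\<xi>\<in>?L. w \<xi> powr s * (norm (fourier M h \<xi>))\<^sup>2) * (\<Sum>\<xi>\<in>?L. w \<xi> powr (- s))
      \<le> C * (K * A powr (\<alpha> - s))"
  proof (rule mult_mono)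
    show le: "(\<Sum>\<xi>\<in>?L. w \<xi> powr s * (norm (fourier M h \<xi>))\<^sup>2) \<le> C"
      by (rule Hs_ballD(2)[OF h L])
    show "0 \<le> C" using Hs_ballD(2)[OF h, of "{}"] by simp
    have "(\<Sum>\<xi>\<in>?L. w \<xi> powr (- s)) \<le> (\<Sum>\<xi>\<in>?L. w \<xi> powr (- \<alpha>) * A powr (\<alpha> - s))"
    proof (rule sum_mono)
      fix \<xi> assume xi: "\<xi> \<in> ?L"
      then have "w \<xi> powr (\<alpha> - s) \<le> A powr (\<alpha> - s)"
        using wpos alpha_gt unfolding low_def by (intro powr_mono2) (auto simp: less_imp_le)
      then have "w \<xi> powr (- \<alpha>) * w \<xi> powr (\<alpha> - s) \<le> w \<xi> powr (- \<alpha>) * A powr (\<alpha> - s)"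
        by (intro mult_left_mono) auto
      then show "w \<xi> powr (- s) \<le> w \<xi> powr (- \<alpha>) * A powr (\<alpha> - s)"
        by (simp flip: powr_add)
    qed
    also have "\<dots> \<le> K * A powr (\<alpha> - s)"
      unfolding sum_distrib_right[symmetric] by (intro mult_right_mono weight_sum L) auto
    finally show "(\<Sum>\<xi>\<in>?L. w \<xi> powr (- s)) \<le> K * A powr (\<alpha> - s)" .
  qed (auto intro: sum_nonneg)
  finally show ?thesis .
qed

definition crit :: real where "crit = 2 * \<alpha> / (\<alpha> - s)"

text \<open>
  Splitting \<open>h\<close> at the frequency level \<open>A\<close> for which the low part is at most \<open>t / 2\<close> gives the
  endpoint embedding into weak \<open>L\<close> to the power \<open>2\<alpha> / (\<alpha> - s)\<close>.
\<close>

lemma weak_type_embedding: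
  assumes C: "C > 0"
  obtains D where "D \<ge> 0"
    "\<And>h t. Hs_ball C h \<Longrightarrow> t > 0 \<Longrightarrow> measure M {x \<in> space M. norm (h x) > t} \<le> D * t powr (- crit)"
proof -
  \<comment> \<open>Chosen so that, with \<open>A\<close> as defined below, the bound of
    \<open>norm_proj_low_le\<close> is exactly the square of \<open>\<mu> * (t / 2)\<close>.\<close>
  define b where "b = \<mu>\<^sup>2 / (4 * C * K)"
  have b: "b > 0" unfolding b_def using C K_pos mu_pos by simp
  define D where "D = 4 * C / \<mu> * b powr (- s / (\<alpha> - s))"
  have D: "D \<ge> 0" unfolding D_def using C mu_pos by simp
  show ?thesis
  proof (rule that[OF D])
    fix h :: "'a \<Rightarrow> complex" and t :: real
    assume h: "Hs_ball C h" and t: "t > 0"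
    define A where "A = (b * t\<^sup>2) powr (1 / (\<alpha> - s))"
    have A: "A > 0" unfolding A_def using b t by simp
    note L = Hs_ballD(1)[OF h]
    let ?g = "\<lambda>x. h x - proj (low A) h x"
    have Lg: "L2 ?g" by (rule l2_minus_proj(1)[OF finite_low[OF A] low_subset L])
    note [measurable] = L2_measurable[OF L] L2_measurable[OF Lg]
    have "C * (K * A powr (\<alpha> - s)) = (\<mu> * (t / 2))\<^sup>2"
      unfolding A_def b_def using alpha_gt C K_pos mu_pos t by (simp add: powr_powr field_simps power2_eq_square)
    then have "(\<mu> * norm (proj (low A) h x))\<^sup>2 \<le> (\<mu> * (t / 2))\<^sup>2" for x
      using norm_proj_low_le[OF h A, of x] by simp
    then have "\<mu> * norm (proj (low A) h x) \<le> \<mu> * (t / 2)" for x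
      by (rule power2_le_imp_le) (use mu_pos t in simp)
    then have small: "norm (proj (low A) h x) \<le> t / 2" for x using mu_pos by simp
    \<comment> \<open>Chebyshev: where \<open>h\<close> exceeds \<open>t\<close>, the low part
      accounts for at most \<open>t / 2\<close>, so the high part is at least
      \<open>t / 2\<close>.\<close>
    have sub: "indicator {x \<in> space M. norm (h x) > t} x \<le> (4 / t\<^sup>2) * (norm (?g x))\<^sup>2" for x
    proof (cases "norm (h x) > t")
      case True
      have "norm (h x) \<le> norm (?g x) + norm (proj (low A) h x)"
        using norm_triangle_ineq[of "?g x" "proj (low A) h x"] by simp
      then have "t / 2 \<le> norm (?g x)" using small[of x] True by linarith
      then have "(t / 2)\<^sup>2 \<le> (norm (?g x))\<^sup>2" using t by (intro power_mono) auto
      then show ?thesis using t True by (simp add: power_divide field_simps)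
    qed simp
    have "measure M {x \<in> space M. norm (h x) > t} = (LINT x|M. indicator {x \<in> space M. norm (h x) > t} x)"
      by simp
    also have "\<dots> \<le> (LINT x|M. (4 / t\<^sup>2) * (norm (?g x))\<^sup>2)"
    proof (rule integral_mono)
      show "integrable M (indicat_real {x \<in> space M. norm (h x) > t})"
        by (simp add: emeasure_eq_measure)
      show "integrable M (\<lambda>x. (4 / t\<^sup>2) * (norm (?g x))\<^sup>2)" using L2_integrable[OF Lg] by simp
    qed (rule sub)
    also have "\<dots> = (4 / t\<^sup>2) * l2 ?g" unfolding l2_def by simp
    also have "\<dots> \<le> (4 / t\<^sup>2) * (A powr (- s) * C / \<mu>)"
      by (intro mult_left_mono l2_minus_proj_low h A) simp
    \<comment> \<open>Chebyshev contributes the exponent -2 and \<open>A powr (- s)\<close>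
      contributes -2s / (\<alpha> - s); their sum is \<open>- crit\<close>.\<close>
    also have "\<dots> = D * t powr (- crit)"
    proof -
      have "(t powr 2) powr c = t powr (2 * c)" for c by (rule powr_powr)
      then have "t\<^sup>2 powr c = t powr (2 * c)" for c using t by simp
      then have A_powr: "A powr (- s) = b powr (- s / (\<alpha> - s)) * t powr (- 2 * s / (\<alpha> - s))"
        unfolding A_def using b t by (simp add: powr_powr powr_mult)
      have "- 2 - 2 * s / (\<alpha> - s) = - crit"
        unfolding crit_def using alpha_gt by (simp add: field_simps)
      then have t_powr: "t powr (- crit) = t powr (- 2) * t powr (- 2 * s / (\<alpha> - s))"
        by (simp flip: powr_add)
      have "4 / t\<^sup>2 = 4 * t powr (- 2)" using t by (simp add: powr_minus divide_inverse)
      then show ?thesis unfolding D_def A_powr t_powr by simp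
    qed
    finally show "measure M {x \<in> space M. norm (h x) > t} \<le> D * t powr (- crit)" .
  qed
qed

text \<open>\<open>T\<close> depends on the ball and on \<open>e\<close> but not on
  \<open>h\<close>, so mean square smallness becomes smallness of p-th powers. The summand
  \<open>e\<close> absorbs what \<open>l2\<close> does not control: values below \<open>T\<close>
  when \<open>p < 2\<close>, where the measure is finite, and values above \<open>T\<close>
  otherwise, where the weak-type tail applies.\<close>

lemma norm_powr_split:
  assumes C: "C > 0" and p: "1 \<le> p" "p < crit" and e: "e > 0"
  obtains T where "T > 0" "\<And>h. Hs_ball C h \<Longrightarrow>
    (\<integral>\<^sup>+x. ennreal (norm (h x) powr p) \<partial>M) \<le> ennreal (T powr (p - 2) * l2 h + e)"
proof -
  have sq: "(\<integral>\<^sup>+x. ennreal (T powr (p - 2) * (norm (h x))\<^sup>2) \<partial>M) = ennreal (T powr (p - 2) * l2 h)"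
    if "Hs_ball C h" for h T
    using nn_integral_eq_integral[of M "\<lambda>x. T powr (p - 2) * (norm (h x))\<^sup>2"]
      L2_integrable[OF Hs_ballD(1)[OF that]] by (simp add: l2_def)
  show ?thesis
  proof (cases "p < 2")
    case True
    define T where "T = (e / \<mu>) powr (1 / p)"
    have T: "T > 0" "T powr p = e / \<mu>"
      unfolding T_def using e mu_pos p by (simp_all add: powr_powr)
    show ?thesis
    proof (rule that[OF T(1)])
      fix h assume h: "Hs_ball C h"
      note [measurable] = L2_measurable[OF Hs_ballD(1)[OF h]]
      have "norm (h x) powr p \<le> T powr (p - 2) * (norm (h x))\<^sup>2 + T powr p" for x
      proof (cases "norm (h x) \<le> T")
        case True
        then have "norm (h x) powr p \<le> T powr p" using p by (intro powr_mono2) auto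
        then show ?thesis by (simp add: add_increasing)
      next
        case False
        then have pos: "norm (h x) > 0" using T(1) by linarith
        then have "norm (h x) powr p = norm (h x) powr (p - 2) * (norm (h x))\<^sup>2"
          by (rule powr_eq_powr_minus_two)
        also have "\<dots> \<le> T powr (p - 2) * (norm (h x))\<^sup>2"
          using False T(1) \<open>p < 2\<close> by (intro mult_right_mono powr_mono2') auto
        finally show ?thesis by (simp add: add_increasing2)
      qed
      then have "(\<integral>\<^sup>+x. ennreal (norm (h x) powr p) \<partial>M)
          \<le> (\<integral>\<^sup>+x. ennreal (T powr (p - 2) * (norm (h x))\<^sup>2) + ennreal (T powr p) \<partial>M)"
        by (intro nn_integral_mono) (simp flip: ennreal_plus)
      also have "\<dots> = ennreal (T powr (p - 2) * l2 h) + ennreal (T powr p) * ennreal \<mu>"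
        by (simp add: nn_integral_add sq[OF h] emeasure_UNIV)
      also have "\<dots> = ennreal (T powr (p - 2) * l2 h + e)"
        using T(2) mu_pos e by (simp add: ennreal_plus ennreal_mult[symmetric])
      finally show "(\<integral>\<^sup>+x. ennreal (norm (h x) powr p) \<partial>M) \<le> ennreal (T powr (p - 2) * l2 h + e)" .
    qed
  next
    case False
    obtain D where D: "D \<ge> 0" "\<And>h t. Hs_ball C h \<Longrightarrow> t > 0 \<Longrightarrow>
        measure M {x \<in> space M. norm (h x) > t} \<le> D * t powr (- crit)"
      using weak_type_embedding[OF C] by metis
    \<comment> \<open>The summand 1 keeps \<open>E\<close> positive when
      \<open>D = 0\<close>.\<close>
    define E where "E = D * 2 powr p / (1 - 2 powr (p - crit)) + 1"
    have r: "2 powr (p - crit) < (1::real)" using p by (simp add: powr_less_one)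
    have E: "E > 0" unfolding E_def using D(1) r by (intro add_nonneg_pos divide_nonneg_pos) auto
    \<comment> \<open>The exponent \<open>p - crit\<close> is negative: a smaller \<open>e\<close>
      calls for a larger threshold.\<close>
    define T where "T = (e / E) powr (1 / (p - crit))"
    have T: "T > 0" "T powr (p - crit) = e / E"
      unfolding T_def using e E p by (simp_all add: powr_powr)
    show ?thesis
    proof (rule that[OF T(1)])
      fix h assume h: "Hs_ball C h"
      note [measurable] = L2_measurable[OF Hs_ballD(1)[OF h]]
      have "ennreal (norm (h x) powr p) \<le> ennreal (T powr (p - 2) * (norm (h x))\<^sup>2)
          + ennreal (norm (h x) powr p) * indicator {y. y > T} (norm (h x))" for x
      proof (cases "norm (h x) \<le> T")
        case True
        have "norm (h x) powr p \<le> T powr (p - 2) * (norm (h x))\<^sup>2"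
        proof (cases "h x = 0")
          case False
          then have "norm (h x) powr p = norm (h x) powr (p - 2) * (norm (h x))\<^sup>2"
            by (intro powr_eq_powr_minus_two) simp
          also have "\<dots> \<le> T powr (p - 2) * (norm (h x))\<^sup>2"
            using True \<open>\<not> p < 2\<close> by (intro mult_right_mono powr_mono2) auto
          finally show ?thesis .
        qed simp
        then show ?thesis by (intro add_increasing2 ennreal_leI) auto
      qed simp
      then have "(\<integral>\<^sup>+x. ennreal (norm (h x) powr p) \<partial>M)
          \<le> (\<integral>\<^sup>+x. ennreal (T powr (p - 2) * (norm (h x))\<^sup>2)
            + ennreal (norm (h x) powr p) * indicator {y. y > T} (norm (h x)) \<partial>M)"
        by (intro nn_integral_mono)
      also have "\<dots> = ennreal (T powr (p - 2) * l2 h)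
          + (\<integral>\<^sup>+x. ennreal (norm (h x) powr p) * indicator {y. y > T} (norm (h x)) \<partial>M)"
        by (subst nn_integral_add) (simp_all add: sq[OF h])
      also have "\<dots> \<le> ennreal (T powr (p - 2) * l2 h)
          + ennreal (D * 2 powr p / (1 - 2 powr (p - crit)) * T powr (p - crit))"
        using p by (intro add_left_mono weak_type_tail D h T) auto
      also have "\<dots> \<le> ennreal (T powr (p - 2) * l2 h) + ennreal e"
      proof (intro add_left_mono ennreal_leI)
        have "D * 2 powr p / (1 - 2 powr (p - crit)) * T powr (p - crit) \<le> E * (e / E)"
          unfolding T(2) using e E by (intro mult_right_mono) (auto simp: E_def)
        then show "D * 2 powr p / (1 - 2 powr (p - crit)) * T powr (p - crit) \<le> e" using E by simp
      qed
      also have "\<dots> = ennreal (T powr (p - 2) * l2 h + e)" using e by (simp add: ennreal_plus)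
      finally show "(\<integral>\<^sup>+x. ennreal (norm (h x) powr p) \<partial>M) \<le> ennreal (T powr (p - 2) * l2 h + e)" .
    qed
  qed
qed

text \<open>
  For \<open>s = 0\<close> the weight gives no decay; but then all characters stay close to \<open>1\<close> on a common
  neighbourhood \<open>U\<close> of \<open>0\<close>, so the Fourier coefficients of the indicator of \<open>U\<close> are bounded below
  and Bessel's inequality makes the dual group finite.
\<close>

lemma finite_dual_group:
  assumes "s = 0"
  shows "finite (dual_group :: ('a \<Rightarrow> complex) set)"
proof -
  obtain U where U: "open U" "(0::'a) \<in> U"
    and le: "\<And>h \<xi>. h \<in> U \<Longrightarrow> \<xi> \<in> dual_group \<Longrightarrow> cmod (\<xi> h - 1) \<le> 1 / 2"
  proof -
    obtain U where U: "open U" "(0::'a) \<in> U"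
      "\<forall>h\<in>U. \<forall>\<xi>\<in>dual_group. cmod (\<xi> h - 1) / w \<xi> powr s \<le> 1 / 2"
      using cont_cond[of "1 / 2"] by auto
    have "cmod (\<xi> h - 1) \<le> 1 / 2" if "h \<in> U" "\<xi> \<in> dual_group" for h \<xi>
    proof -
      have "w \<xi> powr s = 1" using assms w_ge[OF that(2)] by simp
      then show ?thesis using U(3) that by fastforce
    qed
    with U show ?thesis using that by blast
  qed
  define m where "m = measure M U"
  have m: "m > 0" unfolding m_def using open_pos[OF U(1)] U(2) by (auto simp: emeasure_eq_measure)
  let ?f = "\<lambda>x. complex_of_real (indicator U x)"
  have sq: "(norm (?f x))\<^sup>2 = indicator U x" for x by (simp add: indicator_def)
  have iU: "integrable M (indicat_real U)" using U(1) by (simp add: emeasure_eq_measure)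
  have L: "L2 ?f" unfolding L2_def sq using U(1) iU by simp
  have l2U: "l2 ?f = m" unfolding l2_def sq using U(1) by (simp add: m_def)
  have lower: "m / 2 \<le> norm (fourier M ?f \<xi>)" if xi: "\<xi> \<in> dual_group" for \<xi>
  proof -
    note i = L2_mult_integrable[OF L2_dual_group(2)[OF xi] L]
    have "norm (complex_of_real m - fourier M ?f \<xi>) = norm (LINT x|M. ?f x - cnj (\<xi> x) * ?f x)"
      unfolding fourier_def using i iU U(1) by (simp add: m_def)
    also have "\<dots> \<le> (LINT x|M. norm (?f x - cnj (\<xi> x) * ?f x))" by (rule integral_norm_bound)
    also have "\<dots> \<le> (LINT x|M. 1 / 2 * indicator U x)"
    proof (rule integral_mono)
      show "integrable M (\<lambda>x. norm (?f x - cnj (\<xi> x) * ?f x))"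
        using i iU by (intro integrable_norm Bochner_Integration.integrable_diff) auto
      show "integrable M (\<lambda>x. 1 / 2 * indicat_real U x)" using iU by simp
      show "norm (?f x - cnj (\<xi> x) * ?f x) \<le> 1 / 2 * indicator U x" for x
      proof (cases "x \<in> U")
        case True
        have "norm (1 - cnj (\<xi> x)) = norm (\<xi> x - 1)"
          by (metis complex_cnj_diff complex_cnj_one complex_mod_cnj norm_minus_commute)
        then show ?thesis using le[OF True xi] True by simp
      qed simp
    qed
    also have "\<dots> = m / 2" using U(1) by (simp add: m_def)
    finally have "norm (complex_of_real m - fourier M ?f \<xi>) \<le> m / 2" .
    moreover have "m \<le> norm (complex_of_real m - fourier M ?f \<xi>) + norm (fourier M ?f \<xi>)"
      using norm_triangle_ineq[of "complex_of_real m - fourier M ?f \<xi>" "fourier M ?f \<xi>"] m by simp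
    ultimately show ?thesis by linarith
  qed
  have "card F \<le> nat \<lceil>4 * \<mu> / m\<rceil>"
    if F: "F \<subseteq> dual_group" "finite F" for F :: "('a \<Rightarrow> complex) set"
  proof -
    have "real (card F) * (m / 2)\<^sup>2 = (\<Sum>\<xi>\<in>F. (m / 2)\<^sup>2)" by simp
    also have "\<dots> \<le> (\<Sum>\<xi>\<in>F. (norm (fourier M ?f \<xi>))\<^sup>2)"
      using F lower m by (intro sum_mono power_mono) auto
    also have "\<dots> \<le> \<mu> * m" using Bessel[OF F(2,1) L] l2U by simp
    finally have "real (card F) \<le> 4 * \<mu> / m" using m by (simp add: field_simps power2_eq_square)
    then show ?thesis by linarith
  qed
  then show ?thesis using finite_if_finite_subsets_card_bdd by blast
qed

text \<open>One set of frequencies serves the whole ball. For positive \<open>s\<close> the level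
  \<open>A\<close> solves \<open>A powr (- s) * C / \<mu> = e\<close>, which is impossible in
  general for \<open>s = 0\<close>; hence the separate case.\<close>

lemma uniform_tail:
  assumes C: "C > 0" and e: "e > 0"
  obtains F where "finite F" "F \<subseteq> dual_group"
    "\<And>h. Hs_ball C h \<Longrightarrow> l2 (\<lambda>x. h x - proj F h x) \<le> e"
proof (cases "s = 0")
  case True
  note fin = finite_dual_group[OF True]
  show ?thesis
  proof (rule that[OF fin order_refl])
    fix h assume h: "Hs_ball C h"
    obtain F where "finite F" "F \<subseteq> dual_group" "dual_group \<subseteq> F" "l2 (\<lambda>x. h x - proj F h x) < e"
      using proj_approximation[OF Hs_ballD(1)[OF h] e fin order_refl] by metis
    then show "l2 (\<lambda>x. h x - proj dual_group h x) \<le> e" by (metis less_imp_le subset_antisym)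
  qed
next
  case False
  define A where "A = (\<mu> * e / C) powr (- 1 / s)"
  have A: "A > 0" "A powr (- s) = \<mu> * e / C"
    unfolding A_def using mu_pos e C False by (simp_all add: powr_powr)
  show ?thesis
  proof (rule that[OF finite_low[OF A(1)] low_subset])
    fix h assume "Hs_ball C h"
    from l2_minus_proj_low[OF this A(1)] show "l2 (\<lambda>x. h x - proj (low A) h x) \<le> e"
      using A(2) C mu_pos by simp
  qed
qed

section \<open>Extraction of the convergent subsequence\<close>

lemma Hs_ball_diff:
  assumes f: "Hs_ball C f" and g: "Hs_ball C g"
  shows "Hs_ball (4 * C) (\<lambda>x. f x - g x)"
  unfolding Hs_ball_def
proof (intro conjI allI impI)
  note Lf = Hs_ballD(1)[OF f] and Lg = Hs_ballD(1)[OF g]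
  show "L2 (\<lambda>x. f x - g x)" by (rule L2_diff(1)[OF Lf Lg])
  fix F :: "('a \<Rightarrow> complex) set" assume F: "finite F" "F \<subseteq> dual_group"
  have "(\<Sum>\<xi>\<in>F. w \<xi> powr s * (norm (fourier M (\<lambda>x. f x - g x) \<xi>))\<^sup>2)
      \<le> (\<Sum>\<xi>\<in>F. 2 * (w \<xi> powr s * (norm (fourier M f \<xi>))\<^sup>2) + 2 * (w \<xi> powr s * (norm (fourier M g \<xi>))\<^sup>2))"
  proof (rule sum_mono)
    fix \<xi> assume "\<xi> \<in> F"
    then have xi: "\<xi> \<in> dual_group" using F(2) by blast
    have "fourier M (\<lambda>x. f x - g x) \<xi> = fourier M f \<xi> + - fourier M g \<xi>"
      using fourier_lincomb[OF Lf Lg xi, of 1] by simp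
    then have "(norm (fourier M (\<lambda>x. f x - g x) \<xi>))\<^sup>2
        \<le> 2 * (norm (fourier M f \<xi>))\<^sup>2 + 2 * (norm (fourier M g \<xi>))\<^sup>2"
      using norm_square_add_le[of "fourier M f \<xi>" "- fourier M g \<xi>"] by simp
    then have "w \<xi> powr s * (norm (fourier M (\<lambda>x. f x - g x) \<xi>))\<^sup>2
        \<le> w \<xi> powr s * (2 * (norm (fourier M f \<xi>))\<^sup>2 + 2 * (norm (fourier M g \<xi>))\<^sup>2)"
      by (rule mult_left_mono) simp
    then show "w \<xi> powr s * (norm (fourier M (\<lambda>x. f x - g x) \<xi>))\<^sup>2
        \<le> 2 * (w \<xi> powr s * (norm (fourier M f \<xi>))\<^sup>2) + 2 * (w \<xi> powr s * (norm (fourier M g \<xi>))\<^sup>2)"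
      by (simp add: algebra_simps)
  qed
  also have "\<dots> \<le> 2 * C + 2 * C"
    unfolding sum.distrib sum_distrib_left[symmetric]
    using Hs_ballD(2)[OF f F] Hs_ballD(2)[OF g F] by linarith
  finally show "(\<Sum>\<xi>\<in>F. w \<xi> powr s * (norm (fourier M (\<lambda>x. f x - g x) \<xi>))\<^sup>2) \<le> 4 * C" by simp
qed

lemma L2_Cauchy_subsequence:
  fixes f :: "nat \<Rightarrow> 'a \<Rightarrow> complex"
  assumes C: "C > 0" and f: "\<And>n. Hs_ball C (f n)"
  obtains r :: "nat \<Rightarrow> nat" where "strict_mono r"
    "\<And>e. e > 0 \<Longrightarrow> \<exists>N. \<forall>m\<ge>N. \<forall>n\<ge>N. l2 (\<lambda>x. f (r m) x - f (r n) x) \<le> e"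
proof -
  \<comment> \<open>The diagonal argument needs each coefficient bounded along the sequence; since
    the weight is at least 1, a singleton in the ball condition gives this.\<close>
  have "norm (fourier M (f n) \<xi>) \<le> sqrt C" if xi: "\<xi> \<in> dual_group" for n \<xi>
  proof -
    have "1 * (norm (fourier M (f n) \<xi>))\<^sup>2 \<le> w \<xi> powr s * (norm (fourier M (f n) \<xi>))\<^sup>2"
      using w_ge[OF xi] s_nonneg by (intro mult_right_mono ge_one_powr_ge_zero) auto
    also have "\<dots> \<le> C" using Hs_ballD(2)[OF f[of n], of "{\<xi>}"] xi by simp
    finally show ?thesis by (simp add: real_le_rsqrt)
  qed
  then obtain r where r: "strict_mono r"
    and "\<And>\<xi>. \<xi> \<in> dual_group \<Longrightarrow> \<exists>l. (\<lambda>n. fourier M (f (r n)) \<xi>) \<longlonglongrightarrow> l"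
    using function_convergent_subsequence[OF countable_dual_group, of "\<lambda>n. fourier M (f n)" "sqrt C"]
    by metis
  then obtain l where l: "\<And>\<xi>. \<xi> \<in> dual_group \<Longrightarrow> (\<lambda>n. fourier M (f (r n)) \<xi>) \<longlonglongrightarrow> l \<xi>" by metis
  show ?thesis
  proof (rule that[OF r])
    fix e :: real assume e: "e > 0"
    \<comment> \<open>Differences of members lie in the ball of size \<open>4 * C\<close>, so the
      tail is controlled there.\<close>
    have "4 * C > 0" "e / 2 > 0" using C e by auto
    then obtain F where F: "finite F" "F \<subseteq> dual_group"
      and tail: "\<And>h. Hs_ball (4 * C) h \<Longrightarrow> l2 (\<lambda>x. h x - proj F h x) \<le> e / 2"
      using uniform_tail by metis
    define G where "G n = (\<Sum>\<xi>\<in>F. (norm (fourier M (f (r n)) \<xi> - l \<xi>))\<^sup>2)" for n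
    have "G \<longlonglongrightarrow> (\<Sum>\<xi>\<in>F. (norm (l \<xi> - l \<xi>))\<^sup>2)"
      unfolding G_def using F(2) by (intro tendsto_intros l) auto
    then have "G \<longlonglongrightarrow> 0" by simp
    \<comment> \<open>\<open>2 * G m + 2 * G n\<close> then stays below
      \<open>e * \<mu> / 2\<close>; after division by \<mu> the frequencies in \<open>F\<close> use
      the half of \<open>e\<close> left by the tail.\<close>
    moreover have "e * \<mu> / 8 > 0" using e mu_pos by simp
    ultimately have "\<forall>\<^sub>F n in sequentially. G n < e * \<mu> / 8" by (rule order_tendstoD)
    then obtain N where N: "\<And>n. n \<ge> N \<Longrightarrow> G n < e * \<mu> / 8" unfolding eventually_sequentially by blast
    have "l2 (\<lambda>x. f (r m) x - f (r n) x) \<le> e" if mn: "m \<ge> N" "n \<ge> N" for m n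
    proof -
      let ?h = "\<lambda>x. f (r m) x - f (r n) x"
      have h: "Hs_ball (4 * C) ?h" by (rule Hs_ball_diff[OF f f])
      have "(\<Sum>\<xi>\<in>F. (norm (fourier M ?h \<xi>))\<^sup>2)
          \<le> (\<Sum>\<xi>\<in>F. 2 * (norm (fourier M (f (r m)) \<xi> - l \<xi>))\<^sup>2 + 2 * (norm (fourier M (f (r n)) \<xi> - l \<xi>))\<^sup>2)"
      proof (rule sum_mono)
        fix \<xi> assume "\<xi> \<in> F"
        then have xi: "\<xi> \<in> dual_group" using F(2) by blast
        have "fourier M ?h \<xi> = (fourier M (f (r m)) \<xi> - l \<xi>) + - (fourier M (f (r n)) \<xi> - l \<xi>)"
          using fourier_lincomb[OF Hs_ballD(1)[OF f] Hs_ballD(1)[OF f] xi, of "r m" 1 "r n"] by simp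
        then show "(norm (fourier M ?h \<xi>))\<^sup>2
            \<le> 2 * (norm (fourier M (f (r m)) \<xi> - l \<xi>))\<^sup>2 + 2 * (norm (fourier M (f (r n)) \<xi> - l \<xi>))\<^sup>2"
          using norm_square_add_le[of "fourier M (f (r m)) \<xi> - l \<xi>" "- (fourier M (f (r n)) \<xi> - l \<xi>)"]
          by (simp only: norm_minus_cancel)
      qed
      also have "\<dots> = 2 * G m + 2 * G n" by (simp add: sum.distrib G_def sum_distrib_left)
      also have "\<dots> \<le> \<mu> * (e / 2)" using N[OF mn(1)] N[OF mn(2)] by (simp add: mult.commute)
      finally have "(\<Sum>\<xi>\<in>F. (norm (fourier M ?h \<xi>))\<^sup>2) / \<mu> \<le> e / 2"
        using mu_pos by (simp add: pos_divide_le_eq mult.commute)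
      then show ?thesis using tail[OF h] l2_minus_proj(2)[OF F Hs_ballD(1)[OF h]] by linarith
    qed
    then show "\<exists>N. \<forall>m\<ge>N. \<forall>n\<ge>N. l2 (\<lambda>x. f (r m) x - f (r n) x) \<le> e" by blast
  qed
qed

lemma compact_embedding:
  fixes f :: "nat \<Rightarrow> 'a \<Rightarrow> complex"
  assumes C: "C > 0" and f: "\<And>n. Hs_ball C (f n)" and p: "1 \<le> p" "p < crit"
  obtains r :: "nat \<Rightarrow> nat" and g where "strict_mono r" "in_Lp M p g"
    "(\<lambda>n. \<integral>\<^sup>+x. ennreal (cmod (f (r n) x - g x) powr p) \<partial>M) \<longlonglongrightarrow> 0"
proof -
  obtain r :: "nat \<Rightarrow> nat" where r: "strict_mono r"
    and cauchy: "\<And>e. e > 0 \<Longrightarrow> \<exists>N. \<forall>m\<ge>N. \<forall>n\<ge>N. l2 (\<lambda>x. f (r m) x - f (r n) x) \<le> e"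
    by (rule L2_Cauchy_subsequence[OF C f]) (rule that)
  have meas [measurable]: "f n \<in> borel_measurable M" for n
    by (rule L2_measurable[OF Hs_ballD(1)[OF f]])
  have C4: "4 * C > 0" using C by simp
  have Lp_cauchy: "\<exists>N. \<forall>m\<ge>N. \<forall>n\<ge>N.
      (\<integral>\<^sup>+x. ennreal (cmod (f (r m) x - f (r n) x) powr p) \<partial>M) \<le> ennreal e"
    if e: "e > 0" for e
  proof -
    have e2: "e / 2 > 0" using e by simp
    obtain T where T: "T > 0" and split: "\<And>h. Hs_ball (4 * C) h \<Longrightarrow>
        (\<integral>\<^sup>+x. ennreal (norm (h x) powr p) \<partial>M) \<le> ennreal (T powr (p - 2) * l2 h + e / 2)"
      by (rule norm_powr_split[OF C4 p e2]) (rule that)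
    have "e / 2 / T powr (p - 2) > 0" using e T by simp
    from cauchy[OF this] obtain N where N: "\<And>m n. m \<ge> N \<Longrightarrow> n \<ge> N \<Longrightarrow>
        l2 (\<lambda>x. f (r m) x - f (r n) x) \<le> e / 2 / T powr (p - 2)" by blast
    have "(\<integral>\<^sup>+x. ennreal (cmod (f (r m) x - f (r n) x) powr p) \<partial>M) \<le> ennreal e"
      if mn: "m \<ge> N" "n \<ge> N" for m n
    proof -
      have "T powr (p - 2) * l2 (\<lambda>x. f (r m) x - f (r n) x) \<le> e / 2"
        using N[OF mn] T by (simp add: field_simps)
      then have "ennreal (T powr (p - 2) * l2 (\<lambda>x. f (r m) x - f (r n) x) + e / 2) \<le> ennreal e"
        by (intro ennreal_leI) simp
      with split[OF Hs_ball_diff[OF f f]] show ?thesis by (rule order_trans)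
    qed
    then show ?thesis by blast
  qed
  obtain g where g [measurable]: "g \<in> borel_measurable M"
    and lim: "(\<lambda>n. \<integral>\<^sup>+x. ennreal (cmod (f (r n) x - g x) powr p) \<partial>M) \<longlonglongrightarrow> 0"
    by (rule Lp_complete[of "\<lambda>n. f (r n)", OF meas p(1) Lp_cauchy]) (assumption, rule that)
  \<comment> \<open>The limit lies in the target space because it is within distance 1, in p-th
    powers, of a single member, and that member is p-integrable by \<open>norm_powr_split\<close>
    with \<open>e = 1\<close>.\<close>
  have "\<forall>\<^sub>F n in sequentially. (\<integral>\<^sup>+x. ennreal (cmod (f (r n) x - g x) powr p) \<partial>M) < 1"
    using lim by (rule order_tendstoD) simp
  then obtain n where n: "(\<integral>\<^sup>+x. ennreal (cmod (f (r n) x - g x) powr p) \<partial>M) < 1"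
    unfolding eventually_sequentially by blast
  obtain T where "(\<integral>\<^sup>+x. ennreal (norm (f (r n) x) powr p) \<partial>M) \<le> ennreal (T powr (p - 2) * l2 (f (r n)) + 1)"
  proof (rule norm_powr_split[OF C p zero_less_one])
    fix T assume "\<And>h. Hs_ball C h \<Longrightarrow>
      (\<integral>\<^sup>+x. ennreal (norm (h x) powr p) \<partial>M) \<le> ennreal (T powr (p - 2) * l2 h + 1)"
    then show thesis using that f by blast
  qed
  then have fin: "(\<integral>\<^sup>+x. ennreal (norm (f (r n) x) powr p) \<partial>M) < \<infinity>"
    by (rule le_less_trans) simp
  have "cmod (g x) powr p \<le> 2 powr p * (cmod (f (r n) x) powr p + cmod (f (r n) x - g x) powr p)" for x
    using cmod_add_powr_le[of p "f (r n) x" "g x - f (r n) x"] p(1) by (simp add: norm_minus_commute)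
  then have "(\<integral>\<^sup>+x. ennreal (cmod (g x) powr p) \<partial>M)
      \<le> (\<integral>\<^sup>+x. ennreal (2 powr p) * (ennreal (cmod (f (r n) x) powr p) + ennreal (cmod (f (r n) x - g x) powr p)) \<partial>M)"
    by (intro nn_integral_mono) (simp flip: ennreal_plus ennreal_mult)
  also have "\<dots> = ennreal (2 powr p) * ((\<integral>\<^sup>+x. ennreal (cmod (f (r n) x) powr p) \<partial>M)
      + (\<integral>\<^sup>+x. ennreal (cmod (f (r n) x - g x) powr p) \<partial>M))"
    by (simp add: nn_integral_cmult nn_integral_add)
  also have "\<dots> < \<infinity>"
    using fin less_trans[OF n, of \<infinity>] by (simp add: ennreal_mult_less_top)
  finally have "in_Lp M p g" unfolding in_Lp_def by simp
  then show ?thesis using that r lim by blast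
qed

end

section \<open>From integrals over the dual group to finite sums\<close>

context compact_haar
begin

text \<open>Each character carries the mass 1 / \<mu>, so restricting the integral to
  \<open>F\<close> gives the finite sum at the cost of a factor \<mu>.\<close>

lemma dual_measure_sum_le:
  assumes le: "(\<integral>\<^sup>+ \<xi>. ennreal (g \<xi>) \<partial>dual_measure M) \<le> ennreal C" and C: "C \<ge> 0"
    and g: "\<And>\<xi>. 0 \<le> g \<xi>" and F: "finite F" "F \<subseteq> dual_group"
  shows "(\<Sum>\<xi>\<in>F. g \<xi>) \<le> \<mu> * C"
proof -
  have one: "1 / emeasure M UNIV = ennreal (1 / \<mu>)"
    unfolding emeasure_UNIV using divide_ennreal[of 1 \<mu>] mu_pos by simp
  have "ennreal ((\<Sum>\<xi>\<in>F. g \<xi>) / \<mu>) = (\<Sum>\<xi>\<in>F. ennreal (1 / \<mu>) * ennreal (g \<xi>))"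
    using mu_pos g by (simp add: sum_divide_distrib sum_ennreal flip: ennreal_mult)
  also have "\<dots> = (\<integral>\<^sup>+ \<xi>. ennreal (1 / \<mu>) * ennreal (g \<xi>) * indicator F \<xi> \<partial>count_space dual_group)"
    using F by (subst nn_integral_count_space'[of F]) (auto simp: indicator_def)
  also have "\<dots> \<le> (\<integral>\<^sup>+ \<xi>. ennreal (1 / \<mu>) * ennreal (g \<xi>) \<partial>count_space dual_group)"
    by (intro nn_integral_mono) (auto simp: indicator_def)
  also have "\<dots> = (\<integral>\<^sup>+ \<xi>. ennreal (g \<xi>) \<partial>dual_measure M)"
    unfolding dual_measure_def one by (subst nn_integral_density) auto
  finally have "ennreal ((\<Sum>\<xi>\<in>F. g \<xi>) / \<mu>) \<le> ennreal C" using le by (rule order_trans)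
  then have "(\<Sum>\<xi>\<in>F. g \<xi>) / \<mu> \<le> C" using C by (simp only: ennreal_le_iff)
  then show ?thesis using mu_pos by (simp add: pos_divide_le_eq mult.commute)
qed

end

lemma powr_two: "(x::real) \<ge> 0 \<Longrightarrow> x powr 2 = x\<^sup>2"
  by (cases "x = 0") simp_all

theorem theorem4:
  fixes M :: "'a::{topological_ab_group_add, t2_space} measure"
    and \<gamma> :: "('a \<Rightarrow> complex) \<Rightarrow> real"
    and s \<alpha> p :: real
    and f :: "nat \<Rightarrow> 'a \<Rightarrow> complex"
  assumes compact_G: "compact (UNIV :: 'a set)"
    and haar: "haar_measure M"
    and gamma: "Gamma_class \<gamma>"
    and s_nonneg: "0 \<le> s"
    and alpha_gt: "\<alpha> > s"
    and integrable_weight: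
      "(\<integral>\<^sup>+ \<xi>. ennreal (\<bar>(1 + (\<gamma> \<xi>)\<^sup>2) powr (-1)\<bar> powr \<alpha>) \<partial>dual_measure M) < \<infinity>"
    and cont_cond: "\<And>\<epsilon>. \<epsilon> > 0 \<Longrightarrow> \<exists>U. open U \<and> (0::'a) \<in> U \<and>
        (\<forall>h\<in>U. \<forall>\<xi>\<in>dual_group. cmod (\<xi> h - 1) / (1 + (\<gamma> \<xi>)\<^sup>2) powr s \<le> \<epsilon>)"
    and p_ge: "1 \<le> p"
    and p_lt: "p < 2 * \<alpha> / (\<alpha> - s)"
    and f_L2: "\<And>n. in_Lp M 2 (f n)"
    and f_bdd: "\<exists>C. \<forall>n. sobolev_norm_sq M \<gamma> s (f n) \<le> ennreal C"
  shows "\<exists>r g. strict_mono r \<and> in_Lp M p g \<and>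
           (\<lambda>n. \<integral>\<^sup>+ x. ennreal (cmod (f (r n) x - g x) powr p) \<partial>M) \<longlonglongrightarrow> 0"
proof -
  interpret compact_haar M by unfold_locales (fact compact_G haar)+
  define w where "w \<xi> = 1 + (\<gamma> \<xi>)\<^sup>2" for \<xi>
  have w: "w \<xi> \<ge> 1" for \<xi> by (simp add: w_def)
  obtain K0 where K0: "K0 \<ge> 0"
    "(\<integral>\<^sup>+ \<xi>. ennreal (\<bar>(1 + (\<gamma> \<xi>)\<^sup>2) powr (-1)\<bar> powr \<alpha>) \<partial>dual_measure M) = ennreal K0"
    using integrable_weight
    by (cases "\<integral>\<^sup>+ \<xi>. ennreal (\<bar>(1 + (\<gamma> \<xi>)\<^sup>2) powr (-1)\<bar> powr \<alpha>) \<partial>dual_measure M") auto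
  have "(\<Sum>\<xi>\<in>F. w \<xi> powr (- \<alpha>)) \<le> \<mu> * K0 + 1" if F: "finite F" "F \<subseteq> dual_group" for F
  proof -
    have "\<bar>(1 + (\<gamma> \<xi>)\<^sup>2) powr (-1)\<bar> powr \<alpha> = w \<xi> powr (- \<alpha>)" for \<xi>
      unfolding w_def by (simp only: abs_of_nonneg[OF powr_ge_zero] powr_powr) simp
    then show ?thesis
      using dual_measure_sum_le[OF eq_refl[OF K0(2)] K0(1) _ F] by simp
  qed
  \<comment> \<open>The summand 1 makes the constant strictly positive even if
    \<open>K0 = 0\<close>.\<close>
  then interpret sobolev_weight M w s \<alpha> "\<mu> * K0 + 1"
    using w s_nonneg alpha_gt cont_cond K0(1) mu_pos
    by unfold_locales (simp_all add: w_def add_nonneg_pos)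
  obtain C where C: "\<And>n. sobolev_norm_sq M \<gamma> s (f n) \<le> ennreal C" using f_bdd by blast
  \<comment> \<open>A negative \<open>C\<close> stands for the bound 0 because
    \<open>ennreal\<close> truncates, hence \<open>max C 0\<close>; the summand 1 gives a strictly
    positive radius.\<close>
  define B where "B = \<mu> * max C 0 + 1"
  have B: "B > 0" unfolding B_def using mu_pos by (intro add_nonneg_pos) auto
  have ball: "Hs_ball B (f n)" for n
    unfolding Hs_ball_def
  proof (intro conjI allI impI)
    have "f n \<in> borel_measurable M" "(\<integral>\<^sup>+ x. ennreal (norm ((cmod (f n x))\<^sup>2)) \<partial>M) < \<infinity>"
      using f_L2[of n] unfolding in_Lp_def by (simp_all add: powr_two)
    then show "L2 (f n)" unfolding L2_def by (simp add: integrable_iff_bounded)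
    fix F :: "('a \<Rightarrow> complex) set" assume F: "finite F" "F \<subseteq> dual_group"
    have "sobolev_norm_sq M \<gamma> s (f n) \<le> ennreal (max C 0)"
      using C[of n] by (rule order_trans) (simp add: ennreal_leI)
    from dual_measure_sum_le[OF this[unfolded sobolev_norm_sq_def] _ _ F]
    show "(\<Sum>\<xi>\<in>F. w \<xi> powr s * (norm (fourier M (f n) \<xi>))\<^sup>2) \<le> B"
      unfolding B_def w_def by simp
  qed
  show ?thesis
  proof (rule compact_embedding[OF B ball p_ge])
    show "p < crit" unfolding crit_def by (rule p_lt)
    fix r :: "nat \<Rightarrow> nat" and g
    assume "strict_mono r" "in_Lp M p g"
      "(\<lambda>n. \<integral>\<^sup>+x. ennreal (cmod (f (r n) x - g x) powr p) \<partial>M) \<longlonglongrightarrow> 0"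
    then show ?thesis by (intro exI conjI)
  qed
qed

end
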